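(* Let $(a,b)\subseteq\mathbb R$ be a bounded open interval. For every positive integer $k$ let $$\mathcal S_k((a,b)):=\left\{g\in L^1((a,b)):\ \sup_{\lambda>0}\mathcal M_k((a,b),g,\lambda)<+\infty\right\}.$$ Then, for every integer $k\ge2$, $$BV((a,b))=\mathcal S_1((a,b))\subsetneq\mathcal S_2((a,b))=\mathcal S_k((a,b))\subsetneq\bigcap_{s\in(0,1)}W^{s,1}((a,b)).$$
   Context: For $g\in L^1((a,b))$, a positive integer $k$, $\lambda>0$ and $\gamma\in C^k([a,b])$, set $$\mathcal F_k((a,b),g,\lambda,\gamma):=\frac1{\lambda^{k-1}}\int_a^b|\gamma^{(k)}(x)|\,dx+\lambda\int_a^b|\gamma(x)-g(x)|\,dx,$$ $$\mathcal M_k((a,b),g,\lambda):=\inf\{\mathcal F_k((a,b),g,\lambda,\gamma):\gamma\in C^k([a,b])\}.$$ For $s\in(0,1)$, $W^{s,1}((a,b))$ is the space of $g\in L^1((a,b))$ with $\int_a^b\int_a^b\frac{|g(y)-g(x)|}{|y-x|^{1+s}}\,dx\,dy<+\infty$. $BV((a,b))$ is the space of $L^1$ functions of bounded variation. *)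

theory Defs
  imports "HOL-Analysis.Analysis"
begin

text \<open>
  As usual in HOL-Analysis, an element of $L^1((a,b))$ is represented by a function
  \<open>real \<Rightarrow> real\<close>; values outside \<open>{a<..<b}\<close> and on null sets do not matter.
  Each function space below is a set of such representatives, closed under equality almost
  everywhere on \<open>{a<..<b}\<close>, so that equality and strict inclusion of these sets are those of
  the corresponding spaces of classes.
\<close>

definition L1 :: "real \<Rightarrow> real \<Rightarrow> (real \<Rightarrow> real) set" where
  "L1 a b = {g. g absolutely_integrable_on {a<..<b}}"

text \<open>The derivative of order \<open>k\<close> on the closed interval (one-sided at the end points).\<close>

definition deriv_on :: "real \<Rightarrow> real \<Rightarrow> nat \<Rightarrow> (real \<Rightarrow> real) \<Rightarrow> real \<Rightarrow> real" where
  "deriv_on a b k = ((\<lambda>f x. vector_derivative f (at x within {a..b})) ^^ k)"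

definition Ck :: "nat \<Rightarrow> real \<Rightarrow> real \<Rightarrow> (real \<Rightarrow> real) set" where
  "Ck k a b = {\<gamma>. (\<forall>i<k. deriv_on a b i \<gamma> differentiable_on {a..b}) \<and>
                  continuous_on {a..b} (deriv_on a b k \<gamma>)}"

definition F_fun ::
  "nat \<Rightarrow> real \<Rightarrow> real \<Rightarrow> (real \<Rightarrow> real) \<Rightarrow> real \<Rightarrow> (real \<Rightarrow> real) \<Rightarrow> real" where
  "F_fun k a b g lam \<gamma> =
     1 / lam ^ (k - 1) * (LINT x:{a<..<b}|lebesgue. \<bar>deriv_on a b k \<gamma> x\<bar>)
     + lam * (LINT x:{a<..<b}|lebesgue. \<bar>\<gamma> x - g x\<bar>)"

text \<open>
  For \<open>g \<in> L1 a b\<close> and \<open>lam > 0\<close> this is the infimum of a nonempty set of nonnegative reals,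
  since both integrals are finite for every \<open>\<gamma> \<in> Ck k a b\<close>.
\<close>

definition M_fun :: "nat \<Rightarrow> real \<Rightarrow> real \<Rightarrow> (real \<Rightarrow> real) \<Rightarrow> real \<Rightarrow> real" where
  "M_fun k a b g lam = (INF \<gamma>\<in>Ck k a b. F_fun k a b g lam \<gamma>)"

definition S_space :: "nat \<Rightarrow> real \<Rightarrow> real \<Rightarrow> (real \<Rightarrow> real) set" where
  "S_space k a b = {g \<in> L1 a b. bdd_above (M_fun k a b g ` {0<..})}"

text \<open>
  Bounded variation in the sense of $L^1$ functions: finiteness of
  $\sup \{\int_a^b g \varphi' : \varphi \in C^1_c((a,b)),\ |\varphi| \le 1\}$.
\<close>

definition C1c :: "real \<Rightarrow> real \<Rightarrow> (real \<Rightarrow> real) set" where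
  "C1c a b = {\<phi>. \<phi> C1_differentiable_on UNIV \<and> closure (support_on UNIV \<phi>) \<subseteq> {a<..<b}}"

definition BV :: "real \<Rightarrow> real \<Rightarrow> (real \<Rightarrow> real) set" where
  "BV a b = {g \<in> L1 a b. bdd_above
     ((\<lambda>\<phi>. LINT x:{a<..<b}|lebesgue. g x * deriv \<phi> x) ` {\<phi> \<in> C1c a b. \<forall>x. \<bar>\<phi> x\<bar> \<le> 1})}"

definition W_s1 :: "real \<Rightarrow> real \<Rightarrow> real \<Rightarrow> (real \<Rightarrow> real) set" where
  "W_s1 s a b = {g \<in> L1 a b.
     (\<integral>\<^sup>+ y\<in>{a<..<b}. (\<integral>\<^sup>+ x\<in>{a<..<b}.
        ennreal (\<bar>g y - g x\<bar> / \<bar>y - x\<bar> powr (1 + s)) \<partial>lebesgue) \<partial>lebesgue) < \<infinity>}"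

end

theory Submission
  imports Defs "HOL-Real_Asymp.Real_Asymp"
begin

text \<open>
  With $\varepsilon = 1/\lambda$, finiteness of the supremum says that $g$ has approximations
  $\gamma_\varepsilon$ with $\|\gamma_\varepsilon - g\| = O(\varepsilon)$ and
  $\|\gamma_\varepsilon^{(k)}\| = O(\varepsilon^{1-k})$ in $L^1$; only dyadic $\varepsilon$ matter.

  Lowering $k$ is a Marchaud argument: the interpolation inequality
  $\|u^{(j)}\| \lesssim \varepsilon^{-j}\|u\| + \varepsilon\|u^{(j+1)}\|$, applied to differences of
  consecutive dyadic approximations, gives increments of size $\varepsilon^{1-j}$, whose sum is again
  $O(\varepsilon^{1-j})$ for $j \ge 2$ and $O(\log(1/\varepsilon))$ for $j = 1$. The logarithmic bound
  suffices for $W^{s,1}$, on splitting $|x - y|$ dyadically. Raising $k$ is smoothing by repeated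
  averages over windows of radius $\varepsilon$, whose error is $O(\varepsilon^2\|\gamma''\|)$ by
  symmetry. For $BV$, duality with test functions bounds $\|g(\cdot + h) - g\|$ by a multiple of $h$.

  Since a function is bounded in terms of the $L^1$ norms of itself and its derivative, the mean of $|g|$ over
  an interval of length $\varepsilon$ at the left end point is $O(1)$ for $g \in S_1$ and
  $O(\log(1/\varepsilon))$ for $g \in S_2$. Hence $\log(x - a)$ is not in $S_1$ and
  $\log^2(x - a)$ is not in $S_2$.
\<close>

section \<open>Chains of derivatives on the real line\<close>

text \<open>The obstacle throughout is the boundary: functions in \<open>Ck\<close> live on [a,b],
  while differences, translations and averages leave it. Every approximation is therefore continued
  to the whole line, and the estimates keep only its behaviour on [a,b]. Why 2 is the threshold: the
  increments of the j-th derivative at level n have size 2^((j-1)n). For j >= 2 their sum is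
  dominated by its last term; for j = 1 the ratio is 1, all n levels contribute equally, and the
  logarithm appears. Why the averages are symmetric: for S_2 the first derivative is only controlled
  up to a factor n, so a first-order error would be of size n / 2^n. Cancelling the linear term
  leaves eps^2 times the norm of the second derivative, which is O(1/eps), hence exactly O(eps). Why
  no power of eps is lost when raising the order: every extra derivative turns one average into a
  central difference of cost 1/eps, except that one difference falls on a function whose derivative
  is already controlled and costs nothing.\<close>

definition derivs :: "nat \<Rightarrow> (nat \<Rightarrow> real \<Rightarrow> real) \<Rightarrow> bool" where
  "derivs k U \<longleftrightarrow> (\<forall>i<k. \<forall>x. (U i has_real_derivative U (Suc i) x) (at x)) \<and> continuous_on UNIV (U k)"

lemma derivs_D: "derivs k U \<Longrightarrow> i < k \<Longrightarrow> (U i has_real_derivative U (Suc i) x) (at x)"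
  by (simp add: derivs_def)

lemma derivs_continuous:
  assumes "derivs k U" "i \<le> k"
  shows "continuous_on UNIV (U i)"
proof (cases "i = k")
  case True
  then show ?thesis using assms by (simp add: derivs_def)
next
  case False
  then have "i < k" using assms by simp
  then show ?thesis
    using derivs_D[OF assms(1)] DERIV_isCont by (blast intro: continuous_at_imp_continuous_on)
qed

lemma derivs_le:
  assumes "derivs k U" "j \<le> k"
  shows "derivs j U"
  using assms derivs_continuous[OF assms] by (auto simp: derivs_def)

lemma derivs_diff:
  assumes "derivs k U" "derivs k V"
  shows "derivs k (\<lambda>i x. U i x - V i x)"
  using assms unfolding derivs_def by (auto intro!: derivative_intros continuous_intros)

lemma antiderivative_exists:
  fixes u :: "real \<Rightarrow> real"
  assumes "continuous_on UNIV u"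
  obtains P where "P c = y" "\<And>x. (P has_real_derivative u x) (at x)"
proof -
  obtain P0 where "P0 0 = 0" and P0: "\<And>x. (P0 has_vector_derivative u x) (at x)"
  proof -
    have "\<exists>F. F 0 = 0 \<and> (\<forall>x. (F has_vector_derivative u x) (at x))"
    proof -
      define F where "F x = (if 0 \<le> x then integral {0..x} u else - integral {x..0} u)" for x
      have F: "(F has_vector_derivative u x) (at x)" for x
      proof -
        \<comment> \<open>\<open>m\<close> lies to the left of both 0 and x, so near x the two
          branches of \<open>F\<close> are the single function "integral from m" minus a constant,
          to which the fundamental theorem applies.\<close>
        define m where "m = - (\<bar>x\<bar> + 1)"
        have m: "m < x" "m < 0" "x < \<bar>x\<bar> + 1" by (auto simp: m_def)
        have c: "continuous_on {m..\<bar>x\<bar>+1} u" using assms continuous_on_subset by blast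
        have "((\<lambda>y. integral {m..y} u) has_vector_derivative u x) (at x within {m..\<bar>x\<bar>+1})"
          by (rule integral_has_vector_derivative[OF c]) (use m in auto)
        then have 1: "((\<lambda>y. integral {m..y} u) has_vector_derivative u x) (at x)"
          using at_within_Icc_at[of m x "\<bar>x\<bar>+1"] m by simp
        have 2: "integral {m..y} u - integral {m..0} u = F y" if y: "y \<in> {m<..}" for y
        proof (cases "0 \<le> y")
          case True
          have "integral {m..0} u + integral {0..y} u = integral {m..y} u"
            by (rule Henstock_Kurzweil_Integration.integral_combine)
               (use True m in \<open>auto intro!: integrable_continuous_real continuous_on_subset[OF assms]\<close>)
          then show ?thesis using True by (simp add: F_def)
        next
          case False
          have "integral {m..y} u + integral {y..0} u = integral {m..0} u"
            by (rule Henstock_Kurzweil_Integration.integral_combine)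
               (use False m y in \<open>auto intro!: integrable_continuous_real continuous_on_subset[OF assms]\<close>)
          then show ?thesis using False by (simp add: F_def)
        qed
        have "((\<lambda>y. integral {m..y} u - integral {m..0} u) has_vector_derivative u x - 0) (at x)"
          by (intro derivative_intros 1)
        then have "((\<lambda>y. integral {m..y} u - integral {m..0} u) has_vector_derivative u x) (at x)" by simp
        then show ?thesis
          by (rule has_vector_derivative_transform_within_open[where S="{m<..}"]) (use m 2 in auto)
      qed
      moreover have "F 0 = 0" by (simp add: F_def)
      ultimately show ?thesis by blast
    qed
    then show ?thesis using that by blast
  qed
  have "((\<lambda>x. P0 x - P0 c + y) has_real_derivative u x) (at x)" for x
    using P0[of x, folded has_real_derivative_iff_has_vector_derivative]
    by (auto intro!: derivative_eq_intros)
  then show ?thesis by (intro that[of "\<lambda>x. P0 x - P0 c + y"]) auto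
qed

section \<open>Continuation from the interval to the whole line\<close>

definition clamp1 :: "real \<Rightarrow> real \<Rightarrow> real \<Rightarrow> real" where
  "clamp1 a b x = max a (min b x)"

lemma clamp1_cont: "continuous_on S (clamp1 a b)"
  unfolding clamp1_def by (intro continuous_intros)

lemma clamp1_in: "a \<le> b \<Longrightarrow> clamp1 a b x \<in> {a..b}"
  by (auto simp: clamp1_def)

lemma clamp1_id: "x \<in> {a..b} \<Longrightarrow> clamp1 a b x = x"
  by (auto simp: clamp1_def)

lemma continuous_clamp1:
  assumes "a \<le> b" "continuous_on {a..b} u"
  shows "continuous_on UNIV (\<lambda>x. u (clamp1 a b x))"
  by (rule continuous_on_compose2[OF assms(2) clamp1_cont]) (use clamp1_in[OF assms(1)] in auto)

lemma deriv_on_0: "deriv_on a b 0 f = f"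
  and deriv_on_Suc: "deriv_on a b (Suc i) f x = vector_derivative (deriv_on a b i f) (at x within {a..b})"
  by (simp_all add: deriv_on_def)

lemma vector_derivative_within_cong:
  assumes "x \<in> S" "\<And>y. y \<in> S \<Longrightarrow> f y = g y"
  shows "vector_derivative f (at x within S) = vector_derivative g (at x within S)"
  unfolding vector_derivative_def
  by (rule arg_cong[where f = Eps])
     (use assms in \<open>auto intro!: ext has_vector_derivative_cong_ev simp: has_vector_derivative_cong_ev\<close>)

text \<open>\<open>vector_derivative\<close> is a choice, and it is determined here because every
  point of a nondegenerate interval is a limit point of it. Hence values on {a..b} alone fix all
  \<open>deriv_on\<close>, end points included.\<close>

lemma deriv_on_eq_derivs:
  assumes "a < b" "derivs k U" "\<And>x. x \<in> {a..b} \<Longrightarrow> \<gamma> x = U 0 x" "i \<le> k" "x \<in> {a..b}"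
  shows "deriv_on a b i \<gamma> x = U i x"
  using assms(4,5)
proof (induction i arbitrary: x)
  case 0
  then show ?case using assms(3) by (simp add: deriv_on_0)
next
  case (Suc i)
  have "vector_derivative (deriv_on a b i \<gamma>) (at x within {a..b}) = vector_derivative (U i) (at x within {a..b})"
    by (rule vector_derivative_within_cong) (use Suc in auto)
  also have "\<dots> = U (Suc i) x"
  proof (rule vector_derivative_within)
    show "at x within {a..b} \<noteq> bot" using Suc.prems assms(1) by (simp add: trivial_limit_within islimpt_Icc)
    show "(U i has_vector_derivative U (Suc i) x) (at x within {a..b})"
      using derivs_D[OF assms(2), of i x] Suc.prems
      by (auto simp: has_real_derivative_iff_has_vector_derivative intro: has_vector_derivative_at_within)
  qed
  finally show ?case by (simp add: deriv_on_Suc)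
qed

lemma derivs_imp_Ck:
  assumes "a < b" "derivs k U"
  shows "U 0 \<in> Ck k a b"
proof -
  have eq: "deriv_on a b i (U 0) x = U i x" if "i \<le> k" "x \<in> {a..b}" for i x
    using deriv_on_eq_derivs[OF assms, of "U 0"] that by blast
  have "deriv_on a b i (U 0) differentiable_on {a..b}" if "i < k" for i
    unfolding differentiable_on_def
  proof
    fix x assume x: "x \<in> {a..b}"
    have "(U i has_derivative (*) (U (Suc i) x)) (at x within {a..b})"
      using derivs_D[OF assms(2) that, of x] has_field_derivative_def has_derivative_at_withinI by blast
    then have "(deriv_on a b i (U 0) has_derivative (*) (U (Suc i) x)) (at x within {a..b})"
      by (rule has_derivative_transform[rotated 2]) (use x eq that in auto)
    then show "deriv_on a b i (U 0) differentiable at x within {a..b}" unfolding differentiable_def by blast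
  qed
  moreover have "continuous_on {a..b} (deriv_on a b k (U 0))"
    using continuous_on_cong[of "{a..b}" "{a..b}" "deriv_on a b k (U 0)" "U k"] eq
      continuous_on_subset[OF derivs_continuous[OF assms(2), of k]] by auto
  ultimately show ?thesis by (simp add: Ck_def)
qed

text \<open>The derivative of order \<open>k\<close> is extended by constants and then integrated back, which
  extends \<open>\<gamma>\<close> by its Taylor polynomials at the end points.\<close>

lemma derivs_extend:
  assumes "a < b"
    "\<And>i x. i < k \<Longrightarrow> x \<in> {a..b} \<Longrightarrow> (V i has_real_derivative V (Suc i) x) (at x within {a..b})"
    "continuous_on {a..b} (V k)"
  shows "\<exists>U. derivs k U \<and> (\<forall>i\<le>k. \<forall>x\<in>{a..b}. U i x = V i x)"
  using assms(2,3)
proof (induction k arbitrary: V)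
  case 0
  show ?case
    using continuous_clamp1[OF less_imp_le[OF assms(1)] 0(2)] clamp1_id
    by (intro exI[of _ "\<lambda>i x. V i (clamp1 a b x)"]) (auto simp: derivs_def)
next
  case (Suc k)
  have "\<exists>U. derivs k U \<and> (\<forall>i\<le>k. \<forall>x\<in>{a..b}. U i x = V (Suc i) x)"
    using Suc.IH[of "\<lambda>i. V (Suc i)"] Suc.prems by auto
  then obtain U where U: "derivs k U" "\<And>i x. i \<le> k \<Longrightarrow> x \<in> {a..b} \<Longrightarrow> U i x = V (Suc i) x" by blast
  obtain P where P: "P a = V 0 a" "\<And>x. (P has_real_derivative U 0 x) (at x)"
    using antiderivative_exists[OF derivs_continuous[OF U(1)], of 0] by auto
  have PV: "P x = V 0 x" if x: "x \<in> {a..b}" for x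
  proof -
    have "P x - V 0 x = P a - V 0 a"
    proof (rule has_derivative_zero_unique[of "{a..b}" "\<lambda>x. P x - V 0 x"])
      show "((\<lambda>x. P x - V 0 x) has_derivative (\<lambda>h. 0)) (at y within {a..b})" if y: "y \<in> {a..b}" for y
      proof -
        have "((\<lambda>x. P x - V 0 x) has_real_derivative U 0 y - V (Suc 0) y) (at y within {a..b})"
          by (rule derivative_intros DERIV_subset[OF P(2)] Suc.prems(1) y subset_UNIV | simp)+
        then show ?thesis using U(2)[of 0 y] y by (simp add: has_field_derivative_def lambda_zero)
      qed
    qed (use x assms(1) in auto)
    then show ?thesis using P by simp
  qed
  show ?case
  proof (intro exI conjI)
    show "derivs (Suc k) (\<lambda>i. case i of 0 \<Rightarrow> P | Suc j \<Rightarrow> U j)"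
      using U(1) P(2) by (auto simp: derivs_def split: nat.split)
    show "\<forall>i\<le>Suc k. \<forall>x\<in>{a..b}. (case i of 0 \<Rightarrow> P | Suc j \<Rightarrow> U j) x = V i x"
      using U(2) PV by (auto split: nat.split)
  qed
qed

lemma Ck_imp_derivs:
  assumes "a < b" "\<gamma> \<in> Ck k a b"
  obtains U where "derivs k U" "\<And>x. x \<in> {a..b} \<Longrightarrow> \<gamma> x = U 0 x"
proof -
  have "(deriv_on a b i \<gamma> has_real_derivative deriv_on a b (Suc i) \<gamma> x) (at x within {a..b})"
    if "i < k" "x \<in> {a..b}" for i x
  proof -
    have "deriv_on a b i \<gamma> differentiable at x within {a..b}"
      using assms that by (auto simp: Ck_def differentiable_on_def)
    then show ?thesis
      using vector_derivative_works
      by (auto simp: deriv_on_Suc has_real_derivative_iff_has_vector_derivative)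
  qed
  then have "\<exists>U. derivs k U \<and> (\<forall>i\<le>k. \<forall>x\<in>{a..b}. U i x = deriv_on a b i \<gamma> x)"
    using assms by (intro derivs_extend) (auto simp: Ck_def)
  then obtain U where "derivs k U" "\<forall>i\<le>k. \<forall>x\<in>{a..b}. U i x = deriv_on a b i \<gamma> x" by blast
  then show ?thesis using that[of U] by (force simp: deriv_on_0)
qed

section \<open>The spaces $S_k$ in terms of dyadic approximations\<close>

text \<open>Values in \<open>ennreal\<close> let all estimates be added and compared without
  integrability side conditions; \<open>lborel\<close> gives access to Tonelli and translation
  invariance.\<close>

definition L1_norm :: "real set \<Rightarrow> (real \<Rightarrow> real) \<Rightarrow> ennreal" where
  "L1_norm S u = (\<integral>\<^sup>+x\<in>S. ennreal \<bar>u x\<bar> \<partial>lborel)"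

lemma L1_norm_mono:
  assumes "\<And>x. x \<in> S \<Longrightarrow> \<bar>u x\<bar> \<le> \<bar>v x\<bar>"
  shows "L1_norm S u \<le> L1_norm S v"
  unfolding L1_norm_def
  by (intro nn_integral_mono) (use assms in \<open>auto simp: indicator_def intro: ennreal_leI\<close>)

lemma L1_norm_cong:
  assumes "\<And>x. x \<in> S \<Longrightarrow> u x = v x"
  shows "L1_norm S u = L1_norm S v"
  using assms by (intro antisym L1_norm_mono) auto

lemma L1_norm_subset: "S \<subseteq> T \<Longrightarrow> L1_norm S u \<le> L1_norm T u"
  unfolding L1_norm_def by (intro nn_integral_mono) (auto simp: indicator_def)

lemma L1_norm_UNIV: "L1_norm UNIV u = (\<integral>\<^sup>+x. ennreal \<bar>u x\<bar> \<partial>lborel)"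
  by (simp add: L1_norm_def)

lemma L1_norm_triangle:
  assumes [measurable]: "u \<in> borel_measurable borel" "v \<in> borel_measurable borel" "S \<in> sets borel"
    and w: "\<And>x. x \<in> S \<Longrightarrow> \<bar>w x\<bar> \<le> \<bar>u x\<bar> + \<bar>v x\<bar>"
  shows "L1_norm S w \<le> L1_norm S u + L1_norm S v"
proof -
  have "L1_norm S w \<le> (\<integral>\<^sup>+x. ennreal \<bar>u x\<bar> * indicator S x + ennreal \<bar>v x\<bar> * indicator S x \<partial>lborel)"
    unfolding L1_norm_def
    by (intro nn_integral_mono)
       (use w in \<open>auto simp: indicator_def ennreal_plus[symmetric] simp del: ennreal_plus intro: ennreal_leI\<close>)
  also have "\<dots> = L1_norm S u + L1_norm S v"
    unfolding L1_norm_def by (rule nn_integral_add) auto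
  finally show ?thesis .
qed

lemma L1_norm_cmult:
  assumes [measurable]: "u \<in> borel_measurable borel" "S \<in> sets borel"
  shows "L1_norm S (\<lambda>x. c * u x) = ennreal \<bar>c\<bar> * L1_norm S u"
  unfolding L1_norm_def
  by (subst nn_integral_cmult[symmetric]) (auto simp: abs_mult ennreal_mult mult.assoc)

lemma L1_norm_continuous:
  assumes "continuous_on {a..b} u"
  shows "L1_norm {a..b} u = ennreal (integral {a..b} (\<lambda>x. \<bar>u x\<bar>))"
  unfolding L1_norm_def
  by (rule nn_integral_has_integral_lebesgue')
     (auto intro!: integrable_integral integrable_continuous_real continuous_intros assms)

lemma L1_norm_continuous_finite:
  "continuous_on {a..b} u \<Longrightarrow> L1_norm {a..b} u < \<infinity>"
  by (simp add: L1_norm_continuous)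

text \<open>Passes from the Lebesgue completion to Borel functions. Vanishing off the open interval
  makes translates g'(x + h) meaningful on the whole line.\<close>

definition borel_version :: "real \<Rightarrow> real \<Rightarrow> (real \<Rightarrow> real) \<Rightarrow> (real \<Rightarrow> real) \<Rightarrow> bool" where
  "borel_version a b g g' \<longleftrightarrow> integrable lborel g' \<and> (\<forall>x. x \<notin> {a<..<b} \<longrightarrow> g' x = 0) \<and>
     (AE x in lborel. x \<in> {a<..<b} \<longrightarrow> g x = g' x)"

lemma borel_version_exists:
  assumes "g \<in> L1 a b"
  obtains g' where "borel_version a b g g'"
proof -
  have i: "integrable lebesgue (\<lambda>x. indicator {a<..<b} x *\<^sub>R g x)"
    using assms unfolding L1_def set_integrable_def by simp
  then obtain h where h[measurable]: "h \<in> borel_measurable borel"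
    and ae: "AE x in lborel. indicator {a<..<b} x *\<^sub>R g x = h x"
    using completion_ex_borel_measurable_real[OF borel_measurable_integrable[OF i]] by auto
  have "integrable lebesgue h"
    by (rule integrable_cong_AE_imp[OF i])
       (use ae h in \<open>auto intro: AE_completion measurable_completion simp: eq_commute\<close>)
  then have hi: "integrable lborel h"
    using h by (simp add: integrable_completion)
  have "borel_version a b g (\<lambda>x. indicator {a<..<b} x *\<^sub>R h x)"
    unfolding borel_version_def
  proof (intro conjI)
    show "integrable lborel (\<lambda>x. indicator {a<..<b} x *\<^sub>R h x)"
      using hi by (rule integrable_mult_indicator[rotated]) simp
    show "AE x in lborel. x \<in> {a<..<b} \<longrightarrow> g x = indicator {a<..<b} x *\<^sub>R h x"
      using ae by eventually_elim auto
  qed auto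
  then show ?thesis by (rule that)
qed

lemma borel_version_measurable: "borel_version a b g g' \<Longrightarrow> g' \<in> borel_measurable borel"
  unfolding borel_version_def using borel_measurable_integrable by force

lemma borel_version_finite: "borel_version a b g g' \<Longrightarrow> L1_norm UNIV g' < \<infinity>"
  unfolding borel_version_def L1_norm_UNIV by (auto simp: integrable_iff_bounded)

lemma AE_endpoints: "AE x in lborel. x \<noteq> (a::real) \<and> x \<noteq> b"
  using AE_lborel_singleton[of a] AE_lborel_singleton[of b] by eventually_elim auto

text \<open>Finiteness excludes the case in which the Bochner integral is 0 by convention; the two
  end points form a null set.\<close>

lemma LINT_eq_L1_norm:
  assumes f'[measurable]: "f' \<in> borel_measurable borel"
    and ae: "AE x in lborel. x \<in> {a<..<b} \<longrightarrow> f x = f' x"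
    and fin: "L1_norm {a..b} f' < \<infinity>"
  shows "ennreal (LINT x:{a<..<b}|lebesgue. \<bar>f x\<bar>) = L1_norm {a..b} f'"
proof -
  have ae1: "AE x in lborel. indicator {a<..<b} x *\<^sub>R \<bar>f' x\<bar> = indicator {a<..<b} x *\<^sub>R \<bar>f x\<bar>"
    using ae by eventually_elim (auto simp: indicator_def)
  have m: "(\<lambda>x. indicator {a<..<b} x *\<^sub>R \<bar>f' x\<bar>) \<in> borel_measurable lebesgue"
    by (rule measurable_completion) simp
  have "(LINT x:{a<..<b}|lebesgue. \<bar>f x\<bar>) = (LINT x|lebesgue. indicator {a<..<b} x *\<^sub>R \<bar>f' x\<bar>)"
    unfolding set_lebesgue_integral_def
  proof (rule integral_cong_AE)
    show "(\<lambda>x. indicator {a<..<b} x *\<^sub>R \<bar>f x\<bar>) \<in> borel_measurable lebesgue"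
      by (rule borel_measurable_AE[OF m AE_completion[OF ae1]])
    show "AE x in lebesgue. indicator {a<..<b} x *\<^sub>R \<bar>f x\<bar> = indicator {a<..<b} x *\<^sub>R \<bar>f' x\<bar>"
      using AE_completion[OF ae1] by eventually_elim (rule sym)
  qed (rule m)
  also have "\<dots> = (LINT x|lborel. indicator {a<..<b} x *\<^sub>R \<bar>f' x\<bar>)"
    by (rule integral_completion) simp
  also have "\<dots> = enn2real (\<integral>\<^sup>+x. ennreal (indicator {a<..<b} x *\<^sub>R \<bar>f' x\<bar>) \<partial>lborel)"
    by (rule integral_eq_nn_integral) auto
  also have "(\<integral>\<^sup>+x. ennreal (indicator {a<..<b} x *\<^sub>R \<bar>f' x\<bar>) \<partial>lborel) = L1_norm {a..b} f'"
    unfolding L1_norm_def using AE_endpoints[of a b]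
    by (intro nn_integral_cong_AE, eventually_elim) (auto simp: indicator_def)
  finally show ?thesis using fin by simp
qed

lemma LINT_abs_nonneg: "0 \<le> (LINT x:S|M. \<bar>f x\<bar> :: real)"
  unfolding set_lebesgue_integral_def by (intro integral_nonneg_AE) auto

lemma L1_norm_diff_finite:
  assumes "borel_version a b g g'" "continuous_on UNIV u"
  shows "L1_norm {a..b} (\<lambda>x. u x - g' x) < \<infinity>"
proof -
  have "L1_norm {a..b} (\<lambda>x. u x - g' x) \<le> L1_norm {a..b} u + L1_norm {a..b} g'"
    by (rule L1_norm_triangle)
       (auto intro: borel_measurable_continuous_onI assms(2) borel_version_measurable[OF assms(1)])
  also have "L1_norm {a..b} g' \<le> L1_norm UNIV g'" by (rule L1_norm_subset) simp
  finally have "L1_norm {a..b} (\<lambda>x. u x - g' x) \<le> L1_norm {a..b} u + L1_norm UNIV g'"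
    by (simp add: add_left_mono)
  also have "\<dots> < \<infinity>"
    using borel_version_finite[OF assms(1)] L1_norm_continuous_finite[OF continuous_on_subset[OF assms(2)], of a b]
    by simp
  finally show ?thesis .
qed

text \<open>The reals \<open>p\<close> and \<open>q\<close> do not depend on \<open>lam\<close>, so
  bounds on the functional and bounds on the two norms translate into each other by
  arithmetic.\<close>

lemma F_fun_derivs:
  assumes "a < b" "borel_version a b g g'" "derivs k U" "\<And>x. x \<in> {a..b} \<Longrightarrow> \<gamma> x = U 0 x"
  obtains p q where "0 \<le> p" "0 \<le> q" "L1_norm {a..b} (U k) = ennreal p"
    "L1_norm {a..b} (\<lambda>x. U 0 x - g' x) = ennreal q"
    "\<And>lam. F_fun k a b g lam \<gamma> = 1 / lam ^ (k - 1) * p + lam * q"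
proof -
  have c: "continuous_on UNIV (U i)" if "i \<le> k" for i using derivs_continuous[OF assms(3) that] .
  have m[measurable]: "U i \<in> borel_measurable borel" if "i \<le> k" for i
    using c[OF that] by (rule borel_measurable_continuous_onI)
  have [measurable]: "g' \<in> borel_measurable borel" using borel_version_measurable[OF assms(2)] .
  have 1: "ennreal (LINT x:{a<..<b}|lebesgue. \<bar>deriv_on a b k \<gamma> x\<bar>) = L1_norm {a..b} (U k)"
    by (rule LINT_eq_L1_norm)
       (use deriv_on_eq_derivs[OF assms(1,3,4)] L1_norm_continuous_finite[OF continuous_on_subset[OF c]] in auto)
  have 2: "ennreal (LINT x:{a<..<b}|lebesgue. \<bar>\<gamma> x - g x\<bar>) = L1_norm {a..b} (\<lambda>x. U 0 x - g' x)"
  proof (rule LINT_eq_L1_norm)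
    show "AE x in lborel. x \<in> {a<..<b} \<longrightarrow> \<gamma> x - g x = U 0 x - g' x"
      using assms(2) unfolding borel_version_def
      by (elim conjE, elim eventually_mono) (use assms(4) in auto)
  qed (use L1_norm_diff_finite[OF assms(2) c[of 0]] m[of 0] in auto)
  show ?thesis
    using LINT_abs_nonneg[of lebesgue "{a<..<b}" "deriv_on a b k \<gamma>"] LINT_abs_nonneg[of lebesgue "{a<..<b}" "\<lambda>x. \<gamma> x - g x"]
    by (rule that[OF _ _ 1[symmetric] 2[symmetric]]) (simp add: F_fun_def)
qed

section \<open>Near-minimisers at dyadic parameters\<close>

lemma Ck_0: "a < b \<Longrightarrow> (\<lambda>x. 0) \<in> Ck k a b"
  using derivs_imp_Ck[of a b k "\<lambda>i x. 0"] by (simp add: derivs_def)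

lemma F_fun_nonneg: "0 < lam \<Longrightarrow> 0 \<le> F_fun k a b g lam \<gamma>"
  unfolding F_fun_def by (intro add_nonneg_nonneg mult_nonneg_nonneg LINT_abs_nonneg) auto

lemma M_fun_le:
  assumes "0 < lam" "\<gamma> \<in> Ck k a b"
  shows "M_fun k a b g lam \<le> F_fun k a b g lam \<gamma>"
  unfolding M_fun_def
  by (rule cINF_lower[OF _ assms(2)]) (use F_fun_nonneg[OF assms(1)] in \<open>auto intro!: bdd_belowI2\<close>)

text \<open>The sequence \<open>U n\<close> consists of the derivatives of an approximation at \<open>\<lambda> = 2\<^sup>n\<close>.\<close>

definition dyadic_approx :: "real \<Rightarrow> real \<Rightarrow> nat \<Rightarrow> (real \<Rightarrow> real) \<Rightarrow> real \<Rightarrow> (nat \<Rightarrow> nat \<Rightarrow> real \<Rightarrow> real) \<Rightarrow> bool" where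
  "dyadic_approx a b k g C U \<longleftrightarrow> 0 \<le> C \<and> (\<forall>n. derivs k (U n) \<and>
     L1_norm {a..b} (U n k) \<le> ennreal (C * (2 ^ (k - 1)) ^ n) \<and>
     L1_norm {a..b} (\<lambda>x. U n 0 x - g x) \<le> ennreal (C / 2 ^ n))"

text \<open>Both terms of the functional are nonnegative, so a competitor of value below
  \<open>C\<close> at lam = 2^n has each term below \<open>C\<close>; dividing out the powers of lam
  gives the two bounds.\<close>

lemma S_space_imp_dyadic_approx:
  assumes "a < b" "g \<in> S_space k a b" "borel_version a b g g'"
  obtains C U where "dyadic_approx a b k g' C U"
proof -
  obtain B where B: "\<And>lam. 0 < lam \<Longrightarrow> M_fun k a b g lam \<le> B"
    using assms(2) by (auto simp: S_space_def bdd_above_def)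
  \<comment> \<open>The surplus 1 puts \<open>C\<close> strictly above the infimum, which some
    competitor must then undercut.\<close>
  define C where "C = \<bar>B\<bar> + 1"
  have "\<exists>U. derivs k U \<and> L1_norm {a..b} (U k) \<le> ennreal (C * (2 ^ (k - 1)) ^ n) \<and>
     L1_norm {a..b} (\<lambda>x. U 0 x - g' x) \<le> ennreal (C / 2 ^ n)" for n :: nat
  proof -
    have "M_fun k a b g (2^n) < C" using B[of "2^n"] by (simp add: C_def)
    then obtain \<gamma> where \<gamma>: "\<gamma> \<in> Ck k a b" "F_fun k a b g (2^n) \<gamma> < C"
      unfolding M_fun_def using cInf_lessD[of "F_fun k a b g (2^n) ` Ck k a b" C] Ck_0[OF assms(1)] by auto
    obtain U where U: "derivs k U" "\<And>x. x \<in> {a..b} \<Longrightarrow> \<gamma> x = U 0 x"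
      using Ck_imp_derivs[OF assms(1) \<gamma>(1)] by blast
    obtain p q where pq: "0 \<le> p" "0 \<le> q" "L1_norm {a..b} (U k) = ennreal p"
      "L1_norm {a..b} (\<lambda>x. U 0 x - g' x) = ennreal q"
      "\<And>lam. F_fun k a b g lam \<gamma> = 1 / lam ^ (k - 1) * p + lam * q"
      using F_fun_derivs[OF assms(1,3) U] by blast
    have F: "1 / (2^n) ^ (k - 1) * p + 2^n * q < C" using \<gamma>(2) pq(5) by simp
    have "0 \<le> 1 / (2^n::real) ^ (k - 1) * p" using pq by simp
    then have "q * 2^n \<le> C" using F by (simp add: mult.commute)
    then have q: "q \<le> C / 2^n" by (simp add: field_simps)
    have "0 \<le> 2^n * q" using pq by simp
    then have "1 / (2^n) ^ (k - 1) * p \<le> C" using F by linarith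
    then have "p \<le> C * (2 ^ (k - 1)) ^ n"
      by (simp add: field_simps power_mult[symmetric] mult.commute)
    then show ?thesis using U(1) pq q by (intro exI[of _ U]) (auto intro: ennreal_leI)
  qed
  then obtain U where "\<And>n. derivs k (U n) \<and> L1_norm {a..b} (U n k) \<le> ennreal (C * (2 ^ (k - 1)) ^ n) \<and>
     L1_norm {a..b} (\<lambda>x. U n 0 x - g' x) \<le> ennreal (C / 2 ^ n)" by metis
  then have "dyadic_approx a b k g' C U" by (simp add: dyadic_approx_def C_def)
  then show ?thesis by (rule that)
qed

lemma dyadic_floor:
  fixes x :: real assumes "1 \<le> x"
  obtains n where "2 ^ n \<le> x" "x < 2 ^ Suc n"
proof -
  obtain m where m: "x < 2 ^ m" using real_arch_pow[of 2 x] by auto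
  define n where "n = (LEAST m. x < 2 ^ m)"
  have 1: "x < 2 ^ n" unfolding n_def by (rule LeastI[of _ m]) (rule m)
  then have "n \<noteq> 0" using assms by (intro notI) simp
  then obtain j where j: "n = Suc j" by (cases n) auto
  have "\<not> x < 2 ^ j" using not_less_Least[of j "\<lambda>m. x < 2 ^ m"] j by (simp add: n_def)
  then show ?thesis using 1 j by (intro that[of j]) auto
qed

text \<open>Dyadic parameters suffice: for lam between 2^n and 2^(n+1) the approximation of level n
  still serves, at the cost of a factor 2 in the second term, and for lam <= 1 the zero function is
  a competitor of value at most \<open>q0\<close>.\<close>

lemma S_spaceI:
  assumes "a < b" "g \<in> L1 a b" "borel_version a b g g'" "0 \<le> C"
    and U: "\<And>n. \<exists>U. derivs k U \<and> L1_norm {a..b} (U k) \<le> ennreal (C * (2 ^ (k - 1)) ^ n) \<and>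
     L1_norm {a..b} (\<lambda>x. U 0 x - g' x) \<le> ennreal (C / 2 ^ n)"
  shows "g \<in> S_space k a b"
proof -
  obtain p0 q0 where 0: "0 \<le> p0" "0 \<le> q0" "L1_norm {a..b} (\<lambda>_. 0) = ennreal p0"
    "\<And>lam. F_fun k a b g lam (\<lambda>_. 0) = 1 / lam ^ (k - 1) * p0 + lam * q0"
    by (rule F_fun_derivs[OF assms(1,3), of k "\<lambda>i x. 0" "\<lambda>x. 0"]) (auto simp: derivs_def)
  have p0: "p0 = 0" using 0 by (simp add: L1_norm_def)
  have "M_fun k a b g lam \<le> q0 + 3 * C" if lam: "0 < lam" for lam
  proof (cases "lam \<le> 1")
    case True
    have "M_fun k a b g lam \<le> F_fun k a b g lam (\<lambda>_. 0)" by (rule M_fun_le[OF lam Ck_0[OF assms(1)]])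
    also have "\<dots> = lam * q0" using 0(4) p0 by simp
    also have "\<dots> \<le> q0" using True 0 lam by (simp add: mult_left_le_one_le)
    finally show ?thesis using assms(4) by simp
  next
    case False
    then obtain n where n: "2 ^ n \<le> lam" "lam < 2 ^ Suc n" using dyadic_floor[of lam] by auto
    obtain U where U: "derivs k U" "L1_norm {a..b} (U k) \<le> ennreal (C * (2 ^ (k - 1)) ^ n)"
      "L1_norm {a..b} (\<lambda>x. U 0 x - g' x) \<le> ennreal (C / 2 ^ n)"
      using U[of n] by blast
    obtain p q where pq: "0 \<le> p" "0 \<le> q" "L1_norm {a..b} (U k) = ennreal p"
      "L1_norm {a..b} (\<lambda>x. U 0 x - g' x) = ennreal q"
      "\<And>lam. F_fun k a b g lam (U 0) = 1 / lam ^ (k - 1) * p + lam * q"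
      by (rule F_fun_derivs[OF assms(1,3) U(1), of "U 0"]) auto
    have p: "p \<le> C * (2 ^ (k - 1)) ^ n" and q: "q \<le> C / 2^n"
      using U(2,3) pq assms(4) by (simp_all add: ennreal_le_iff)
    have "p \<le> C * lam ^ (k - 1)"
    proof -
      have "((2::real) ^ (k - 1)) ^ n = (2 ^ n) ^ (k - 1)" by (simp flip: power_mult add: mult.commute)
      also have "\<dots> \<le> lam ^ (k - 1)" using n by (intro power_mono) auto
      finally show ?thesis using order_trans[OF p mult_left_mono[OF _ assms(4)]] by blast
    qed
    then have 1: "1 / lam ^ (k - 1) * p \<le> C" using lam by (simp add: pos_divide_le_eq)
    have "lam * q \<le> 2 ^ Suc n * (C / 2 ^ n)" using n q lam pq by (intro mult_mono) auto
    then have 2: "lam * q \<le> 2 * C" by simp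
    have "M_fun k a b g lam \<le> F_fun k a b g lam (U 0)"
      by (rule M_fun_le[OF lam derivs_imp_Ck[OF assms(1) U(1)]])
    also have "\<dots> \<le> 3 * C" using 1 2 pq(5) by simp
    finally show ?thesis using 0 by simp
  qed
  then have "bdd_above (M_fun k a b g ` {0<..})" by (intro bdd_aboveI2) auto
  then show ?thesis using assms(2) by (simp add: S_space_def)
qed

section \<open>Interpolation of derivatives\<close>

text \<open>Differences with negative step are allowed, so that every point of an interval can be
  reached by differences staying inside it.\<close>

definition diff_op :: "real \<Rightarrow> (real \<Rightarrow> real) \<Rightarrow> real \<Rightarrow> real" where
  "diff_op h u x = (u (x + h) - u x) / h"

text \<open>The differences \<open>diff_op h (U i)\<close> again form a chain, so the induction
  hypothesis applies to them; the remaining difference of \<open>U j\<close> is a mean value, which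
  moves theta by at most 1.\<close>

lemma diff_op_mean_value:
  assumes "derivs k U" "h \<noteq> 0" "j \<le> k"
  shows "\<exists>\<theta>\<in>{0..real j}. (diff_op h ^^ j) (U 0) x = U j (x + \<theta> * h)"
  using assms(1,3)
proof (induction j arbitrary: U k)
  case 0
  then show ?case by auto
next
  case (Suc j)
  have D: "derivs k (\<lambda>i. diff_op h (U i))"
  proof -
    have c: "continuous_on UNIV (U k)" using derivs_continuous[OF Suc.prems(1)] by simp
    show ?thesis
      unfolding derivs_def diff_op_def
    proof (intro conjI allI impI)
      show "((\<lambda>x. (U i (x + h) - U i x) / h) has_real_derivative (U (Suc i) (x + h) - U (Suc i) x) / h) (at x)"
        if "i < k" for i x
        using derivs_D[OF Suc.prems(1) that, of x] derivs_D[OF Suc.prems(1) that, of "x + h"]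
        by (intro DERIV_cdivide DERIV_diff) (auto simp: DERIV_shift)
      show "continuous_on UNIV (\<lambda>x. (U k (x + h) - U k x) / h)"
        using assms(2) by (intro continuous_intros c continuous_on_compose2[OF c]) auto
    qed
  qed
  obtain \<theta> where \<theta>: "\<theta> \<in> {0..real j}" "(diff_op h ^^ j) (diff_op h (U 0)) x = diff_op h (U j) (x + \<theta> * h)"
    using Suc.IH[OF D] Suc.prems by auto
  define \<xi> where "\<xi> = x + \<theta> * h"
  have "\<exists>\<eta>\<in>{0..1}. diff_op h (U j) \<xi> = U (Suc j) (\<xi> + \<eta> * h)"
  proof (cases "h > 0")
    case True
    obtain z where "\<xi> < z" "z < \<xi> + h" "U j (\<xi> + h) - U j \<xi> = (\<xi> + h - \<xi>) * U (Suc j) z"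
      using MVT2[of \<xi> "\<xi> + h" "U j" "U (Suc j)"] derivs_D[OF Suc.prems(1)] Suc.prems True by auto
    then show ?thesis using True by (intro bexI[of _ "(z - \<xi>) / h"]) (auto simp: diff_op_def)
  next
    case False
    then have h: "h < 0" using assms by simp
    obtain z where "\<xi> + h < z" "z < \<xi>" "U j \<xi> - U j (\<xi> + h) = (\<xi> - (\<xi> + h)) * U (Suc j) z"
      using MVT2[of "\<xi> + h" \<xi> "U j" "U (Suc j)"] derivs_D[OF Suc.prems(1)] Suc.prems h by auto
    then show ?thesis using h by (intro bexI[of _ "(z - \<xi>) / h"]) (auto simp: diff_op_def field_simps)
  qed
  then obtain \<eta> where "\<eta> \<in> {0..1}" "diff_op h (U j) \<xi> = U (Suc j) (\<xi> + \<eta> * h)" by blast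
  then show ?case using \<theta>
    by (intro bexI[of _ "\<theta> + \<eta>"]) (auto simp: funpow_Suc_right \<xi>_def algebra_simps simp del: funpow.simps)
qed

text \<open>An iterated difference samples only x, x + h, ..., x + jh. This allows a function to be
  replaced by its truncation to {a..b}.\<close>

lemma diff_op_cong:
  assumes "\<And>i. i \<le> j \<Longrightarrow> u (x + real i * h) = v (x + real i * h)"
  shows "(diff_op h ^^ j) u x = (diff_op h ^^ j) v x"
  using assms
proof (induction j arbitrary: x)
  case (Suc j)
  have "(diff_op h ^^ j) u x = (diff_op h ^^ j) v x"
    by (rule Suc.IH) (use Suc.prems in auto)
  moreover have "(diff_op h ^^ j) u (x + h) = (diff_op h ^^ j) v (x + h)"
    using Suc.prems[of "Suc i" for i] by (intro Suc.IH) (auto simp: algebra_simps)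
  ultimately show ?case by (simp add: diff_op_def[of h "(diff_op h ^^ j) w" for w])
qed simp

lemma diff_op_measurable:
  assumes [measurable]: "u \<in> borel_measurable borel"
  shows "(diff_op h ^^ j) u \<in> borel_measurable borel"
proof (induction j)
  case (Suc j)
  note Suc[measurable]
  have "(diff_op h ^^ Suc j) u = (\<lambda>x. ((diff_op h ^^ j) u (x + h) - (diff_op h ^^ j) u x) / h)"
    by (simp add: fun_eq_iff diff_op_def[of h "(diff_op h ^^ j) u"])
  then show ?case by simp
qed simp

lemma L1_norm_shift:
  assumes [measurable]: "u \<in> borel_measurable borel"
  shows "L1_norm UNIV (\<lambda>x. u (x + h)) = L1_norm UNIV u"
  using nn_integral_real_affine[of "\<lambda>x. ennreal \<bar>u x\<bar>" 1 h]
  by (simp add: L1_norm_UNIV add.commute)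

lemma L1_norm_diff_op:
  assumes u: "u \<in> borel_measurable borel" and "h \<noteq> 0"
  shows "L1_norm UNIV ((diff_op h ^^ j) u) \<le> ennreal ((2 / \<bar>h\<bar>) ^ j) * L1_norm UNIV u"
proof (induction j)
  case (Suc j)
  define v where "v = (diff_op h ^^ j) u"
  have v[measurable]: "v \<in> borel_measurable borel" unfolding v_def by (rule diff_op_measurable[OF u])
  have "L1_norm UNIV (diff_op h v) \<le> L1_norm UNIV (\<lambda>x. (1/h) * v (x + h)) + L1_norm UNIV (\<lambda>x. (1/h) * v x)"
    by (rule L1_norm_triangle) (auto simp: diff_op_def diff_divide_distrib intro: order_trans[OF abs_triangle_ineq4])
  also have "\<dots> = ennreal (2 / \<bar>h\<bar>) * L1_norm UNIV v"
    by (subst L1_norm_cmult, simp, simp)+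
       (simp add: L1_norm_shift distrib_right[symmetric] ennreal_plus[symmetric] del: ennreal_plus)
  also have "\<dots> \<le> ennreal (2 / \<bar>h\<bar>) * (ennreal ((2 / \<bar>h\<bar>) ^ j) * L1_norm UNIV u)"
    unfolding v_def by (intro mult_left_mono Suc) auto
  finally show ?case by (simp add: v_def mult.assoc[symmetric] ennreal_mult[symmetric])
qed simp

lemma derivs_increment_le:
  assumes "derivs k U" "j < k" "x \<le> y"
  shows "ennreal \<bar>U j y - U j x\<bar> \<le> (\<integral>\<^sup>+t\<in>{x..y}. ennreal \<bar>U (Suc j) t\<bar> \<partial>lborel)"
proof -
  have c: "continuous_on {x..y} (U (Suc j))"
    using derivs_continuous[OF assms(1), of "Suc j"] assms(2) continuous_on_subset by fastforce
  have "(U (Suc j) has_integral (U j y - U j x)) {x..y}"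
    by (rule fundamental_theorem_of_calculus[OF assms(3)])
       (use derivs_D[OF assms(1,2)] in \<open>auto simp: has_real_derivative_iff_has_vector_derivative intro: has_vector_derivative_at_within\<close>)
  then have "U j y - U j x = integral {x..y} (U (Suc j))" by (simp add: integral_unique)
  moreover have "norm (integral {x..y} (U (Suc j))) \<le> integral {x..y} (\<lambda>t. \<bar>U (Suc j) t\<bar>)"
    by (rule integral_norm_bound_integral) (auto intro!: integrable_continuous_real continuous_intros c)
  ultimately have "ennreal \<bar>U j y - U j x\<bar> \<le> ennreal (integral {x..y} (\<lambda>t. \<bar>U (Suc j) t\<bar>))"
    by (auto intro: ennreal_leI)
  then show ?thesis using L1_norm_continuous[OF c] by (simp add: L1_norm_def)
qed

section \<open>Integrals over moving windows\<close>

lemma window_measurable: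
  fixes f :: "real \<Rightarrow> ennreal"
  assumes [measurable]: "f \<in> borel_measurable borel"
  shows "(\<lambda>x. \<integral>\<^sup>+t\<in>{x - r..x + r}. f t \<partial>lborel) \<in> borel_measurable borel"
proof -
  have [measurable]: "Measurable.pred (borel \<Otimes>\<^sub>M borel) (\<lambda>p. snd p \<in> {fst p - r..fst p + r})"
    unfolding atLeastAtMost_iff by measurable
  have "(\<lambda>x. \<integral>\<^sup>+t\<in>{x - r..x + r}. f t \<partial>lborel) \<in> borel_measurable lborel"
    by (rule lborel.borel_measurable_nn_integral) (simp add: indicator_def split_beta')
  then show ?thesis by simp
qed

text \<open>Tonelli: a given t lies in the windows of exactly those x with |x - t| <= r, a set of
  measure 2r.\<close>

lemma nn_integral_window:
  assumes [measurable]: "w \<in> borel_measurable borel" and r: "0 \<le> r"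
  shows "(\<integral>\<^sup>+x. (\<integral>\<^sup>+t\<in>{x - r..x + r}. w t \<partial>lborel) \<partial>lborel) = ennreal (2 * r) * (\<integral>\<^sup>+t. w t \<partial>lborel)"
proof -
  have [measurable]: "Measurable.pred (borel \<Otimes>\<^sub>M borel) (\<lambda>p. snd p \<in> {fst p - r..fst p + r})"
    unfolding atLeastAtMost_iff by measurable
  have "(\<integral>\<^sup>+x. (\<integral>\<^sup>+t\<in>{x - r..x + r}. w t \<partial>lborel) \<partial>lborel) = (\<integral>\<^sup>+t. (\<integral>\<^sup>+x. w t * indicator {x - r..x + r} t \<partial>lborel) \<partial>lborel)"
    by (rule lborel_pair.Fubini') (simp add: indicator_def split_beta')
  also have "\<dots> = (\<integral>\<^sup>+t. w t * ennreal (2 * r) \<partial>lborel)"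
  proof (rule nn_integral_cong)
    fix t
    have "(\<integral>\<^sup>+x. w t * indicator {x - r..x + r} t \<partial>lborel) = (\<integral>\<^sup>+x. w t * indicator {t - r..t + r} x \<partial>lborel)"
      by (intro nn_integral_cong) (auto simp: indicator_def)
    also have "\<dots> = w t * ennreal (2 * r)"
      by (subst nn_integral_cmult_indicator) (use r in auto)
    finally show "(\<integral>\<^sup>+x. w t * indicator {x - r..x + r} t \<partial>lborel) = w t * ennreal (2 * r)" .
  qed
  also have "\<dots> = ennreal (2 * r) * (\<integral>\<^sup>+t. w t \<partial>lborel)"
    by (subst nn_integral_multc) (auto simp: mult.commute)
  finally show ?thesis .
qed

lemma L1_norm_UNIV_indicator:
  "L1_norm UNIV (\<lambda>x. indicator S x * u x) = L1_norm S u"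
  unfolding L1_norm_def by (intro nn_integral_cong) (auto simp: indicator_def)

text \<open>The j-th difference at x is the value of \<open>U j\<close> at a point within distance
  jh. Its norm is at most (2/h)^j times that of \<open>U 0\<close>, and \<open>U j x\<close> differs
  from that value by at most the integral of \<open>U (Suc j)\<close> over a window of radius jh.
  The factor 2 in the first term comes from using differences in both directions.\<close>

lemma interpolation:
  assumes U: "derivs k U" and j: "j < k" and h: "0 < h" and L: "2 * real j * h \<le> b - a"
  shows "L1_norm {a..b} (U j) \<le> ennreal (2 * (2 / h) ^ j) * L1_norm {a..b} (U 0) +
           ennreal (2 * real j * h) * L1_norm {a..b} (U (Suc j))"
proof -
  define r where "r = real j * h"
  have r: "0 \<le> r" using h by (simp add: r_def)
  \<comment> \<open>Truncation to {a..b}, so that the translation invariant norm on the line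
    measures only what happens on the interval.\<close>
  define u where "u x = indicator {a..b} x * U 0 x" for x
  define w where "w x = indicator {a..b} x * U (Suc j) x" for x
  have m[measurable]: "U i \<in> borel_measurable borel" if "i \<le> k" for i
    using derivs_continuous[OF U that] by (rule borel_measurable_continuous_onI)
  have [measurable]: "u \<in> borel_measurable borel" unfolding u_def[abs_def] using m[of 0] by measurable
  have [measurable]: "w \<in> borel_measurable borel" unfolding w_def[abs_def] using m[of "Suc j", OF Suc_leI[OF j]] by measurable
  define v where "v s = (diff_op s ^^ j) u" for s
  have v[measurable]: "v s \<in> borel_measurable borel" for s unfolding v_def by (rule diff_op_measurable) simp
  define W where "W x = (\<integral>\<^sup>+t\<in>{x - r..x + r}. ennreal \<bar>w t\<bar> \<partial>lborel)" for x
  have [measurable]: "W \<in> borel_measurable borel"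
    unfolding W_def[abs_def] by (rule window_measurable) measurable
  \<comment> \<open>Here s is h or -h, subject to all j steps from x staying inside {a..b}.\<close>
  have step: "ennreal \<bar>U j x\<bar> \<le> ennreal \<bar>v s x\<bar> + W x"
    if x: "x \<in> {a..b}" "x + real j * s \<in> {a..b}" and s: "\<bar>s\<bar> = h" for x s
  proof -
    have in_ab: "x + \<theta> * s \<in> {a..b}" if "\<theta> \<in> {0..real j}" for \<theta>
    proof (cases "s \<ge> 0")
      case True
      have "0 \<le> \<theta> * s" "\<theta> * s \<le> real j * s" using that True by (auto intro: mult_right_mono)
      then show ?thesis using x by auto
    next
      case False
      have "\<theta> * s \<le> 0" "real j * s \<le> \<theta> * s" using that False
        by (auto intro: mult_right_mono_neg simp: mult_le_0_iff)
      then show ?thesis using x by auto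
    qed
    have "v s x = (diff_op s ^^ j) (U 0) x"
      unfolding v_def by (rule diff_op_cong) (use in_ab in \<open>auto simp: u_def\<close>)
    moreover obtain \<theta> where \<theta>: "\<theta> \<in> {0..real j}" "(diff_op s ^^ j) (U 0) x = U j (x + \<theta> * s)"
      using diff_op_mean_value[OF U, of s j x] s h j by auto
    moreover define \<xi> where "\<xi> = x + \<theta> * s"
    ultimately have v\<xi>: "v s x = U j \<xi>" by simp
    have \<xi>: "\<xi> \<in> {a..b}" using in_ab[OF \<theta>(1)] by (simp add: \<xi>_def)
    have "\<bar>\<theta> * s\<bar> \<le> r" using \<theta>(1) s h by (simp add: r_def abs_mult mult_right_mono)
    then have \<xi>r: "\<bar>\<xi> - x\<bar> \<le> r" by (simp add: \<xi>_def)
    have inc: "ennreal \<bar>U j q - U j p\<bar> \<le> W x" if "p \<le> q" "{p..q} \<subseteq> {a..b} \<inter> {x - r..x + r}" for p q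
    proof -
      have "ennreal \<bar>U j q - U j p\<bar> \<le> (\<integral>\<^sup>+t\<in>{p..q}. ennreal \<bar>U (Suc j) t\<bar> \<partial>lborel)"
        by (rule derivs_increment_le[OF U j that(1)])
      also have "\<dots> \<le> W x" unfolding W_def w_def
        by (intro nn_integral_mono) (use that(2) in \<open>auto simp: indicator_def subset_iff\<close>)
      finally show ?thesis .
    qed
    have "ennreal \<bar>U j x - U j \<xi>\<bar> \<le> W x"
      using inc[of x \<xi>] inc[of \<xi> x] x(1) \<xi> \<xi>r by (cases "x \<le> \<xi>") (auto simp: abs_minus_commute)
    moreover have "ennreal \<bar>U j x\<bar> \<le> ennreal \<bar>v s x\<bar> + ennreal \<bar>U j x - U j \<xi>\<bar>"
      using v\<xi> by (simp flip: ennreal_plus add: ennreal_leI)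
    ultimately show ?thesis by (meson add_left_mono order_trans)
  qed
  have "L1_norm {a..b} (U j) \<le> (\<integral>\<^sup>+x. (ennreal \<bar>v h x\<bar> + ennreal \<bar>v (- h) x\<bar>) + W x \<partial>lborel)"
    unfolding L1_norm_def
  proof (rule nn_integral_mono)
    fix x
    show "ennreal \<bar>U j x\<bar> * indicator {a..b} x \<le> ennreal \<bar>v h x\<bar> + ennreal \<bar>v (- h) x\<bar> + W x"
    proof (cases "x \<in> {a..b}")
      case True
      \<comment> \<open>Since 2jh <= b - a, from any x at least one of the two directions has room
        for j steps.\<close>
      have "x + real j * h \<in> {a..b} \<or> x + real j * (- h) \<in> {a..b}"
        using True L r by (auto simp: r_def)
      then consider "ennreal \<bar>U j x\<bar> \<le> ennreal \<bar>v h x\<bar> + W x" | "ennreal \<bar>U j x\<bar> \<le> ennreal \<bar>v (- h) x\<bar> + W x"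
        using step[OF True, of h] step[OF True, of "- h"] h by auto
      then show ?thesis
      proof cases
        case 1
        also have "ennreal \<bar>v h x\<bar> + W x \<le> ennreal \<bar>v h x\<bar> + ennreal \<bar>v (- h) x\<bar> + W x"
          by (intro add_mono) auto
        finally show ?thesis using True by simp
      next
        case 2
        also have "ennreal \<bar>v (- h) x\<bar> + W x \<le> ennreal \<bar>v h x\<bar> + ennreal \<bar>v (- h) x\<bar> + W x"
          by (intro add_mono) auto
        finally show ?thesis using True by simp
      qed
    qed auto
  qed
  also have "\<dots> = (L1_norm UNIV (v h) + L1_norm UNIV (v (- h))) + (\<integral>\<^sup>+x. W x \<partial>lborel)"
    unfolding L1_norm_UNIV by (subst nn_integral_add, simp, simp)+ simp
  also have "(\<integral>\<^sup>+x. W x \<partial>lborel) = ennreal (2 * r) * L1_norm UNIV w"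
    unfolding W_def L1_norm_UNIV by (rule nn_integral_window) (use r in auto)
  also have "L1_norm UNIV w = L1_norm {a..b} (U (Suc j))"
    unfolding w_def by (rule L1_norm_UNIV_indicator)
  finally have "L1_norm {a..b} (U j) \<le> L1_norm UNIV (v h) + L1_norm UNIV (v (- h)) + ennreal (2 * r) * L1_norm {a..b} (U (Suc j))" .
  also have "L1_norm UNIV (v h) + L1_norm UNIV (v (- h)) \<le>
      ennreal ((2 / h) ^ j) * L1_norm UNIV u + ennreal ((2 / h) ^ j) * L1_norm UNIV u"
    unfolding v_def using L1_norm_diff_op[of u h j] L1_norm_diff_op[of u "- h" j] h by (intro add_mono) auto
  also have "\<dots> = ennreal (2 * (2 / h) ^ j) * L1_norm UNIV u"
    using h by (simp flip: distrib_right ennreal_plus)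
  also have "L1_norm UNIV u = L1_norm {a..b} (U 0)"
    unfolding u_def by (rule L1_norm_UNIV_indicator)
  finally show ?thesis by (simp add: r_def mult.assoc add_right_mono)
qed

section \<open>Lowering the order\<close>

lemma derivs_measurable: "derivs k U \<Longrightarrow> i \<le> k \<Longrightarrow> U i \<in> borel_measurable borel"
  by (intro borel_measurable_continuous_onI derivs_continuous)

text \<open>Two consecutive approximations differ by O(2^(-n)), while the derivative of order j + 1
  of the difference is O(2^(jn)). Interpolation with a step proportional to 2^(-n) balances both
  terms at 2^((j-1)n).\<close>

lemma dyadic_approx_increment:
  assumes "a < b" and g[measurable]: "g \<in> borel_measurable borel" and U: "dyadic_approx a b k g C U"
    and j: "1 \<le> j" "j < k" and C1: "0 \<le> C1"
    and UC1: "\<And>n. L1_norm {a..b} (U n (Suc j)) \<le> ennreal (C1 * (2 ^ j) ^ n)"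
  shows "\<exists>C2\<ge>0. \<forall>n. L1_norm {a..b} (\<lambda>x. U (Suc n) j x - U n j x) \<le> ennreal (C2 * (2 ^ (j - 1)) ^ n)"
proof -
  have C: "0 \<le> C" and der: "derivs k (U n)" and U0: "L1_norm {a..b} (\<lambda>x. U n 0 x - g x) \<le> ennreal (C / 2 ^ n)" for n
    using U by (auto simp: dyadic_approx_def)
  note m[measurable] = derivs_measurable[OF der]
  define h0 where "h0 = (b - a) / (2 * real j)"
  have h0: "0 < h0" using assms(1) j by (simp add: h0_def)
  \<comment> \<open>First summand: 2 (2/h0)^j times the bound 2C for the difference. Second: 2jh =
    (b - a) / 2^n times the bound C1 (2^j + 1) for the derivative of order j + 1.\<close>
  define C2 where "C2 = 4 * C * (2 / h0) ^ j + (b - a) * (C1 * (2 ^ j + 1))"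
  have C2: "0 \<le> C2" using C C1 h0 assms(1) by (simp add: C2_def)
  have "L1_norm {a..b} (\<lambda>x. U (Suc n) j x - U n j x) \<le> ennreal (C2 * (2 ^ (j - 1)) ^ n)" for n
  proof -
    define V where "V i x = U (Suc n) i x - U n i x" for i x
    define h where "h = h0 / 2 ^ n"
    have h: "0 < h" using h0 by (simp add: h_def)
    have jh: "2 * real j * h = (b - a) / 2 ^ n" using j by (simp add: h_def h0_def)
    have "(b - a) / 2 ^ n \<le> b - a" using assms(1) by (simp add: divide_le_eq mult_left_le)
    then have L: "2 * real j * h \<le> b - a" using jh by simp
    have "L1_norm {a..b} (V 0) \<le> L1_norm {a..b} (\<lambda>x. U (Suc n) 0 x - g x) + L1_norm {a..b} (\<lambda>x. U n 0 x - g x)"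
      using m[of 0] by (intro L1_norm_triangle) (auto simp: V_def)
    also have "\<dots> \<le> ennreal (C / 2 ^ Suc n) + ennreal (C / 2 ^ n)" by (intro add_mono U0)
    also have "\<dots> \<le> ennreal (2 * C / 2 ^ n)"
      using C by (subst ennreal_plus[symmetric]) (auto intro!: ennreal_leI simp: field_simps)
    finally have V0: "L1_norm {a..b} (V 0) \<le> ennreal (2 * C / 2 ^ n)" .
    have "L1_norm {a..b} (V (Suc j)) \<le> L1_norm {a..b} (U (Suc n) (Suc j)) + L1_norm {a..b} (U n (Suc j))"
      using m[of "Suc j"] j by (intro L1_norm_triangle) (auto simp: V_def)
    also have "\<dots> \<le> ennreal (C1 * (2 ^ j) ^ Suc n) + ennreal (C1 * (2 ^ j) ^ n)" by (intro add_mono UC1)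
    also have "\<dots> = ennreal (C1 * (2 ^ j + 1) * (2 ^ j) ^ n)"
      using C1 by (subst ennreal_plus[symmetric]) (auto simp: algebra_simps)
    finally have V1: "L1_norm {a..b} (V (Suc j)) \<le> ennreal (C1 * (2 ^ j + 1) * (2 ^ j) ^ n)" .
    have "L1_norm {a..b} (V j) \<le> ennreal (2 * (2 / h) ^ j) * L1_norm {a..b} (V 0) +
           ennreal (2 * real j * h) * L1_norm {a..b} (V (Suc j))"
      unfolding V_def by (rule interpolation[OF derivs_diff[OF der der] j(2) h L])
    also have "\<dots> \<le> ennreal (2 * (2 / h) ^ j) * ennreal (2 * C / 2 ^ n) +
           ennreal (2 * real j * h) * ennreal (C1 * (2 ^ j + 1) * (2 ^ j) ^ n)"
      by (intro add_mono mult_left_mono V0 V1) auto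
    also have "\<dots> = ennreal (2 * (2 / h) ^ j * (2 * C / 2 ^ n) + 2 * real j * h * (C1 * (2 ^ j + 1) * (2 ^ j) ^ n))"
      using h C C1 by (simp del: ennreal_plus add: ennreal_mult[symmetric] ennreal_plus[symmetric])
    also have "2 * (2 / h) ^ j * (2 * C / 2 ^ n) + 2 * real j * h * (C1 * (2 ^ j + 1) * (2 ^ j) ^ n) = C2 * (2 ^ (j - 1)) ^ n"
    proof -
      have p: "((2::real) ^ j) ^ n = 2 ^ n * (2 ^ (j - 1)) ^ n"
        using j by (cases j) (auto simp: power_mult_distrib)
      have "(2 / h) ^ j = (2 / h0) ^ j * (2 ^ n) ^ j"
        by (simp add: h_def power_divide power_mult_distrib)
      also have "((2::real) ^ n) ^ j = 2 ^ n * (2 ^ (j - 1)) ^ n"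
        using p by (simp flip: power_mult add: mult.commute)
      finally show ?thesis unfolding jh p by (simp add: C2_def field_simps)
    qed
    finally show ?thesis by (simp add: V_def)
  qed
  then show ?thesis using C2 by blast
qed

text \<open>\<open>p\<close> is any majorant of the partial sums; it is taken geometric for
  derivatives of order at least 2 and linear in n for the first derivative.\<close>

lemma telescope_bound:
  fixes p :: "nat \<Rightarrow> real"
  assumes [measurable]: "\<And>n. u n \<in> borel_measurable borel"
    and "L1_norm {a..b} (u 0) \<le> ennreal (p 0)" "\<And>n. 0 \<le> p n" "\<And>n. p n + q n \<le> p (Suc n)" "\<And>n. 0 \<le> q n"
    "\<And>n. L1_norm {a..b} (\<lambda>x. u (Suc n) x - u n x) \<le> ennreal (q n)"
  shows "L1_norm {a..b} (u n) \<le> ennreal (p n)"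
proof (induction n)
  case (Suc n)
  have "L1_norm {a..b} (u (Suc n)) \<le> L1_norm {a..b} (u n) + L1_norm {a..b} (\<lambda>x. u (Suc n) x - u n x)"
    by (intro L1_norm_triangle) auto
  also have "\<dots> \<le> ennreal (p n) + ennreal (q n)" by (intro add_mono Suc assms)
  also have "\<dots> \<le> ennreal (p (Suc n))"
    using assms by (simp flip: ennreal_plus add: ennreal_leI)
  finally show ?case .
qed (rule assms)

lemma L1_norm_continuous_bound:
  assumes "continuous_on UNIV u"
  obtains c where "0 \<le> c" "L1_norm {a..b} u \<le> ennreal c"
  by (rule that[of "integral {a..b} (\<lambda>x. \<bar>u x\<bar>)"])
     (auto simp: L1_norm_continuous continuous_on_subset[OF assms]
       intro!: integral_nonneg integrable_continuous_real continuous_intros continuous_on_subset[OF assms])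

text \<open>Descends from order k to order j. At each order the increments grow geometrically, so
  their sum has the size of the last one.\<close>

lemma dyadic_approx_deriv:
  assumes "a < b" and g: "g \<in> borel_measurable borel" and U: "dyadic_approx a b k g C U"
    and "2 \<le> j" "j \<le> k"
  shows "\<exists>C'\<ge>0. \<forall>n. L1_norm {a..b} (U n j) \<le> ennreal (C' * (2 ^ (j - 1)) ^ n)"
  using assms(5,4)
proof (induction rule: inc_induct)
  case base
  then show ?case using U by (auto simp: dyadic_approx_def)
next
  case (step j)
  then obtain C1 where C1: "0 \<le> C1" "\<And>n. L1_norm {a..b} (U n (Suc j)) \<le> ennreal (C1 * (2 ^ j) ^ n)" by auto
  obtain C2 where C2: "0 \<le> C2" "\<And>n. L1_norm {a..b} (\<lambda>x. U (Suc n) j x - U n j x) \<le> ennreal (C2 * (2 ^ (j - 1)) ^ n)"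
    using dyadic_approx_increment[OF assms(1) g U _ _ C1] step by auto
  have der: "derivs k (U n)" for n using U by (auto simp: dyadic_approx_def)
  obtain c where c: "0 \<le> c" "L1_norm {a..b} (U 0 j) \<le> ennreal c"
    using L1_norm_continuous_bound[OF derivs_continuous[OF der less_imp_le[OF step(2)]]] .
  have "L1_norm {a..b} (U n j) \<le> ennreal ((c + C2) * (2 ^ (j - 1)) ^ n)" for n
  proof (rule telescope_bound[of "\<lambda>n. U n j" _ _ "\<lambda>n. (c + C2) * (2 ^ (j - 1)) ^ n", OF _ _ _ _ _ C2(2)])
    show "U n j \<in> borel_measurable borel" for n using step by (intro derivs_measurable[OF der]) auto
    show "L1_norm {a..b} (U 0 j) \<le> ennreal ((c + C2) * (2 ^ (j - 1)) ^ 0)"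
      using c C2 by (auto intro: order_trans[OF c(2)] ennreal_leI)
    show "(c + C2) * (2 ^ (j - 1)) ^ n + C2 * (2 ^ (j - 1)) ^ n \<le> (c + C2) * (2 ^ (j - 1)) ^ Suc n" for n
    proof -
      \<comment> \<open>The point where j >= 2 enters: the ratio is at least 2, so one more
        increment fits below the next value of the majorant.\<close>
      have "(2::real) ^ 1 \<le> 2 ^ (j - 1)" using step by (intro power_increasing) auto
      then have "(c + C2) * 2 \<le> (c + C2) * 2 ^ (j - 1)" using c C2 by (intro mult_left_mono) auto
      then have "(c + C2 + C2) * (2 ^ (j - 1)) ^ n \<le> ((c + C2) * 2 ^ (j - 1)) * (2 ^ (j - 1)) ^ n"
        using c by (intro mult_right_mono) auto
      then show ?thesis by (simp add: algebra_simps)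
    qed
  qed (use c C2 in auto)
  then show ?case using c C2 by (intro exI[of _ "c + C2"]) auto
qed

text \<open>For the first derivative the increments are merely bounded, so n of them add up to O(n),
  that is, O(log(1/eps)) with eps = 2^(-n).\<close>

lemma dyadic_approx_deriv1:
  assumes "a < b" and g: "g \<in> borel_measurable borel" and U: "dyadic_approx a b 2 g C U"
  shows "\<exists>C'\<ge>0. \<forall>n. L1_norm {a..b} (U n 1) \<le> ennreal (C' * (real n + 1))"
proof -
  have C: "0 \<le> C" and der: "derivs 2 (U n)" and C1: "L1_norm {a..b} (U n (Suc 1)) \<le> ennreal (C * (2 ^ 1) ^ n)" for n
    using U by (auto simp: dyadic_approx_def numeral_2_eq_2)
  obtain C2 where C2: "0 \<le> C2" "\<And>n. L1_norm {a..b} (\<lambda>x. U (Suc n) 1 x - U n 1 x) \<le> ennreal C2"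
    using dyadic_approx_increment[OF assms(1) g U _ _ C C1] by auto
  obtain c where c: "0 \<le> c" "L1_norm {a..b} (U 0 1) \<le> ennreal c"
    using L1_norm_continuous_bound[OF derivs_continuous[OF der one_le_numeral]] .
  have "L1_norm {a..b} (U n 1) \<le> ennreal ((c + C2) * (real n + 1))" for n
  proof (rule telescope_bound[of "\<lambda>n. U n 1" _ _ "\<lambda>n. (c + C2) * (real n + 1)", OF _ _ _ _ _ C2(2)])
    show "U n 1 \<in> borel_measurable borel" for n by (intro derivs_measurable[OF der]) auto
    show "L1_norm {a..b} (U 0 1) \<le> ennreal ((c + C2) * (real 0 + 1))"
      by (rule order_trans[OF c(2)], rule ennreal_leI) (use C2 in simp)
  qed (use c C2 in \<open>auto simp: algebra_simps\<close>)
  then show ?thesis using c C2 by (intro exI[of _ "c + C2"]) auto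
qed

text \<open>The approximations of order k serve unchanged for order 2, by the bound on their second
  derivatives.\<close>

lemma S_space_subset_S2:
  assumes "a < b" "2 \<le> k"
  shows "S_space k a b \<subseteq> S_space 2 a b"
proof
  fix g assume g: "g \<in> S_space k a b"
  then have L1: "g \<in> L1 a b" by (simp add: S_space_def)
  obtain g' where g': "borel_version a b g g'" using borel_version_exists[OF L1] .
  obtain C U where U: "dyadic_approx a b k g' C U" using S_space_imp_dyadic_approx[OF assms(1) g g'] .
  obtain C' where C': "0 \<le> C'" "\<And>n. L1_norm {a..b} (U n 2) \<le> ennreal (C' * 2 ^ n)"
    using dyadic_approx_deriv[OF assms(1) borel_version_measurable[OF g'] U _ assms(2)] by auto
  show "g \<in> S_space 2 a b"
  proof (rule S_spaceI[OF assms(1) L1 g', of "C + C'"])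
    show "0 \<le> C + C'" using U C' by (simp add: dyadic_approx_def)
    fix n
    have "L1_norm {a..b} (U n 2) \<le> ennreal ((C + C') * 2 ^ n)"
      using U C' by (intro order_trans[OF C'(2)[of n]] ennreal_leI) (auto simp: dyadic_approx_def)
    moreover have "L1_norm {a..b} (\<lambda>x. U n 0 x - g' x) \<le> ennreal ((C + C') / 2 ^ n)"
      by (rule order_trans[of _ "ennreal (C / 2 ^ n)"])
         (use U C' in \<open>auto simp: dyadic_approx_def intro!: ennreal_leI divide_right_mono\<close>)
    moreover have "derivs 2 (U n)" using U assms(2) by (auto simp: dyadic_approx_def intro: derivs_le)
    ultimately show "\<exists>U. derivs 2 U \<and> L1_norm {a..b} (U 2) \<le> ennreal ((C + C') * (2 ^ (2 - 1)) ^ n) \<and>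
       L1_norm {a..b} (\<lambda>x. U 0 x - g' x) \<le> ennreal ((C + C') / 2 ^ n)"
      by (intro exI[of _ "U n"]) auto
  qed
qed

section \<open>Smoothing by averages\<close>

definition avg :: "real \<Rightarrow> (real \<Rightarrow> real) \<Rightarrow> real \<Rightarrow> real" where
  "avg e u x = integral {x - e..x + e} u / (2 * e)"

text \<open>The derivative of \<open>avg e u\<close>; it is also the average of u', since averaging
  and differentiation commute.\<close>

definition cdiff :: "real \<Rightarrow> (real \<Rightarrow> real) \<Rightarrow> real \<Rightarrow> real" where
  "cdiff e u x = (u (x + e) - u (x - e)) / (2 * e)"

lemma avg_eq:
  assumes "0 \<le> e" "\<And>x. (P has_real_derivative u x) (at x)"
  shows "avg e u x = cdiff e P x"
proof -
  have "(u has_integral (P (x + e) - P (x - e))) {x - e..x + e}"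
    by (rule fundamental_theorem_of_calculus)
       (use assms in \<open>auto simp: has_real_derivative_iff_has_vector_derivative intro: has_vector_derivative_at_within\<close>)
  then show ?thesis by (simp add: avg_def cdiff_def integral_unique)
qed

lemma cdiff_has_derivative:
  assumes "\<And>x. (u has_real_derivative v x) (at x)"
  shows "(cdiff e u has_real_derivative cdiff e v x) (at x)"
proof -
  have "((\<lambda>x. u (x + e)) has_real_derivative v (x + e)) (at x)"
    using assms[of "x + e"] by (simp add: DERIV_shift)
  moreover have "((\<lambda>x. u (x + - e)) has_real_derivative v (x + - e)) (at x)"
    using assms[of "x + - e"] by (simp only: DERIV_shift)
  ultimately have "((\<lambda>x. (u (x + e) - u (x - e)) / (2 * e)) has_real_derivative (v (x + e) - v (x - e)) / (2 * e)) (at x)"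
    by (intro DERIV_cdivide DERIV_diff) simp_all
  then show ?thesis by (simp add: cdiff_def[abs_def])
qed

lemma avg_has_derivative:
  assumes "0 \<le> e" "continuous_on UNIV u"
  shows "(avg e u has_real_derivative cdiff e u x) (at x)"
proof -
  obtain P where P: "\<And>x. (P has_real_derivative u x) (at x)"
    using antiderivative_exists[OF assms(2)] by metis
  have "avg e u = cdiff e P" using avg_eq[OF assms(1) P] by auto
  then show ?thesis using cdiff_has_derivative[OF P] by simp
qed

lemma avg_continuous:
  assumes "0 \<le> e" "continuous_on UNIV u"
  shows "continuous_on UNIV (avg e u)"
  using DERIV_isCont[OF avg_has_derivative[OF assms]] by (simp add: continuous_at_imp_continuous_on)

lemma funpow_avg_continuous:
  assumes "0 \<le> e" "continuous_on UNIV u"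
  shows "continuous_on UNIV ((avg e ^^ r) u)"
  by (induction r) (simp_all add: assms avg_continuous)

lemma cdiff_continuous:
  assumes "continuous_on UNIV u"
  shows "continuous_on UNIV (cdiff e u)"
proof (cases "e = 0")
  case False
  then show ?thesis unfolding cdiff_def[abs_def]
    by (intro continuous_intros continuous_on_compose2[OF assms]) auto
qed (simp add: cdiff_def[abs_def])

lemma funpow_cdiff_continuous:
  "continuous_on UNIV u \<Longrightarrow> continuous_on UNIV ((cdiff e ^^ r) u)"
  by (induction r) (simp_all add: cdiff_continuous)

lemma funpow_cdiff_has_derivative:
  assumes "\<And>x. (u has_real_derivative v x) (at x)"
  shows "((cdiff e ^^ i) u has_real_derivative (cdiff e ^^ i) v x) (at x)"
  by (induction i arbitrary: x) (simp_all add: assms cdiff_has_derivative)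

text \<open>Each derivative consumes one average and turns it into a central difference, so r
  averages of a continuous function are r times continuously differentiable.\<close>

lemma derivs_funpow_avg:
  assumes e: "0 \<le> e" and f: "continuous_on UNIV f"
  shows "derivs r (\<lambda>i. (cdiff e ^^ i) ((avg e ^^ (r - i)) f))"
  unfolding derivs_def
proof (intro conjI allI impI)
  fix i x assume i: "i < r"
  then obtain q where q: "r - i = Suc q" "r - Suc i = q" by (metis Suc_diff_Suc)
  have "((cdiff e ^^ i) (avg e ((avg e ^^ q) f)) has_real_derivative (cdiff e ^^ i) (cdiff e ((avg e ^^ q) f)) x) (at x)"
    by (intro funpow_cdiff_has_derivative avg_has_derivative e funpow_avg_continuous f)
  then show "((cdiff e ^^ i) ((avg e ^^ (r - i)) f) has_real_derivative (cdiff e ^^ Suc i) ((avg e ^^ (r - Suc i)) f) x) (at x)"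
    using q by (simp add: funpow_swap1)
qed (simp add: funpow_cdiff_continuous f)

text \<open>Once all r averages are used up, the derivative of \<open>f\<close> itself supplies one
  more order.\<close>

lemma derivs_funpow_avg_Suc:
  assumes e: "0 \<le> e" and f: "\<And>x. (f has_real_derivative W x) (at x)" and W: "continuous_on UNIV W"
  shows "derivs (Suc r) (\<lambda>i. if i = Suc r then (cdiff e ^^ r) W else (cdiff e ^^ i) ((avg e ^^ (r - i)) f))"
proof -
  have "continuous_on UNIV f" using DERIV_isCont[OF f] by (simp add: continuous_at_imp_continuous_on)
  from derivs_funpow_avg[OF e this, of r] show ?thesis
    using funpow_cdiff_has_derivative[OF f, where e=e and i=r] funpow_cdiff_continuous[OF W, where e=e and r=r]
    by (auto simp: derivs_def less_Suc_eq simp del: funpow.simps)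
qed

lemma cdiff_measurable:
  assumes [measurable]: "u \<in> borel_measurable borel"
  shows "cdiff e u \<in> borel_measurable borel"
  unfolding cdiff_def[abs_def] by measurable

lemma L1_norm_cdiff:
  assumes [measurable]: "u \<in> borel_measurable borel" and e: "0 < e"
  shows "L1_norm UNIV (cdiff e u) \<le> ennreal (1 / e) * L1_norm UNIV u"
proof -
  have "L1_norm UNIV (cdiff e u) \<le> L1_norm UNIV (\<lambda>x. (1 / (2 * e)) * u (x + e)) + L1_norm UNIV (\<lambda>x. (1 / (2 * e)) * u (x + - e))"
    by (rule L1_norm_triangle) (use e in \<open>auto simp: cdiff_def diff_divide_distrib intro: order_trans[OF abs_triangle_ineq4]\<close>)
  also have "\<dots> = ennreal (1 / e) * L1_norm UNIV u"
    by (subst L1_norm_cmult, simp, simp, subst L1_norm_shift, simp)+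
       (use e in \<open>simp add: distrib_right[symmetric] ennreal_plus[symmetric] del: ennreal_plus\<close>)
  finally show ?thesis .
qed

lemma L1_norm_funpow_cdiff:
  assumes "u \<in> borel_measurable borel" and e: "0 < e"
  shows "L1_norm UNIV ((cdiff e ^^ i) u) \<le> ennreal ((1 / e) ^ i) * L1_norm UNIV u"
proof (induction i)
  case (Suc i)
  have "(cdiff e ^^ i) u \<in> borel_measurable borel"
    by (induction i) (simp_all add: assms cdiff_measurable)
  then have "L1_norm UNIV (cdiff e ((cdiff e ^^ i) u)) \<le> ennreal (1 / e) * L1_norm UNIV ((cdiff e ^^ i) u)"
    by (rule L1_norm_cdiff[OF _ e])
  also have "\<dots> \<le> ennreal (1 / e) * (ennreal ((1 / e) ^ i) * L1_norm UNIV u)"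
    by (intro mult_left_mono Suc) auto
  finally show ?case using e by (simp add: mult.assoc[symmetric] ennreal_mult[symmetric])
qed simp

text \<open>Young's inequality for convolution with the indicator of {-e..e}, in the pointwise form
  in which the bounds below arise.\<close>

lemma L1_norm_window:
  assumes [measurable]: "w \<in> borel_measurable borel" and e: "0 \<le> e" "0 \<le> c"
    and v: "\<And>x. ennreal \<bar>v x\<bar> \<le> ennreal c * (\<integral>\<^sup>+t\<in>{x - e..x + e}. ennreal \<bar>w t\<bar> \<partial>lborel)"
  shows "L1_norm UNIV v \<le> ennreal (2 * e * c) * L1_norm UNIV w"
proof -
  define W where "W x = (\<integral>\<^sup>+t\<in>{x - e..x + e}. ennreal \<bar>w t\<bar> \<partial>lborel)" for x
  have [measurable]: "W \<in> borel_measurable borel"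
    unfolding W_def[abs_def] by (rule window_measurable) measurable
  have "L1_norm UNIV v \<le> (\<integral>\<^sup>+x. ennreal c * W x \<partial>lborel)"
    unfolding L1_norm_UNIV W_def by (intro nn_integral_mono v)
  also have "\<dots> = ennreal c * (\<integral>\<^sup>+x. W x \<partial>lborel)" by (rule nn_integral_cmult) simp
  also have "(\<integral>\<^sup>+x. W x \<partial>lborel) = ennreal (2 * e) * L1_norm UNIV w"
    unfolding W_def L1_norm_UNIV by (rule nn_integral_window) (use e in auto)
  also have "ennreal c * (ennreal (2 * e) * L1_norm UNIV w) = ennreal (2 * e * c) * L1_norm UNIV w"
    using e by (simp only: ennreal_mult mult_ac mult_nonneg_nonneg zero_le_numeral)
  finally show ?thesis .
qed

text \<open>This replaces \<open>w\<close> being the weak derivative of \<open>W\<close>.\<close>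

definition increments_dominated :: "(real \<Rightarrow> real) \<Rightarrow> (real \<Rightarrow> real) \<Rightarrow> bool" where
  "increments_dominated W w \<longleftrightarrow> w \<in> borel_measurable borel \<and>
     (\<forall>x y. x \<le> y \<longrightarrow> ennreal \<bar>W y - W x\<bar> \<le> (\<integral>\<^sup>+t\<in>{x..y}. ennreal \<bar>w t\<bar> \<partial>lborel))"

lemma increments_dominatedD:
  assumes "increments_dominated W w" "x \<in> {p..q}" "y \<in> {p..q}"
  shows "ennreal \<bar>W y - W x\<bar> \<le> (\<integral>\<^sup>+t\<in>{p..q}. ennreal \<bar>w t\<bar> \<partial>lborel)"
proof -
  have *: "ennreal \<bar>W y - W x\<bar> \<le> (\<integral>\<^sup>+t\<in>{p..q}. ennreal \<bar>w t\<bar> \<partial>lborel)"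
    if "x \<le> y" "x \<in> {p..q}" "y \<in> {p..q}" for x y
  proof -
    have "ennreal \<bar>W y - W x\<bar> \<le> (\<integral>\<^sup>+t\<in>{x..y}. ennreal \<bar>w t\<bar> \<partial>lborel)"
      using assms that by (auto simp: increments_dominated_def)
    also have "\<dots> \<le> (\<integral>\<^sup>+t\<in>{p..q}. ennreal \<bar>w t\<bar> \<partial>lborel)"
      by (intro nn_integral_mono) (use that in \<open>auto simp: indicator_def\<close>)
    finally show ?thesis .
  qed
  show ?thesis
    using *[of x y] *[of y x] assms(2,3) by (cases "x \<le> y") (auto simp: abs_minus_commute)
qed

text \<open>A central difference is at most the mean of |w| over its window. In contrast to
  \<open>L1_norm_cdiff\<close> no factor 1/e is lost, which is what gives the right exponent in the
  smoothing lemmas.\<close>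

lemma L1_norm_cdiff_dominated:
  assumes W: "increments_dominated W w" and e: "0 < e"
  shows "L1_norm UNIV (cdiff e W) \<le> L1_norm UNIV w"
proof -
  have "L1_norm UNIV (cdiff e W) \<le> ennreal (2 * e * (1 / (2 * e))) * L1_norm UNIV w"
  proof (rule L1_norm_window)
    fix x
    have "ennreal \<bar>cdiff e W x\<bar> = ennreal (1 / (2 * e)) * ennreal \<bar>W (x + e) - W (x - e)\<bar>"
      using e by (simp add: cdiff_def ennreal_mult[symmetric])
    also have "\<dots> \<le> ennreal (1 / (2 * e)) * (\<integral>\<^sup>+t\<in>{x - e..x + e}. ennreal \<bar>w t\<bar> \<partial>lborel)"
      by (intro mult_left_mono increments_dominatedD[OF W]) (use e in auto)
    finally show "ennreal \<bar>cdiff e W x\<bar> \<le> ennreal (1 / (2 * e)) * (\<integral>\<^sup>+t\<in>{x - e..x + e}. ennreal \<bar>w t\<bar> \<partial>lborel)" .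
  qed (use W e in \<open>auto simp: increments_dominated_def\<close>)
  then show ?thesis using e by simp
qed

lemma L1_norm_avg:
  assumes u: "continuous_on UNIV u" and e: "0 < e"
  shows "L1_norm UNIV (avg e u) \<le> L1_norm UNIV u"
proof -
  have "L1_norm UNIV (avg e u) \<le> ennreal (2 * e * (1 / (2 * e))) * L1_norm UNIV u"
  proof (rule L1_norm_window)
    fix x
    have c: "continuous_on {x - e..x + e} u" using u continuous_on_subset by blast
    have "norm (integral {x - e..x + e} u) \<le> integral {x - e..x + e} (\<lambda>t. \<bar>u t\<bar>)"
      by (rule integral_norm_bound_integral) (auto intro!: integrable_continuous_real continuous_intros c)
    then have "\<bar>avg e u x\<bar> \<le> 1 / (2 * e) * integral {x - e..x + e} (\<lambda>t. \<bar>u t\<bar>)"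
      using e by (simp add: avg_def divide_right_mono)
    then have "ennreal \<bar>avg e u x\<bar> \<le> ennreal (1 / (2 * e)) * L1_norm {x - e..x + e} u"
      using e by (simp add: L1_norm_continuous[OF c] ennreal_mult'[symmetric] ennreal_leI)
    then show "ennreal \<bar>avg e u x\<bar> \<le> ennreal (1 / (2 * e)) * (\<integral>\<^sup>+t\<in>{x - e..x + e}. ennreal \<bar>u t\<bar> \<partial>lborel)"
      by (simp add: L1_norm_def)
  qed (use u e in \<open>auto intro: borel_measurable_continuous_onI\<close>)
  then show ?thesis using e by simp
qed

lemma avg_error1:
  assumes f: "continuous_on UNIV f" "increments_dominated f w" and e: "0 < e"
  shows "L1_norm UNIV (\<lambda>x. avg e f x - f x) \<le> ennreal (2 * e) * L1_norm UNIV w"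
proof -
  obtain P where P: "\<And>x. (P has_real_derivative f x) (at x)"
    using antiderivative_exists[OF f(1)] by metis
  have "L1_norm UNIV (\<lambda>x. avg e f x - f x) \<le> ennreal (2 * e * 1) * L1_norm UNIV w"
  proof (rule L1_norm_window)
    fix x
    obtain z where z: "x - e < z" "z < x + e" "P (x + e) - P (x - e) = (x + e - (x - e)) * f z"
      using MVT2[of "x - e" "x + e" P f] P e by auto
    then have "avg e f x = f z" using avg_eq[OF _ P, of e x] e by (simp add: cdiff_def)
    then show "ennreal \<bar>avg e f x - f x\<bar> \<le> ennreal 1 * (\<integral>\<^sup>+t\<in>{x - e..x + e}. ennreal \<bar>w t\<bar> \<partial>lborel)"
      using increments_dominatedD[OF f(2), of x "x - e" "x + e" z] z e by simp
  qed (use f e in \<open>auto simp: increments_dominated_def\<close>)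
  then show ?thesis by simp
qed

text \<open>The contributions from x + t and x - t cancel to first order, leaving a second
  difference of \<open>f\<close>, that is, t times an increment of \<open>W\<close> inside the
  window. This gains the second power of e.\<close>

lemma avg_error2:
  assumes f: "\<And>x. (f has_real_derivative W x) (at x)" and W: "increments_dominated W w" and e: "0 < e"
  shows "L1_norm UNIV (\<lambda>x. avg e f x - f x) \<le> ennreal (2 * e\<^sup>2) * L1_norm UNIV w"
proof -
  have "continuous_on UNIV f" using DERIV_isCont[OF f] by (simp add: continuous_at_imp_continuous_on)
  then obtain P where P: "\<And>x. (P has_real_derivative f x) (at x)"
    using antiderivative_exists by metis
  have "L1_norm UNIV (\<lambda>x. avg e f x - f x) \<le> ennreal (2 * e * e) * L1_norm UNIV w"
  proof (rule L1_norm_window)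
    fix x
    \<comment> \<open>Up to the factor 2e, \<open>\<phi> e\<close> is the error of the average; its
      derivative in t is the symmetric second difference of \<open>f\<close>.\<close>
    define \<phi> where "\<phi> t = P (x + t) - P (x - t) - 2 * t * f x" for t
    have \<phi>: "(\<phi> has_real_derivative f (x + t) + f (x - t) - 2 * f x) (at t)" for t
      unfolding \<phi>_def[abs_def]
      by (rule derivative_eq_intros DERIV_chain2[OF P] refl | simp)+
    obtain t where t: "0 < t" "t < e" "\<phi> e - \<phi> 0 = (e - 0) * (f (x + t) + f (x - t) - 2 * f x)"
      using MVT2[of 0 e \<phi> "\<lambda>t. f (x + t) + f (x - t) - 2 * f x"] \<phi> e by auto
    obtain y where y: "x < y" "y < x + t" "f (x + t) - f x = (x + t - x) * W y"
      using MVT2[of x "x + t" f W] f t by auto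
    obtain z where z: "x - t < z" "z < x" "f x - f (x - t) = (x - (x - t)) * W z"
      using MVT2[of "x - t" x f W] f t by auto
    have "\<phi> 0 = 0" by (simp add: \<phi>_def)
    then have "\<phi> e = e * (f (x + t) + f (x - t) - 2 * f x)" using t by simp
    also have "f (x + t) + f (x - t) - 2 * f x = t * (W y - W z)" using y z by (simp add: algebra_simps)
    finally have \<phi>e: "\<phi> e = e * (t * (W y - W z))" .
    have "avg e f x - f x = \<phi> e / (2 * e)"
      using avg_eq[OF _ P, of e x] e by (simp add: cdiff_def \<phi>_def field_simps)
    also have "\<dots> = t / 2 * (W y - W z)" using \<phi>e e by simp
    finally have "\<bar>avg e f x - f x\<bar> = \<bar>t / 2 * (W y - W z)\<bar>" by (rule arg_cong)
    also have "\<dots> = t / 2 * \<bar>W y - W z\<bar>" using t by (simp add: abs_mult)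
    also have "\<dots> \<le> e * \<bar>W y - W z\<bar>" using t by (intro mult_right_mono) auto
    finally have "ennreal \<bar>avg e f x - f x\<bar> \<le> ennreal e * ennreal \<bar>W y - W z\<bar>"
      using e by (simp add: ennreal_mult[symmetric] ennreal_leI)
    also have "\<dots> \<le> ennreal e * (\<integral>\<^sup>+t\<in>{x - e..x + e}. ennreal \<bar>w t\<bar> \<partial>lborel)"
      by (intro mult_left_mono increments_dominatedD[OF W]) (use y z t in auto)
    finally show "ennreal \<bar>avg e f x - f x\<bar> \<le> ennreal e * (\<integral>\<^sup>+t\<in>{x - e..x + e}. ennreal \<bar>w t\<bar> \<partial>lborel)" .
  qed (use W e in \<open>auto simp: increments_dominated_def\<close>)
  then show ?thesis by (simp add: power2_eq_square mult.assoc)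
qed

lemma avg_diff:
  assumes "continuous_on UNIV u" "continuous_on UNIV v"
  shows "avg e (\<lambda>x. u x - v x) x = avg e u x - avg e v x"
  unfolding avg_def
  by (subst Henstock_Kurzweil_Integration.integral_diff)
     (auto intro!: integrable_continuous_real continuous_on_subset[OF assms(1)] continuous_on_subset[OF assms(2)]
       simp: diff_divide_distrib)

text \<open>Averaging is an L1 contraction, and avg^(r+1) f - f is the average of avg^r f - f plus
  avg f - f, so the errors add up linearly.\<close>

lemma funpow_avg_error:
  assumes f: "continuous_on UNIV f" and e: "0 < e"
  shows "L1_norm UNIV (\<lambda>x. (avg e ^^ r) f x - f x) \<le> of_nat r * L1_norm UNIV (\<lambda>x. avg e f x - f x)"
proof (induction r)
  case (Suc r)
  define v where "v x = (avg e ^^ r) f x - f x" for x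
  note c = funpow_avg_continuous[OF less_imp_le[OF e] f]
  have cv: "continuous_on UNIV v" unfolding v_def[abs_def] by (intro continuous_intros c f)
  have ca: "continuous_on UNIV (avg e v)" using avg_continuous[OF less_imp_le[OF e] cv] .
  have *: "(avg e ^^ Suc r) f x - f x = avg e v x + (avg e f x - f x)" for x
    by (simp add: v_def[abs_def] avg_diff[OF c f])
  have "L1_norm UNIV (\<lambda>x. (avg e ^^ Suc r) f x - f x) \<le> L1_norm UNIV (avg e v) + L1_norm UNIV (\<lambda>x. avg e f x - f x)"
    unfolding *
    by (rule L1_norm_triangle)
       (auto intro!: borel_measurable_continuous_onI continuous_intros ca f avg_continuous[OF less_imp_le[OF e] f] abs_triangle_ineq)
  also have "L1_norm UNIV (avg e v) \<le> L1_norm UNIV v" by (rule L1_norm_avg[OF cv e])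
  also have "\<dots> \<le> of_nat r * L1_norm UNIV (\<lambda>x. avg e f x - f x)" using Suc by (simp add: v_def[abs_def])
  finally show ?case by (simp add: algebra_simps add_right_mono)
qed (simp add: L1_norm_def)

text \<open>The top derivative consists of r + 1 central differences of \<open>f\<close>; the
  innermost one is absorbed by the domination of \<open>f\<close>, leaving r factors 1/e.\<close>

lemma smoothing1:
  assumes f: "continuous_on UNIV f" "increments_dominated f w" and e: "0 < e"
  shows "\<exists>E. derivs (Suc r) E \<and> L1_norm UNIV (E (Suc r)) \<le> ennreal ((1 / e) ^ r) * L1_norm UNIV w \<and>
    L1_norm UNIV (\<lambda>x. E 0 x - f x) \<le> ennreal (real (Suc r) * (2 * e)) * L1_norm UNIV w"
proof (intro exI conjI)
  let ?E = "\<lambda>i. (cdiff e ^^ i) ((avg e ^^ (Suc r - i)) f)"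
  show "derivs (Suc r) ?E" using derivs_funpow_avg[OF less_imp_le[OF e] f(1)] .
  have "L1_norm UNIV ((cdiff e ^^ r) (cdiff e f)) \<le> ennreal ((1 / e) ^ r) * L1_norm UNIV (cdiff e f)"
    by (rule L1_norm_funpow_cdiff[OF _ e]) (intro borel_measurable_continuous_onI cdiff_continuous f)
  also have "\<dots> \<le> ennreal ((1 / e) ^ r) * L1_norm UNIV w"
    by (intro mult_left_mono L1_norm_cdiff_dominated[OF f(2) e]) auto
  finally show "L1_norm UNIV (?E (Suc r)) \<le> ennreal ((1 / e) ^ r) * L1_norm UNIV w"
    by (simp add: funpow_swap1)
  have "L1_norm UNIV (\<lambda>x. (avg e ^^ Suc r) f x - f x) \<le> of_nat (Suc r) * L1_norm UNIV (\<lambda>x. avg e f x - f x)"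
    by (rule funpow_avg_error[OF f(1) e])
  also have "\<dots> \<le> of_nat (Suc r) * (ennreal (2 * e) * L1_norm UNIV w)"
    by (intro mult_left_mono avg_error1[OF f e]) auto
  also have "\<dots> = ennreal (real (Suc r) * (2 * e)) * L1_norm UNIV w"
    using e by (simp only: ennreal_mult mult.assoc ennreal_of_nat_eq_real_of_nat of_nat_0_le_iff less_imp_le mult_nonneg_nonneg zero_le_numeral)
  finally show "L1_norm UNIV (\<lambda>x. ?E 0 x - f x) \<le> ennreal (real (Suc r) * (2 * e)) * L1_norm UNIV w"
    by simp
qed

text \<open>With r + 1 averages and the derivative \<open>W\<close> of \<open>f\<close>, order r + 2
  is reached; the top derivative consists of r + 1 differences of \<open>W\<close>, the innermost of
  which is free. For w of size 1/e this gives e^(1-k) with k = r + 2 and an error O(e).\<close>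

lemma smoothing2:
  assumes f: "\<And>x. (f has_real_derivative W x) (at x)"
    and W: "continuous_on UNIV W" "increments_dominated W w" and e: "0 < e"
  shows "\<exists>E. derivs (Suc (Suc r)) E \<and> L1_norm UNIV (E (Suc (Suc r))) \<le> ennreal ((1 / e) ^ r) * L1_norm UNIV w \<and>
    L1_norm UNIV (\<lambda>x. E 0 x - f x) \<le> ennreal (real (Suc r) * (2 * e\<^sup>2)) * L1_norm UNIV w"
proof (intro exI conjI)
  let ?E = "\<lambda>i. if i = Suc (Suc r) then (cdiff e ^^ Suc r) W else (cdiff e ^^ i) ((avg e ^^ (Suc r - i)) f)"
  have cf: "continuous_on UNIV f" using DERIV_isCont[OF f] by (simp add: continuous_at_imp_continuous_on)
  show "derivs (Suc (Suc r)) ?E" using derivs_funpow_avg_Suc[OF less_imp_le[OF e] f W(1)] .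
  have "L1_norm UNIV ((cdiff e ^^ r) (cdiff e W)) \<le> ennreal ((1 / e) ^ r) * L1_norm UNIV (cdiff e W)"
    by (rule L1_norm_funpow_cdiff[OF _ e]) (intro borel_measurable_continuous_onI cdiff_continuous W)
  also have "\<dots> \<le> ennreal ((1 / e) ^ r) * L1_norm UNIV w"
    by (intro mult_left_mono L1_norm_cdiff_dominated[OF W(2) e]) auto
  finally show "L1_norm UNIV (?E (Suc (Suc r))) \<le> ennreal ((1 / e) ^ r) * L1_norm UNIV w"
    by (simp add: funpow_swap1)
  have "L1_norm UNIV (\<lambda>x. (avg e ^^ Suc r) f x - f x) \<le> of_nat (Suc r) * L1_norm UNIV (\<lambda>x. avg e f x - f x)"
    by (rule funpow_avg_error[OF cf e])
  also have "\<dots> \<le> of_nat (Suc r) * (ennreal (2 * e\<^sup>2) * L1_norm UNIV w)"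
    by (intro mult_left_mono avg_error2[OF f W(2) e]) auto
  also have "\<dots> = ennreal (real (Suc r) * (2 * e\<^sup>2)) * L1_norm UNIV w"
    by (simp only: ennreal_mult mult.assoc ennreal_of_nat_eq_real_of_nat of_nat_0_le_iff zero_le_power2 mult_nonneg_nonneg zero_le_numeral)
  finally show "L1_norm UNIV (\<lambda>x. ?E 0 x - f x) \<le> ennreal (real (Suc r) * (2 * e\<^sup>2)) * L1_norm UNIV w"
    by simp
qed

section \<open>Raising the order\<close>

text \<open>Freezing at a and b may destroy differentiability there, but increments outside {a..b}
  vanish and those inside are unchanged, so the truncated derivative still dominates.\<close>

lemma increments_dominated_clamp:
  assumes "a < b" "derivs k U" "j < k"
  shows "increments_dominated (\<lambda>x. U j (clamp1 a b x)) (\<lambda>x. indicator {a..b} x * U (Suc j) x)"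
  unfolding increments_dominated_def
proof (intro conjI allI impI)
  have "U (Suc j) \<in> borel_measurable borel" using derivs_measurable[OF assms(2)] assms(3) by simp
  then show "(\<lambda>x. indicator {a..b} x * U (Suc j) x) \<in> borel_measurable borel" by measurable
  fix x y :: real assume xy: "x \<le> y"
  show "ennreal \<bar>U j (clamp1 a b y) - U j (clamp1 a b x)\<bar> \<le> (\<integral>\<^sup>+t\<in>{x..y}. ennreal \<bar>indicator {a..b} t * U (Suc j) t\<bar> \<partial>lborel)"
  proof (cases "clamp1 a b x = clamp1 a b y")
    case False
    have "ennreal \<bar>U j (clamp1 a b y) - U j (clamp1 a b x)\<bar> \<le> (\<integral>\<^sup>+t\<in>{clamp1 a b x..clamp1 a b y}. ennreal \<bar>U (Suc j) t\<bar> \<partial>lborel)"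
      by (rule derivs_increment_le[OF assms(2,3)]) (use xy in \<open>auto simp: clamp1_def\<close>)
    also have "\<dots> \<le> (\<integral>\<^sup>+t\<in>{x..y}. ennreal \<bar>indicator {a..b} t * U (Suc j) t\<bar> \<partial>lborel)"
      using False xy assms(1) by (intro nn_integral_mono) (auto simp: indicator_def clamp1_def)
    finally show ?thesis .
  qed simp
qed

lemma L1_norm_approx_triangle:
  assumes [measurable]: "g \<in> borel_measurable borel" "E \<in> borel_measurable borel" "f \<in> borel_measurable borel" "u \<in> borel_measurable borel"
    and f: "\<And>x. x \<in> {a..b} \<Longrightarrow> f x = u x"
    and "L1_norm UNIV (\<lambda>x. E x - f x) \<le> ennreal p" "L1_norm {a..b} (\<lambda>x. u x - g x) \<le> ennreal q"
    and "0 \<le> p" "0 \<le> q" "p + q \<le> r"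
  shows "L1_norm {a..b} (\<lambda>x. E x - g x) \<le> ennreal r"
proof -
  have "L1_norm {a..b} (\<lambda>x. E x - g x) \<le> L1_norm {a..b} (\<lambda>x. E x - f x) + L1_norm {a..b} (\<lambda>x. u x - g x)"
    by (rule L1_norm_triangle) (use f in auto)
  also have "\<dots> \<le> ennreal p + ennreal q"
    by (intro add_mono assms order_trans[OF L1_norm_subset assms(6)]) auto
  also have "\<dots> \<le> ennreal r" using assms by (simp flip: ennreal_plus add: ennreal_leI)
  finally show ?thesis .
qed

lemma S1_subset_S_space_Suc:
  assumes "a < b"
  shows "S_space 1 a b \<subseteq> S_space (Suc r) a b"
proof
  fix g assume g: "g \<in> S_space 1 a b"
  then have L1: "g \<in> L1 a b" by (simp add: S_space_def)
  obtain g' where g': "borel_version a b g g'" using borel_version_exists[OF L1] .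
  obtain C U where "dyadic_approx a b 1 g' C U" using S_space_imp_dyadic_approx[OF assms(1) g g'] .
  then have C: "0 \<le> C" and U: "derivs 1 (U n)" "L1_norm {a..b} (U n 1) \<le> ennreal C"
      "L1_norm {a..b} (\<lambda>x. U n 0 x - g' x) \<le> ennreal (C / 2 ^ n)" for n
    by (auto simp: dyadic_approx_def)
  note gm = borel_version_measurable[OF g']
  \<comment> \<open>The error is made of 2(r + 1)C from smoothing with e = 1 / 2^n and C from the
    given approximation.\<close>
  define D where "D = (real (Suc r) * 2 + 1) * C"
  have "C \<le> D" using C by (simp add: D_def algebra_simps)
  show "g \<in> S_space (Suc r) a b"
  proof (rule S_spaceI[OF assms(1) L1 g', of D])
    show "0 \<le> D" using C by (simp add: D_def)
    fix n
    define f where "f x = U n 0 (clamp1 a b x)" for x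
    define w where "w x = indicator {a..b} x * U n 1 x" for x
    have f: "continuous_on UNIV f" "increments_dominated f w"
      using continuous_clamp1[of a b "U n 0"] increments_dominated_clamp[OF assms U(1), of 0 n]
        continuous_on_subset[OF derivs_continuous[OF U(1), of 0 n]] assms
      by (auto simp: f_def[abs_def] w_def[abs_def])
    have w: "L1_norm UNIV w \<le> ennreal C"
      unfolding w_def L1_norm_UNIV_indicator by (rule U(2))
    obtain E where E: "derivs (Suc r) E" "L1_norm UNIV (E (Suc r)) \<le> ennreal ((1 / (1 / 2 ^ n)) ^ r) * L1_norm UNIV w"
      "L1_norm UNIV (\<lambda>x. E 0 x - f x) \<le> ennreal (real (Suc r) * (2 * (1 / 2 ^ n))) * L1_norm UNIV w"
      using smoothing1[OF f, of "1 / 2 ^ n" r] by auto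
    have "L1_norm {a..b} (E (Suc r)) \<le> L1_norm UNIV (E (Suc r))" by (rule L1_norm_subset) simp
    also have "\<dots> \<le> ennreal ((2 ^ n) ^ r) * ennreal C"
      using E(2) by (elim order_trans) (simp add: mult_left_mono w)
    also have "\<dots> \<le> ennreal (D * (2 ^ (Suc r - 1)) ^ n)"
      using \<open>C \<le> D\<close> C by (simp add: ennreal_mult[symmetric] power_mult[symmetric] mult.commute ennreal_leI mult_right_mono)
    finally have 1: "L1_norm {a..b} (E (Suc r)) \<le> ennreal (D * (2 ^ (Suc r - 1)) ^ n)" .
    have "L1_norm UNIV (\<lambda>x. E 0 x - f x) \<le> ennreal (real (Suc r) * (2 * (1 / 2 ^ n))) * ennreal C"
      using E(3) by (elim order_trans) (intro mult_left_mono w, simp)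
    then have e: "L1_norm UNIV (\<lambda>x. E 0 x - f x) \<le> ennreal (real (Suc r) * (2 * (1 / 2 ^ n)) * C)"
      using C by (subst ennreal_mult) auto
    have "L1_norm {a..b} (\<lambda>x. E 0 x - g' x) \<le> ennreal (D / 2 ^ n)"
    proof (rule L1_norm_approx_triangle[OF gm _ _ _ _ e U(3)])
      show "f \<in> borel_measurable borel" using f(1) by (rule borel_measurable_continuous_onI)
      show "real (Suc r) * (2 * (1 / 2 ^ n)) * C + C / 2 ^ n \<le> D / 2 ^ n"
        by (simp add: D_def field_simps)
    qed (use C derivs_measurable[OF E(1)] derivs_measurable[OF U(1)] clamp1_id in \<open>auto simp: f_def\<close>)
    with 1 E(1) show "\<exists>U. derivs (Suc r) U \<and> L1_norm {a..b} (U (Suc r)) \<le> ennreal (D * (2 ^ (Suc r - 1)) ^ n) \<and>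
       L1_norm {a..b} (\<lambda>x. U 0 x - g' x) \<le> ennreal (D / 2 ^ n)" by blast
  qed
qed

text \<open>Continuation by tangent lines keeps \<open>f\<close> continuously differentiable and
  freezes its derivative outside {a..b}. The values of \<open>U\<close> outside would carry no bound
  on the second derivative.\<close>

lemma derivs_extend_affine:
  assumes "a < b" "derivs 1 U"
  obtains f where "\<And>x. (f has_real_derivative U 1 (clamp1 a b x)) (at x)" "\<And>x. x \<in> {a..b} \<Longrightarrow> f x = U 0 x"
proof -
  have c: "continuous_on UNIV (\<lambda>x. U 1 (clamp1 a b x))"
    using assms(1) continuous_on_subset[OF derivs_continuous[OF assms(2), of 1]] by (intro continuous_clamp1) auto
  obtain f where f: "f a = U 0 a" "\<And>x. (f has_real_derivative U 1 (clamp1 a b x)) (at x)"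
    by (rule antiderivative_exists[OF c, of a "U 0 a"]) blast
  have "f x = U 0 x" if x: "x \<in> {a..b}" for x
  proof -
    have "f x - U 0 x = f a - U 0 a"
    proof (rule has_derivative_zero_unique[of "{a..b}" "\<lambda>x. f x - U 0 x"])
      show "((\<lambda>x. f x - U 0 x) has_derivative (\<lambda>h. 0)) (at y within {a..b})" if y: "y \<in> {a..b}" for y
      proof -
        have "((\<lambda>x. f x - U 0 x) has_real_derivative U 1 (clamp1 a b y) - U 1 y) (at y within {a..b})"
          using DERIV_subset[OF derivs_D[OF assms(2), of 0 y] subset_UNIV]
          by (intro DERIV_diff DERIV_subset[OF f(2) subset_UNIV]) simp
        then show ?thesis using clamp1_id[OF y] by (simp add: has_field_derivative_def lambda_zero)
      qed
    qed (use x assms(1) in auto)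
    then show ?thesis using f by simp
  qed
  then show ?thesis using f(2) that by blast
qed

text \<open>At e = 1 / 2^n the dominating function has norm C 2^n. The factor e^2 of the symmetric
  error turns this into C / 2^n, and the r factors 1/e give 2^((k-1)n).\<close>

lemma S2_subset_S_space:
  assumes "a < b" "2 \<le> k"
  shows "S_space 2 a b \<subseteq> S_space k a b"
proof
  obtain r where k: "k = Suc (Suc r)" using assms(2) by (metis One_nat_def Suc_1 Suc_le_D Suc_le_mono)
  fix g assume g: "g \<in> S_space 2 a b"
  then have L1: "g \<in> L1 a b" by (simp add: S_space_def)
  obtain g' where g': "borel_version a b g g'" using borel_version_exists[OF L1] .
  obtain C U where "dyadic_approx a b 2 g' C U" using S_space_imp_dyadic_approx[OF assms(1) g g'] .
  then have C: "0 \<le> C" and U: "derivs 2 (U n)" "L1_norm {a..b} (U n 2) \<le> ennreal (C * 2 ^ n)"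
      "L1_norm {a..b} (\<lambda>x. U n 0 x - g' x) \<le> ennreal (C / 2 ^ n)" for n
    by (auto simp: dyadic_approx_def)
  note gm = borel_version_measurable[OF g']
  define D where "D = (real (Suc r) * 2 + 1) * C"
  have "C \<le> D" using C by (simp add: D_def algebra_simps)
  show "g \<in> S_space k a b"
  proof (rule S_spaceI[OF assms(1) L1 g', of D])
    show "0 \<le> D" using C by (simp add: D_def)
    fix n
    define W where "W x = U n 1 (clamp1 a b x)" for x
    define w where "w x = indicator {a..b} x * U n 2 x" for x
    obtain f where f: "\<And>x. (f has_real_derivative W x) (at x)" "\<And>x. x \<in> {a..b} \<Longrightarrow> f x = U n 0 x"
      using derivs_extend_affine[OF assms(1) derivs_le[OF U(1) one_le_numeral]] unfolding W_def by metis
    have W: "continuous_on UNIV W" "increments_dominated W w"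
      using continuous_clamp1[of a b "U n 1"] increments_dominated_clamp[OF assms(1) U(1), of 1 n]
        continuous_on_subset[OF derivs_continuous[OF U(1), of 1 n]] assms
      by (auto simp: W_def[abs_def] w_def[abs_def] numeral_2_eq_2)
    have w: "L1_norm UNIV w \<le> ennreal (C * 2 ^ n)"
      unfolding w_def L1_norm_UNIV_indicator by (rule U(2))
    obtain E where E: "derivs k E" "L1_norm UNIV (E k) \<le> ennreal ((1 / (1 / 2 ^ n)) ^ r) * L1_norm UNIV w"
      "L1_norm UNIV (\<lambda>x. E 0 x - f x) \<le> ennreal (real (Suc r) * (2 * (1 / 2 ^ n)\<^sup>2)) * L1_norm UNIV w"
      using smoothing2[OF f(1) W, of "1 / 2 ^ n" r] k by auto
    have "L1_norm {a..b} (E k) \<le> L1_norm UNIV (E k)" by (rule L1_norm_subset) simp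
    also have "\<dots> \<le> ennreal ((2 ^ n) ^ r) * ennreal (C * 2 ^ n)"
      using E(2) by (elim order_trans) (simp add: mult_left_mono w)
    also have "\<dots> = ennreal (C * (2 ^ (k - 1)) ^ n)"
      using C k by (simp add: ennreal_mult[symmetric] power_mult[symmetric] power_add[symmetric] mult_ac)
    also have "\<dots> \<le> ennreal (D * (2 ^ (k - 1)) ^ n)"
      using \<open>C \<le> D\<close> by (intro ennreal_leI mult_right_mono) auto
    finally have 1: "L1_norm {a..b} (E k) \<le> ennreal (D * (2 ^ (k - 1)) ^ n)" .
    have "L1_norm UNIV (\<lambda>x. E 0 x - f x) \<le> ennreal (real (Suc r) * (2 * (1 / 2 ^ n)\<^sup>2)) * ennreal (C * 2 ^ n)"
      using E(3) by (elim order_trans) (intro mult_left_mono w, simp)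
    also have "\<dots> = ennreal (real (Suc r) * (2 * (1 / 2 ^ n)\<^sup>2) * (C * 2 ^ n))"
      using C by (subst ennreal_mult) auto
    finally have e: "L1_norm UNIV (\<lambda>x. E 0 x - f x) \<le> ennreal (real (Suc r) * (2 * (1 / 2 ^ n)\<^sup>2) * (C * 2 ^ n))" .
    have "L1_norm {a..b} (\<lambda>x. E 0 x - g' x) \<le> ennreal (D / 2 ^ n)"
    proof (rule L1_norm_approx_triangle[OF gm _ _ _ _ e U(3)])
      show "f \<in> borel_measurable borel"
        using DERIV_isCont[OF f(1)] by (intro borel_measurable_continuous_onI continuous_at_imp_continuous_on) simp
      show "real (Suc r) * (2 * (1 / 2 ^ n)\<^sup>2) * (C * 2 ^ n) + C / 2 ^ n \<le> D / 2 ^ n"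
        by (simp add: D_def field_simps power2_eq_square)
    qed (use C derivs_measurable[OF E(1)] derivs_measurable[OF U(1)] f(2) in auto)
    with 1 E(1) show "\<exists>U. derivs k U \<and> L1_norm {a..b} (U k) \<le> ennreal (D * (2 ^ (k - 1)) ^ n) \<and>
       L1_norm {a..b} (\<lambda>x. U 0 x - g' x) \<le> ennreal (D / 2 ^ n)" by blast
  qed
qed

section \<open>Bounded variation\<close>

lemma C1cD:
  assumes "\<phi> \<in> C1c a b"
  shows "(\<phi> has_real_derivative deriv \<phi> x) (at x)" "continuous_on UNIV (deriv \<phi>)"
    "x \<notin> {a<..<b} \<Longrightarrow> \<phi> x = 0"
proof -
  obtain D where D: "\<And>x. (\<phi> has_real_derivative D x) (at x)" "continuous_on UNIV D"
    using assms unfolding C1c_def C1_differentiable_on_def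
    by (auto simp: has_real_derivative_iff_has_vector_derivative)
  have "deriv \<phi> = D" using D(1) DERIV_imp_deriv by blast
  then show "(\<phi> has_real_derivative deriv \<phi> x) (at x)" "continuous_on UNIV (deriv \<phi>)" using D by auto
  show "\<phi> x = 0" if "x \<notin> {a<..<b}"
    using assms that closure_subset[of "support_on UNIV \<phi>"] in_support_on[of x UNIV \<phi>] unfolding C1c_def by blast
qed

lemma C1cI:
  assumes "\<And>x. (\<phi> has_real_derivative D x) (at x)" "continuous_on UNIV D"
    "\<And>x. x \<notin> {c..d} \<Longrightarrow> \<phi> x = 0" "{c..d} \<subseteq> {a<..<b}"
  shows "\<phi> \<in> C1c a b" "deriv \<phi> = D"
proof -
  have "support_on UNIV \<phi> \<subseteq> {c..d}" using assms(3) in_support_on[of _ UNIV \<phi>] by blast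
  then have "closure (support_on UNIV \<phi>) \<subseteq> {c..d}" by (intro closure_minimal) auto
  then show "\<phi> \<in> C1c a b"
    using assms unfolding C1c_def C1_differentiable_on_def
    by (auto simp: has_real_derivative_iff_has_vector_derivative)
  show "deriv \<phi> = D" using assms(1) DERIV_imp_deriv by blast
qed

lemma LINT_borel_version:
  assumes g': "borel_version a b g g'" and p[measurable]: "p \<in> borel_measurable borel"
  shows "(LINT x:{a<..<b}|lebesgue. g x * p x) = (LINT x|lborel. g' x * p x)"
proof -
  have [measurable]: "g' \<in> borel_measurable borel" using borel_version_measurable[OF g'] .
  have z: "\<And>x. x \<notin> {a<..<b} \<Longrightarrow> g' x = 0" and ae: "AE x in lborel. x \<in> {a<..<b} \<longrightarrow> g x = g' x"
    using g' by (auto simp: borel_version_def)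
  have ae1: "AE x in lborel. g' x * p x = indicator {a<..<b} x *\<^sub>R (g x * p x)"
    using ae by (rule eventually_mono) (use z in \<open>auto simp: indicator_def\<close>)
  have m: "(\<lambda>x. g' x * p x) \<in> borel_measurable lebesgue" by (rule measurable_completion) simp
  have "(LINT x:{a<..<b}|lebesgue. g x * p x) = (LINT x|lebesgue. g' x * p x)"
    unfolding set_lebesgue_integral_def
  proof (rule integral_cong_AE)
    show "(\<lambda>x. indicator {a<..<b} x *\<^sub>R (g x * p x)) \<in> borel_measurable lebesgue"
      by (rule borel_measurable_AE[OF m AE_completion[OF ae1]])
    show "AE x in lebesgue. indicator {a<..<b} x *\<^sub>R (g x * p x) = g' x * p x"
      using AE_completion[OF ae1] by eventually_elim (rule sym)
  qed (rule m)
  also have "\<dots> = (LINT x|lborel. g' x * p x)" by (rule integral_completion) simp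
  finally show ?thesis .
qed

lemma continuous_indicator_integrable:
  fixes u :: "real \<Rightarrow> real"
  shows "continuous_on UNIV u \<Longrightarrow> integrable lborel (\<lambda>x. indicator {a..b} x *\<^sub>R u x)"
  using borel_integrable_atLeastAtMost'[of a b u] continuous_on_subset[of UNIV u "{a..b}"]
  by (simp add: set_integrable_def)

lemma integral_parts_C1c:
  assumes "a < b" "derivs 1 U" "\<phi> \<in> C1c a b"
  shows "(LINT x|lborel. indicator {a..b} x *\<^sub>R (U 0 x * deriv \<phi> x)) =
    - (LINT x|lborel. indicator {a..b} x *\<^sub>R (U 1 x * \<phi> x))"
proof -
  note c = derivs_continuous[OF assms(2)] C1cD(2)[OF assms(3)]
  have c\<phi>: "continuous_on UNIV \<phi>"
    using DERIV_isCont[OF C1cD(1)[OF assms(3)]] by (simp add: continuous_at_imp_continuous_on)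
  have "(LINT x|lborel. indicator {a..b} x *\<^sub>R (U 1 x * \<phi> x + U 0 x * deriv \<phi> x)) = U 0 b * \<phi> b - U 0 a * \<phi> a"
  proof (rule integral_FTC_atLeastAtMost)
    show "((\<lambda>x. U 0 x * \<phi> x) has_vector_derivative U 1 x * \<phi> x + U 0 x * deriv \<phi> x) (at x within {a..b})" for x
      using DERIV_mult[OF derivs_D[OF assms(2), of 0 x] C1cD(1)[OF assms(3), of x]]
      by (auto simp: has_real_derivative_iff_has_vector_derivative algebra_simps intro: has_vector_derivative_at_within)
    show "continuous_on {a..b} (\<lambda>x. U 1 x * \<phi> x + U 0 x * deriv \<phi> x)"
      by (rule continuous_on_subset[of UNIV]) (intro continuous_intros c c\<phi> | simp)+
  qed (use assms in auto)
  also have "\<dots> = 0" using C1cD(3)[OF assms(3)] by simp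
  finally show ?thesis
    by (simp add: scaleR_add_right del: real_scaleR_def)
       (subst (asm) Bochner_Integration.integral_add,
        auto intro!: continuous_indicator_integrable continuous_intros c c\<phi> simp del: real_scaleR_def)
qed

text \<open>Lower semicontinuity of the variation: the approximations have derivatives of norm at
  most C and converge to g in L1, and the pairing with a fixed test function passes to the
  limit.\<close>

lemma S1_subset_BV:
  assumes "a < b"
  shows "S_space 1 a b \<subseteq> BV a b"
proof
  fix g assume g: "g \<in> S_space 1 a b"
  then have L1: "g \<in> L1 a b" by (simp add: S_space_def)
  obtain g' where g': "borel_version a b g g'" using borel_version_exists[OF L1] .
  obtain C U where "dyadic_approx a b 1 g' C U" using S_space_imp_dyadic_approx[OF assms(1) g g'] .
  then have C: "0 \<le> C" and U: "derivs 1 (U n)" "L1_norm {a..b} (U n 1) \<le> ennreal C"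
      "L1_norm {a..b} (\<lambda>x. U n 0 x - g' x) \<le> ennreal (C / 2 ^ n)" for n
    by (auto simp: dyadic_approx_def)
  note gm[measurable] = borel_version_measurable[OF g']
  have gi: "integrable lborel g'" and gz: "\<And>x. x \<notin> {a<..<b} \<Longrightarrow> g' x = 0" using g' by (auto simp: borel_version_def)
  have "(LINT x:{a<..<b}|lebesgue. g x * deriv \<phi> x) \<le> C + 1"
    if \<phi>: "\<phi> \<in> C1c a b" and \<phi>1: "\<forall>x. \<bar>\<phi> x\<bar> \<le> 1" for \<phi>
  proof -
    note d = C1cD(2)[OF \<phi>]
    have [measurable]: "deriv \<phi> \<in> borel_measurable borel" using d by (rule borel_measurable_continuous_onI)
    have c\<phi>: "continuous_on UNIV \<phi>"
      using DERIV_isCont[OF C1cD(1)[OF \<phi>]] by (simp add: continuous_at_imp_continuous_on)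
    have "bounded (deriv \<phi> ` {a..b})"
      by (intro compact_imp_bounded compact_continuous_image continuous_on_subset[OF d]) auto
    then obtain K where K: "0 < K" "\<And>x. x \<in> {a..b} \<Longrightarrow> \<bar>deriv \<phi> x\<bar> \<le> K"
      by (auto simp: bounded_pos)
    \<comment> \<open>\<open>K\<close> depends on the test function, so n is chosen after it; the
      bound C + 1 depends on neither.\<close>
    obtain n where "K * C < 2 ^ n" using real_arch_pow[of 2 "K * C"] by auto
    then have n: "K * (C / 2 ^ n) \<le> 1" by (simp add: field_simps)
    note cU = derivs_continuous[OF U(1)[of n]]
    have [measurable]: "U n 0 \<in> borel_measurable borel" "U n 1 \<in> borel_measurable borel"
      using cU by (auto intro!: borel_measurable_continuous_onI)
    define p where "p x = indicator {a..b} x *\<^sub>R (U n 0 x * deriv \<phi> x)" for x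
    define q where "q x = g' x * deriv \<phi> x - p x" for x
    define r where "r x = indicator {a..b} x *\<^sub>R (U n 1 x * \<phi> x)" for x
    have pi: "integrable lborel p" and ri: "integrable lborel r"
      unfolding p_def[abs_def] r_def[abs_def]
      by (intro continuous_indicator_integrable continuous_intros cU d c\<phi> | simp)+
    have gdi: "integrable lborel (\<lambda>x. g' x * deriv \<phi> x)"
    proof (rule Bochner_Integration.integrable_bound[of _ "\<lambda>x. K * g' x"])
      have "\<bar>g' x\<bar> * \<bar>deriv \<phi> x\<bar> \<le> K * \<bar>g' x\<bar>" for x
        using gz[of x] mult_right_mono[OF K(2)[of x], of "\<bar>g' x\<bar>"]
        by (cases "x \<in> {a<..<b}") (auto simp: mult.commute)
      then show "AE x in lborel. norm (g' x * deriv \<phi> x) \<le> norm (K * g' x)" using K by (auto simp: abs_mult)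
    qed (use gi in auto)
    have qi: "integrable lborel q" unfolding q_def using gdi pi by auto
    have "ennreal \<bar>LINT x|lborel. q x\<bar> \<le> (\<integral>\<^sup>+x. ennreal \<bar>q x\<bar> \<partial>lborel)"
      using integral_norm_bound_ennreal[OF qi] by simp
    also have "\<dots> \<le> (\<integral>\<^sup>+x. ennreal K * (ennreal \<bar>U n 0 x - g' x\<bar> * indicator {a..b} x) \<partial>lborel)"
    proof (rule nn_integral_mono)
      fix x
      show "ennreal \<bar>q x\<bar> \<le> ennreal K * (ennreal \<bar>U n 0 x - g' x\<bar> * indicator {a..b} x)"
      proof (cases "x \<in> {a..b}")
        case True
        have "\<bar>q x\<bar> = \<bar>U n 0 x - g' x\<bar> * \<bar>deriv \<phi> x\<bar>"
          using True by (simp add: q_def p_def abs_mult[symmetric]) (simp add: algebra_simps abs_minus_commute)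
        also have "\<dots> \<le> K * \<bar>U n 0 x - g' x\<bar>" using K(2)[OF True] by (simp add: mult.commute mult_right_mono)
        finally show ?thesis using True K by (simp add: ennreal_mult'[symmetric] ennreal_leI)
      qed (use gz[of x] in \<open>auto simp: q_def p_def\<close>)
    qed
    also have "\<dots> = ennreal K * L1_norm {a..b} (\<lambda>x. U n 0 x - g' x)"
      unfolding L1_norm_def by (rule nn_integral_cmult) measurable
    also have "\<dots> \<le> ennreal K * ennreal (C / 2 ^ n)" by (intro mult_left_mono U) auto
    also have "\<dots> = ennreal (K * (C / 2 ^ n))" using K C by (intro ennreal_mult[symmetric]) auto
    finally have 1: "\<bar>LINT x|lborel. q x\<bar> \<le> K * (C / 2 ^ n)" using K C by (subst (asm) ennreal_le_iff) auto
    have "ennreal \<bar>LINT x|lborel. r x\<bar> \<le> (\<integral>\<^sup>+x. ennreal \<bar>r x\<bar> \<partial>lborel)"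
      using integral_norm_bound_ennreal[OF ri] by simp
    also have "\<dots> \<le> L1_norm {a..b} (U n 1)"
      unfolding L1_norm_def
      using \<phi>1 by (intro nn_integral_mono) (auto simp: r_def indicator_def abs_mult intro!: ennreal_leI mult_left_le)
    also have "\<dots> \<le> ennreal C" by (rule U)
    finally have 2: "\<bar>LINT x|lborel. r x\<bar> \<le> C" using C by (subst (asm) ennreal_le_iff) auto
    have "(LINT x:{a<..<b}|lebesgue. g x * deriv \<phi> x) = (LINT x|lborel. g' x * deriv \<phi> x)"
      by (rule LINT_borel_version[OF g']) simp
    also have "\<dots> = (LINT x|lborel. p x) + (LINT x|lborel. q x)"
      by (subst Bochner_Integration.integral_add[symmetric]) (use pi qi in \<open>auto simp: q_def\<close>)
    also have "(LINT x|lborel. p x) = - (LINT x|lborel. r x)"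
      unfolding p_def r_def by (rule integral_parts_C1c[OF assms U(1) \<phi>])
    finally show ?thesis using 1 2 n by linarith
  qed
  then show "g \<in> BV a b" using L1 by (auto simp: BV_def intro!: bdd_aboveI2)
qed

text \<open>Minus the mean of \<open>\<psi>\<close> over {x - h..x} is an admissible test function
  bounded by 1, and its derivative is a difference quotient of \<open>\<psi>\<close>; a change of
  variable moves that difference onto g. The support grows by h to the right, whence d < b -
  h.\<close>

lemma BV_translation_test:
  assumes g: "integrable lborel g"
    and C: "\<And>\<phi>. \<phi> \<in> C1c a b \<Longrightarrow> (\<And>x. \<bar>\<phi> x\<bar> \<le> 1) \<Longrightarrow> (LINT x|lborel. g x * deriv \<phi> x) \<le> C"
    and h: "0 < h" and \<psi>: "continuous_on UNIV \<psi>" "\<And>x. \<bar>\<psi> x\<bar> \<le> 1"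
    and supp: "a < c" "d < b - h" "\<And>x. x \<notin> {c..d} \<Longrightarrow> \<psi> x = 0"
  shows "(LINT x|lborel. (g (x + h) - g x) * \<psi> x) \<le> C * h"
proof -
  obtain P where P: "\<And>x. (P has_real_derivative \<psi> x) (at x)"
    using antiderivative_exists[OF \<psi>(1)] by metis
  define \<phi> where "\<phi> x = (P (x + - h) - P x) / h" for x
  define D where "D x = (\<psi> (x + - h) - \<psi> x) / h" for x
  have mv: "\<exists>z. x - h < z \<and> z < x \<and> \<phi> x = - \<psi> z" for x
    using MVT2[of "x - h" x P \<psi>] P h by (auto simp: \<phi>_def field_simps)
  have d\<phi>: "(\<phi> has_real_derivative D x) (at x)" for x
  proof -
    have "((\<lambda>x. P (x + - h)) has_real_derivative \<psi> (x + - h)) (at x)"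
      using P[of "x + - h"] by (simp only: DERIV_shift)
    then show ?thesis unfolding \<phi>_def[abs_def] D_def using P[of x] by (intro DERIV_cdivide DERIV_diff)
  qed
  have cD: "continuous_on UNIV D" unfolding D_def[abs_def]
    using h by (intro continuous_intros continuous_on_compose2[OF \<psi>(1)] \<psi>(1)) auto
  have supp\<phi>: "\<phi> x = 0" if "x \<notin> {c..d + h}" for x
  proof -
    obtain z where "x - h < z" "z < x" "\<phi> x = - \<psi> z" using mv by blast
    then show ?thesis using supp(3)[of z] that by auto
  qed
  have "{c..d + h} \<subseteq> {a<..<b}" using supp by auto
  note \<phi> = C1cI[OF d\<phi> cD supp\<phi> this]
  have "(LINT x|lborel. g x * deriv \<phi> x) \<le> C"
  proof (rule C[OF \<phi>(1)])
    show "\<bar>\<phi> x\<bar> \<le> 1" for x using mv[of x] \<psi>(2) by auto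
  qed
  moreover have "(LINT x|lborel. g x * deriv \<phi> x) = (LINT x|lborel. (g (x + h) - g x) * \<psi> x) / h"
  proof -
    have [measurable]: "g \<in> borel_measurable borel" "\<psi> \<in> borel_measurable borel"
      using borel_measurable_integrable[OF g] \<psi>(1) by (auto intro: borel_measurable_continuous_onI)
    have i: "integrable lborel (\<lambda>x. u x * v x)"
      if "integrable lborel u" "v \<in> borel_measurable borel" "\<And>x. \<bar>v x\<bar> \<le> 1" for u v :: "real \<Rightarrow> real"
      by (rule Bochner_Integration.integrable_bound[OF that(1)])
         (use that borel_measurable_integrable[OF that(1)] in \<open>auto simp: abs_mult mult_left_le\<close>)
    have gh: "integrable lborel (\<lambda>x. g (x + h))"
      using lborel_integrable_real_affine[OF g, of 1 h] by (simp add: add.commute)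
    have "(LINT x|lborel. g x * \<psi> (x + - h)) = (LINT x|lborel. g (x + h) * \<psi> x)"
      using lborel_integral_real_affine[of 1 "\<lambda>x. g x * \<psi> (x + - h)" h] by (simp add: add.commute)
    moreover have "(LINT x|lborel. g x * deriv \<phi> x) = (LINT x|lborel. g x * \<psi> (x + - h) - g x * \<psi> x) / h"
    proof -
      have "g x * deriv \<phi> x = (g x * \<psi> (x + - h) - g x * \<psi> x) / h" for x
        unfolding DERIV_imp_deriv[OF d\<phi>] D_def by (simp add: right_diff_distrib)
      then show ?thesis by (simp only: Bochner_Integration.integral_divide_zero)
    qed
    moreover have "(LINT x|lborel. g x * \<psi> (x + - h) - g x * \<psi> x) = (LINT x|lborel. g x * \<psi> (x + - h)) - (LINT x|lborel. g x * \<psi> x)"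
      by (rule Bochner_Integration.integral_diff) (intro i g | use \<psi> in simp)+
    moreover have "(LINT x|lborel. (g (x + h) - g x) * \<psi> x) = (LINT x|lborel. g (x + h) * \<psi> x) - (LINT x|lborel. g x * \<psi> x)"
      unfolding left_diff_distrib by (rule Bochner_Integration.integral_diff) (intro i g gh | use \<psi> in simp)+
    ultimately show ?thesis by simp
  qed
  ultimately show ?thesis using h by (simp add: pos_divide_le_eq)
qed

text \<open>The ideal test function is sgn q on the open interval. It is the almost everywhere limit
  of continuous functions, which are clipped to [-1,1] and cut off near the end points before
  passing to the limit.\<close>

lemma L1_norm_le_duality:
  assumes q: "integrable lborel q" and C: "0 \<le> C"
    and test: "\<And>\<psi> c d. continuous_on UNIV \<psi> \<Longrightarrow> (\<And>x. \<bar>\<psi> x\<bar> \<le> 1) \<Longrightarrow> \<alpha> < c \<Longrightarrow> d < \<beta> \<Longrightarrow>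
      (\<And>x. x \<notin> {c..d} \<Longrightarrow> \<psi> x = 0) \<Longrightarrow> (LINT x|lborel. q x * \<psi> x) \<le> C"
  shows "L1_norm {\<alpha>..\<beta>} q \<le> ennreal C"
proof -
  have qm[measurable]: "q \<in> borel_measurable borel" using borel_measurable_integrable[OF q] by simp
  have "(\<lambda>x. sgn (q x)) \<in> borel_measurable lebesgue" by (rule measurable_completion) simp
  \<comment> \<open>\<open>measurable_on\<close> means precisely being the limit of continuous
    functions off a negligible set.\<close>
  then have "(\<lambda>x. sgn (q x)) measurable_on UNIV" by (rule lebesgue_measurable_imp_measurable_on_real) simp
  then obtain N s where N: "negligible N" and s: "\<And>n. continuous_on UNIV (s n)"
    "\<And>x. x \<notin> N \<Longrightarrow> (\<lambda>n. s n x) \<longlonglongrightarrow> sgn (q x)"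
    unfolding measurable_on_def by auto
  \<comment> \<open>Zero within distance 1/(n+1) of the complement of the interval, since n/(n+1) <=
    1, and equal to 1 once n times that distance is at least 2.\<close>
  define cut where "cut n x = max 0 (min 1 (real n * min (x - \<alpha>) (\<beta> - x) - 1))" for n x
  define \<psi> where "\<psi> n x = max (-1) (min 1 (s n x)) * cut n x" for n x
  have \<psi>1: "\<bar>\<psi> n x\<bar> \<le> 1" for n x
    unfolding \<psi>_def abs_mult by (rule mult_le_one) (auto simp: cut_def)
  have c: "continuous_on UNIV (\<psi> n)" for n
    unfolding \<psi>_def cut_def by (intro continuous_intros s)
  have m[measurable]: "\<psi> n \<in> borel_measurable borel" for n using c by (rule borel_measurable_continuous_onI)
  have "(LINT x|lborel. q x * \<psi> n x) \<le> C" for n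
  proof (rule test[OF c \<psi>1])
    show "\<alpha> < \<alpha> + 1 / (real n + 1)" "\<beta> - 1 / (real n + 1) < \<beta>" by auto
    show "\<psi> n x = 0" if "x \<notin> {\<alpha> + 1 / (real n + 1)..\<beta> - 1 / (real n + 1)}" for x
    proof -
      have "min (x - \<alpha>) (\<beta> - x) \<le> 1 / (real n + 1)" using that by auto
      then have "real n * min (x - \<alpha>) (\<beta> - x) \<le> real n * (1 / (real n + 1))" by (intro mult_left_mono) auto
      also have "\<dots> \<le> 1" by (simp add: divide_le_eq)
      finally show ?thesis by (simp add: \<psi>_def cut_def)
    qed
  qed
  moreover have "(\<lambda>n. LINT x|lborel. q x * \<psi> n x) \<longlonglongrightarrow> (LINT x|lborel. indicator {\<alpha><..<\<beta>} x * \<bar>q x\<bar>)"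
  proof (rule integral_dominated_convergence[where w = "\<lambda>x. \<bar>q x\<bar>"])
    obtain N' where "N' \<in> null_sets lborel" "N \<subseteq> N'"
      using N by (auto simp: negligible_iff_null_sets null_sets_completion_iff2)
    then have "AE x in lborel. x \<notin> N" using AE_not_in[of N' lborel] by (auto elim: eventually_mono)
    then show "AE x in lborel. (\<lambda>n. q x * \<psi> n x) \<longlonglongrightarrow> indicator {\<alpha><..<\<beta>} x * \<bar>q x\<bar>"
    proof (rule eventually_mono)
      fix x assume x: "x \<notin> N"
      have 1: "(\<lambda>n. max (-1) (min 1 (s n x))) \<longlonglongrightarrow> max (-1) (min 1 (sgn (q x)))"
        by (intro tendsto_intros s x)
      have 2: "(\<lambda>n. cut n x) \<longlonglongrightarrow> indicator {\<alpha><..<\<beta>} x"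
      proof (cases "x \<in> {\<alpha><..<\<beta>}")
        case True
        then have "0 < min (x - \<alpha>) (\<beta> - x)" by auto
        then have "filterlim (\<lambda>n. real n * min (x - \<alpha>) (\<beta> - x)) at_top sequentially"
          by (intro filterlim_at_top_mult_tendsto_pos[OF tendsto_const] filterlim_real_sequentially)
             (simp add: mult.commute)
        then have "\<forall>\<^sub>F n in sequentially. 2 \<le> real n * min (x - \<alpha>) (\<beta> - x)"
          by (simp add: filterlim_at_top)
        then have "\<forall>\<^sub>F n in sequentially. cut n x = 1" by (rule eventually_mono) (simp add: cut_def)
        then show ?thesis using True by (simp add: tendsto_eventually)
      next
        case False
        then have "min (x - \<alpha>) (\<beta> - x) \<le> 0" by auto
        then have "real n * min (x - \<alpha>) (\<beta> - x) \<le> 0" for n by (simp add: mult_nonneg_nonpos)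
        then have "cut n x = 0" for n using cut_def by (smt (verit))
        then show ?thesis using False by simp
      qed
      have "(\<lambda>n. q x * \<psi> n x) \<longlonglongrightarrow> q x * (max (-1) (min 1 (sgn (q x))) * indicator {\<alpha><..<\<beta>} x)"
        unfolding \<psi>_def by (intro tendsto_intros 1 2)
      also have "q x * (max (-1) (min 1 (sgn (q x))) * indicator {\<alpha><..<\<beta>} x) = indicator {\<alpha><..<\<beta>} x * \<bar>q x\<bar>"
        by (auto simp: sgn_if)
      finally show "(\<lambda>n. q x * \<psi> n x) \<longlonglongrightarrow> indicator {\<alpha><..<\<beta>} x * \<bar>q x\<bar>" .
    qed
    show "AE x in lborel. norm (q x * \<psi> n x) \<le> \<bar>q x\<bar>" for n
      using \<psi>1 by (auto simp: abs_mult intro!: mult_left_le)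
  qed (use q in auto)
  ultimately have le: "(LINT x|lborel. indicator {\<alpha><..<\<beta>} x * \<bar>q x\<bar>) \<le> C"
    by (intro LIMSEQ_le_const2) auto
  have "L1_norm {\<alpha>..\<beta>} q = (\<integral>\<^sup>+x. ennreal (indicator {\<alpha><..<\<beta>} x * \<bar>q x\<bar>) \<partial>lborel)"
    unfolding L1_norm_def using AE_endpoints[of \<alpha> \<beta>]
    by (intro nn_integral_cong_AE, elim eventually_mono) (auto simp: indicator_def)
  also have "\<dots> = ennreal (LINT x|lborel. indicator {\<alpha><..<\<beta>} x * \<bar>q x\<bar>)"
    by (rule nn_integral_eq_integral)
       (use integrable_mult_indicator[of "{\<alpha><..<\<beta>}" lborel "\<lambda>x. \<bar>q x\<bar>"] q in auto)
  finally show ?thesis using le by (simp add: ennreal_leI)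
qed

section \<open>From the translation estimate to approximations\<close>

lemma integral_le_L1_norm:
  assumes "integrable lborel v"
  shows "ennreal \<bar>integral {p..q} v\<bar> \<le> L1_norm {p..q} v"
proof -
  have i: "set_integrable lborel {p..q} v"
    using assms unfolding set_integrable_def by (intro integrable_mult_indicator) auto
  have "ennreal \<bar>LINT x|lborel. indicator {p..q} x *\<^sub>R v x\<bar> \<le> (\<integral>\<^sup>+x. ennreal \<bar>indicator {p..q} x *\<^sub>R v x\<bar> \<partial>lborel)"
    using integral_norm_bound_ennreal[of lborel "\<lambda>x. indicator {p..q} x *\<^sub>R v x"] i by (simp add: set_integrable_def)
  also have "\<dots> = L1_norm {p..q} v"
    unfolding L1_norm_def by (intro nn_integral_cong) (auto simp: indicator_def)
  finally show ?thesis using set_borel_integral_eq_integral(2)[OF i] by (simp add: set_lebesgue_integral_def)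
qed

lemma integrable_lborel_integrable_on:
  fixes v :: "real \<Rightarrow> real"
  assumes "integrable lborel v"
  shows "v integrable_on {p..q}"
  by (rule set_borel_integral_eq_integral(1))
     (use assms in \<open>auto simp: set_integrable_def simp del: real_scaleR_def intro!: integrable_mult_indicator\<close>)

text \<open>On the last window before b the translation estimate says nothing. Since the variation
  bound in \<open>BV_approximation\<close> is uniform in h, h may be shrunk until g has as little
  mass there as desired.\<close>

lemma L1_norm_tail_small:
  assumes g: "integrable lborel g" and "a < b" "0 < \<epsilon>" "0 < \<delta>"
  obtains h where "0 < h" "h < b - a" "h \<le> \<delta>" "L1_norm {b - h..b} g \<le> ennreal \<epsilon>"
proof -
  have gi: "integrable lborel (\<lambda>x. \<bar>g x\<bar>)" using g by simp
  note ii = integrable_lborel_integrable_on[OF gi]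
  have "continuous_on {a..b} (\<lambda>x. integral {x..b} (\<lambda>x. \<bar>g x\<bar>))"
    by (rule indefinite_integral_continuous_1'[OF ii])
  then obtain d where d: "0 < d" "\<And>x. x \<in> {a..b} \<Longrightarrow> dist x b < d \<Longrightarrow>
      dist (integral {x..b} (\<lambda>x. \<bar>g x\<bar>)) (integral {b..b} (\<lambda>x. \<bar>g x\<bar>)) < \<epsilon>"
    unfolding continuous_on_iff using assms by (metis atLeastAtMost_iff less_eq_real_def)
  define h where "h = min \<delta> (min (d / 2) ((b - a) / 2))"
  have h: "0 < h" "h \<le> d / 2" "h \<le> (b - a) / 2" "h \<le> \<delta>"
    unfolding h_def
    by (use assms(2-) d(1) in simp) (rule min.coboundedI2 min.cobounded1 min.cobounded2)+
  have "L1_norm {b - h..b} g = ennreal (integral {b - h..b} (\<lambda>x. \<bar>g x\<bar>))"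
    unfolding L1_norm_def
    by (rule nn_integral_has_integral_lebesgue') (use ii in \<open>auto intro: integrable_integral\<close>)
  also have "\<dots> \<le> ennreal \<epsilon>"
    using d(2)[of "b - h"] h assms d(1) by (intro ennreal_leI) (auto simp: dist_real_def)
  finally show ?thesis using h assms by (intro that[of h]) auto
qed

lemma BV_translation:
  assumes g: "borel_version a b g g'" and C: "0 \<le> C"
    "\<And>\<phi>. \<phi> \<in> C1c a b \<Longrightarrow> (\<And>x. \<bar>\<phi> x\<bar> \<le> 1) \<Longrightarrow> (LINT x:{a<..<b}|lebesgue. g x * deriv \<phi> x) \<le> C"
    and h: "0 \<le> h"
  shows "L1_norm {a..b - h} (\<lambda>x. g' (x + h) - g' x) \<le> ennreal (C * h)"
proof (cases "h = 0")
  case False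
  have gi: "integrable lborel g'" using g by (simp add: borel_version_def)
  have C': "(LINT x|lborel. g' x * deriv \<phi> x) \<le> C" if "\<phi> \<in> C1c a b" "\<And>x. \<bar>\<phi> x\<bar> \<le> 1" for \<phi>
    using C(2)[OF that] LINT_borel_version[OF g borel_measurable_continuous_onI[OF C1cD(2)[OF that(1)]]] by simp
  have gh: "integrable lborel (\<lambda>x. g' (x + h))"
    using lborel_integrable_real_affine[OF gi, of 1 h] by (simp add: add.commute)
  show ?thesis
  proof (rule L1_norm_le_duality)
    show "integrable lborel (\<lambda>x. g' (x + h) - g' x)" using gi gh by simp
    show "0 \<le> C * h" using C h by simp
  qed (rule BV_translation_test[OF gi C'], use False h in auto)
qed (simp add: L1_norm_def)

text \<open>The function \<open>f\<close> is the average of \<open>g\<close> over \<open>{x..x + h}\<close>, frozen where this window would leave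
  \<open>{a..b}\<close>.\<close>

lemma BV_approximation:
  assumes "a < b" and g: "integrable lborel g" and C: "0 \<le> C"
    and trans: "\<And>h. 0 \<le> h \<Longrightarrow> L1_norm {a..b - h} (\<lambda>x. g (x + h) - g x) \<le> ennreal (C * h)"
    and h: "0 < h" "h < b - a"
  obtains f w where "continuous_on UNIV f" "increments_dominated f w" "L1_norm UNIV w \<le> ennreal C"
    "L1_norm {a..b} (\<lambda>x. f x - g x) \<le> ennreal (C * h) + 2 * L1_norm {b - h..b} g"
proof -
  define p where "p = clamp1 a (b - h)"
  define G where "G x = integral {a..x} g" for x
  define f where "f x = (G (p x + h) - G (p x)) / h" for x
  define w where "w x = (1 / h) * (indicator {a..b - h} x * (g (x + h) - g x))" for x
  note gio = integrable_lborel_integrable_on[OF g]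
  have gm[measurable]: "g \<in> borel_measurable borel" using borel_measurable_integrable[OF g] by simp
  have gh: "integrable lborel (\<lambda>x. g (x + s))" for s
    using lborel_integrable_real_affine[OF g, of 1 s] by (simp add: add.commute)
  have p: "p x \<in> {a..b - h}" for x unfolding p_def by (rule clamp1_in) (use h in simp)
  have pc: "continuous_on UNIV p" unfolding p_def by (rule clamp1_cont)
  have Gc: "continuous_on {a..b} G" unfolding G_def[abs_def] by (rule indefinite_integral_continuous_1[OF gio])
  have cf: "continuous_on UNIV f"
    unfolding f_def[abs_def]
  proof (intro continuous_intros continuous_on_compose2[OF Gc] pc)
    show "(\<lambda>x. p x + h) ` UNIV \<subseteq> {a..b}" "p ` UNIV \<subseteq> {a..b}"
    proof safe
      fix x show "p x + h \<in> {a..b}" "p x \<in> {a..b}" using p[of x] h by auto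
    qed
  qed (use h in auto)
  have G: "G y - G x = integral {x..y} g" if "a \<le> x" "x \<le> y" for x y
    using Henstock_Kurzweil_Integration.integral_combine[OF that gio] by (simp add: G_def)
  have shift: "integral {x + s..y + s} g = integral {x..y} (\<lambda>t. g (t + s))" for x y s
  proof -
    show ?thesis using integral_shift_Icc_real[where a = x and b = y and c = s and f = g] by (simp add: add.commute comp_def)
  qed
  have wm: "w \<in> borel_measurable borel" unfolding w_def[abs_def] by measurable
  have fw: "increments_dominated f w"
    unfolding increments_dominated_def
  proof (intro conjI allI impI wm)
    fix x y :: real assume xy: "x \<le> y"
    show "ennreal \<bar>f y - f x\<bar> \<le> (\<integral>\<^sup>+t\<in>{x..y}. ennreal \<bar>w t\<bar> \<partial>lborel)"
    proof (cases "p x = p y")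
      case False
      \<comment> \<open>If the clamped points differ, clamping can only have moved x to the right
        and y to the left, so the interval between them lies inside {x..y}.\<close>
      then have pxy: "p x \<le> p y" "x \<le> p x" "p y \<le> y" using xy h by (auto simp: p_def clamp1_def)
      have "f y - f x = ((G (p y + h) - G (p x + h)) - (G (p y) - G (p x))) / h"
        by (simp add: f_def diff_divide_distrib)
      also have "\<dots> = integral {p x..p y} (\<lambda>t. g (t + h) - g t) / h"
        using G[of "p x + h" "p y + h"] G[of "p x" "p y"] p[of x] pxy h
        by (simp add: shift Henstock_Kurzweil_Integration.integral_diff[OF integrable_lborel_integrable_on[OF gh] gio])
      finally have "ennreal \<bar>f y - f x\<bar> = ennreal (1 / h) * ennreal \<bar>integral {p x..p y} (\<lambda>t. g (t + h) - g t)\<bar>"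
        using h by (simp add: ennreal_mult[symmetric])
      also have "\<dots> \<le> ennreal (1 / h) * L1_norm {p x..p y} (\<lambda>t. g (t + h) - g t)"
        by (intro mult_left_mono integral_le_L1_norm Bochner_Integration.integrable_diff gh g) auto
      also have "\<dots> = L1_norm {p x..p y} (\<lambda>t. (1 / h) * (g (t + h) - g t))"
        using h by (subst L1_norm_cmult) auto
      also have "\<dots> \<le> L1_norm {x..y} w"
        unfolding L1_norm_def using pxy p[of x] p[of y]
        by (intro nn_integral_mono) (auto simp: indicator_def w_def)
      finally show ?thesis by (simp add: L1_norm_def)
    qed (simp add: f_def)
  qed
  have "L1_norm UNIV w = ennreal (1 / h) * L1_norm UNIV (\<lambda>x. indicator {a..b - h} x * (g (x + h) - g x))"
    unfolding w_def by (subst L1_norm_cmult) (use h in auto)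
  also have "\<dots> \<le> ennreal (1 / h) * ennreal (C * h)"
    unfolding L1_norm_UNIV_indicator by (intro mult_left_mono trans) (use h in auto)
  also have "\<dots> = ennreal C" using h C by (simp add: ennreal_mult[symmetric])
  finally have wC: "L1_norm UNIV w \<le> ennreal C" .
  have 1: "L1_norm {a..b - h} (\<lambda>x. f x - g x) \<le> ennreal (C * h)"
  proof -
    \<comment> \<open>The error is the mean over s in {0..h} of g(x + s) - g(x), which reduces the
      norm to translations by s <= h.\<close>
    have pt: "ennreal \<bar>f x - g x\<bar> \<le> ennreal (1 / h) * (\<integral>\<^sup>+s\<in>{0..h}. ennreal \<bar>g (x + s) - g x\<bar> \<partial>lborel)"
      if x: "x \<in> {a..b - h}" for x
    proof -
      have "p x = x" unfolding p_def using x by (rule clamp1_id)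
      then have "f x = integral {x..x + h} g / h" using G[of x "x + h"] x h by (simp add: f_def)
      also have "integral {x..x + h} g = integral {0..h} (\<lambda>s. g (s + x))" using shift[of 0 x h] by (simp add: add.commute)
      also have "\<dots> / h = (integral {0..h} (\<lambda>s. g (s + x) - g x) + h * g x) / h"
        using h by (subst Henstock_Kurzweil_Integration.integral_diff) (auto intro: integrable_lborel_integrable_on[OF gh])
      finally have fx: "f x - g x = integral {0..h} (\<lambda>s. g (s + x) - g x) / h" using h by (simp add: field_simps)
      \<comment> \<open>The constant g(x) is truncated to {0..h} to make the integrand integrable on
        the whole line.\<close>
      have cut: "integral {0..h} (\<lambda>s. g (s + x) - g x) = integral {0..h} (\<lambda>s. g (s + x) - indicator {0..h} s * g x)"
        by (intro integral_cong) auto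
      have "ennreal \<bar>f x - g x\<bar> = ennreal (1 / h) * ennreal \<bar>integral {0..h} (\<lambda>s. g (s + x) - g x)\<bar>"
        unfolding fx using h by (simp add: ennreal_mult[symmetric])
      also have "\<dots> \<le> ennreal (1 / h) * L1_norm {0..h} (\<lambda>s. g (s + x) - indicator {0..h} s * g x)"
        unfolding cut
        by (intro mult_left_mono integral_le_L1_norm Bochner_Integration.integrable_diff gh
            integrable_mult_left integrable_real_indicator) (use h in auto)
      also have "L1_norm {0..h} (\<lambda>s. g (s + x) - indicator {0..h} s * g x) = L1_norm {0..h} (\<lambda>s. g (x + s) - g x)"
        by (intro L1_norm_cong) (auto simp: add.commute)
      finally show ?thesis by (simp add: L1_norm_def)
    qed
    have "L1_norm {a..b - h} (\<lambda>x. f x - g x) \<le>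
        (\<integral>\<^sup>+x. ennreal (1 / h) * (\<integral>\<^sup>+s. ennreal \<bar>g (x + s) - g x\<bar> * indicator {0..h} s * indicator {a..b - h} x \<partial>lborel) \<partial>lborel)"
      unfolding L1_norm_def by (intro nn_integral_mono) (use pt in \<open>auto simp: indicator_def\<close>)
    also have "\<dots> = ennreal (1 / h) * (\<integral>\<^sup>+x. (\<integral>\<^sup>+s. ennreal \<bar>g (x + s) - g x\<bar> * indicator {0..h} s * indicator {a..b - h} x \<partial>lborel) \<partial>lborel)"
      by (rule nn_integral_cmult) measurable
    also have "(\<integral>\<^sup>+x. (\<integral>\<^sup>+s. ennreal \<bar>g (x + s) - g x\<bar> * indicator {0..h} s * indicator {a..b - h} x \<partial>lborel) \<partial>lborel) =
        (\<integral>\<^sup>+s. (\<integral>\<^sup>+x. ennreal \<bar>g (x + s) - g x\<bar> * indicator {0..h} s * indicator {a..b - h} x \<partial>lborel) \<partial>lborel)"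
      by (rule lborel_pair.Fubini') measurable
    also have "\<dots> \<le> (\<integral>\<^sup>+s. ennreal (C * h) * indicator {0..h} s \<partial>lborel)"
    proof (rule nn_integral_mono)
      fix s
      show "(\<integral>\<^sup>+x. ennreal \<bar>g (x + s) - g x\<bar> * indicator {0..h} s * indicator {a..b - h} x \<partial>lborel) \<le> ennreal (C * h) * indicator {0..h} s"
      proof (cases "s \<in> {0..h}")
        case True
        have "L1_norm {a..b - h} (\<lambda>x. g (x + s) - g x) \<le> L1_norm {a..b - s} (\<lambda>x. g (x + s) - g x)"
          using True by (intro L1_norm_subset) auto
        also have "\<dots> \<le> ennreal (C * s)" using True by (intro trans) auto
        also have "\<dots> \<le> ennreal (C * h)" using True C by (intro ennreal_leI mult_left_mono) auto
        finally show ?thesis using True by (simp add: L1_norm_def)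
      qed simp
    qed
    also have "\<dots> = ennreal (C * h) * ennreal h" using h by (simp add: nn_integral_cmult_indicator)
    finally have "L1_norm {a..b - h} (\<lambda>x. f x - g x) \<le> ennreal (1 / h) * (ennreal (C * h) * ennreal h)"
      by (simp add: mult_left_mono)
    also have "\<dots> = ennreal (C * h)" using h C by (simp add: ennreal_mult[symmetric])
    finally show ?thesis .
  qed
  \<comment> \<open>Here \<open>f\<close> is frozen at the mean of g over this last window, whose
    norm is at most that of g.\<close>
  have 2: "L1_norm {b - h..b} (\<lambda>x. f x - g x) \<le> 2 * L1_norm {b - h..b} g"
  proof -
    define c where "c = integral {b - h..b} g / h"
    have fc: "f x = c" if "x \<in> {b - h..b}" for x
    proof -
      have "p x = b - h" using that h by (auto simp: p_def clamp1_def)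
      then show ?thesis using G[of "b - h" b] h by (simp add: f_def c_def)
    qed
    have "L1_norm {b - h..b} (\<lambda>x. c) = ennreal \<bar>c\<bar> * ennreal h"
      unfolding L1_norm_def using h by (simp add: nn_integral_cmult_indicator)
    also have "\<dots> = ennreal \<bar>integral {b - h..b} g\<bar>" using h by (simp add: c_def ennreal_mult[symmetric])
    also have "\<dots> \<le> L1_norm {b - h..b} g" by (rule integral_le_L1_norm[OF g])
    finally have cg: "L1_norm {b - h..b} (\<lambda>x. c) \<le> L1_norm {b - h..b} g" .
    have "L1_norm {b - h..b} (\<lambda>x. f x - g x) \<le> L1_norm {b - h..b} (\<lambda>x. c) + L1_norm {b - h..b} g"
      by (rule L1_norm_triangle) (use fc in auto)
    also have "\<dots> \<le> L1_norm {b - h..b} g + L1_norm {b - h..b} g" by (intro add_mono cg order_refl)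
    finally show ?thesis by (simp add: mult_2)
  qed
  have "L1_norm {a..b} (\<lambda>x. f x - g x) \<le> (\<integral>\<^sup>+x. ennreal \<bar>f x - g x\<bar> * indicator {a..b - h} x + ennreal \<bar>f x - g x\<bar> * indicator {b - h..b} x \<partial>lborel)"
    unfolding L1_norm_def by (intro nn_integral_mono) (auto simp: indicator_def)
  also have "\<dots> = L1_norm {a..b - h} (\<lambda>x. f x - g x) + L1_norm {b - h..b} (\<lambda>x. f x - g x)"
    unfolding L1_norm_def by (rule nn_integral_add) (use borel_measurable_continuous_onI[OF cf] in auto)
  also have "\<dots> \<le> ennreal (C * h) + 2 * L1_norm {b - h..b} g" by (intro add_mono 1 2)
  finally show ?thesis using that[OF cf fw wC] by blast
qed

text \<open>The window averages are only dominated in their increments, not continuously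
  differentiable; one symmetric average makes them so at a cost of order 2^(-n).\<close>

lemma BV_subset_S1:
  assumes "a < b"
  shows "BV a b \<subseteq> S_space 1 a b"
proof
  fix g assume g: "g \<in> BV a b"
  then have L1: "g \<in> L1 a b" by (simp add: BV_def)
  obtain g' where g': "borel_version a b g g'" using borel_version_exists[OF L1] .
  have gi: "integrable lborel g'" using g' by (simp add: borel_version_def)
  note gm[measurable] = borel_version_measurable[OF g']
  obtain B where B: "\<And>\<phi>. \<phi> \<in> C1c a b \<Longrightarrow> (\<And>x. \<bar>\<phi> x\<bar> \<le> 1) \<Longrightarrow> (LINT x:{a<..<b}|lebesgue. g x * deriv \<phi> x) \<le> B"
    using g by (auto simp: BV_def bdd_above_def)
  define C where "C = \<bar>B\<bar>"
  have C: "0 \<le> C" by (simp add: C_def)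
  have trans: "L1_norm {a..b - h} (\<lambda>x. g' (x + h) - g' x) \<le> ennreal (C * h)" if "0 \<le> h" for h
    by (rule BV_translation[OF g' C _ that]) (use B in \<open>force simp: C_def\<close>)
  show "g \<in> S_space 1 a b"
  \<comment> \<open>C from the window average, 2 from the tail of g' near b, and 2C from the final
    smoothing.\<close>
  proof (rule S_spaceI[OF assms(1) L1 g', of "3 * C + 2"])
    fix n
    obtain h where h: "0 < h" "h < b - a" "h \<le> 1 / 2 ^ n" "L1_norm {b - h..b} g' \<le> ennreal (1 / 2 ^ n)"
      using L1_norm_tail_small[OF gi assms(1), of "1 / 2 ^ n" "1 / 2 ^ n"] by auto
    obtain f w where f: "continuous_on UNIV f" "increments_dominated f w" and w: "L1_norm UNIV w \<le> ennreal C"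
      and fg: "L1_norm {a..b} (\<lambda>x. f x - g' x) \<le> ennreal (C * h) + 2 * L1_norm {b - h..b} g'"
      using BV_approximation[OF assms gi C trans h(1,2)] by blast
    have "L1_norm {a..b} (\<lambda>x. f x - g' x) \<le> ennreal (C / 2 ^ n) + 2 * ennreal (1 / 2 ^ n)"
      using h C mult_left_mono[OF h(3) C] by (intro order_trans[OF fg] add_mono mult_left_mono ennreal_leI h(4)) auto
    also have "\<dots> = ennreal ((C + 2) / 2 ^ n)"
      using C by (simp add: add_divide_distrib ennreal_mult[of 2 "1 / 2 ^ n", simplified, symmetric])
    finally have fg': "L1_norm {a..b} (\<lambda>x. f x - g' x) \<le> ennreal ((C + 2) / 2 ^ n)" .
    obtain E where E: "derivs 1 E" "L1_norm UNIV (E 1) \<le> L1_norm UNIV w"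
      "L1_norm UNIV (\<lambda>x. E 0 x - f x) \<le> ennreal (2 * (1 / 2 ^ n)) * L1_norm UNIV w"
      using smoothing1[OF f, of "1 / 2 ^ n" 0] by auto
    have "L1_norm {a..b} (E 1) \<le> L1_norm UNIV (E 1)" by (rule L1_norm_subset) simp
    also have "\<dots> \<le> ennreal (3 * C + 2)" using C by (intro order_trans[OF E(2)] order_trans[OF w] ennreal_leI) simp
    finally have 1: "L1_norm {a..b} (E 1) \<le> ennreal (3 * C + 2)" .
    have "L1_norm UNIV (\<lambda>x. E 0 x - f x) \<le> ennreal (2 * (1 / 2 ^ n)) * ennreal C"
      using E(3) by (elim order_trans) (intro mult_left_mono w, simp)
    also have "\<dots> = ennreal (2 * (1 / 2 ^ n) * C)" by (rule ennreal_mult[symmetric]) (use C in auto)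
    finally have e: "L1_norm UNIV (\<lambda>x. E 0 x - f x) \<le> ennreal (2 * (1 / 2 ^ n) * C)" .
    have "L1_norm {a..b} (\<lambda>x. E 0 x - g' x) \<le> ennreal ((3 * C + 2) / 2 ^ n)"
      by (rule L1_norm_approx_triangle[OF gm _ _ _ refl e fg'])
         (use C derivs_measurable[OF E(1)] borel_measurable_continuous_onI[OF f(1)] in \<open>auto simp: field_simps\<close>)
    with 1 E(1) show "\<exists>U. derivs 1 U \<and> L1_norm {a..b} (U 1) \<le> ennreal ((3 * C + 2) * (2 ^ (1 - 1)) ^ n) \<and>
       L1_norm {a..b} (\<lambda>x. U 0 x - g' x) \<le> ennreal ((3 * C + 2) / 2 ^ n)" by (intro exI[of _ E]) simp
  qed (use C in simp)
qed

section \<open>Fractional Sobolev spaces\<close>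

lemma W_s1_borel_version:
  assumes "g \<in> L1 a b" and g': "borel_version a b g g'"
    and fin: "(\<integral>\<^sup>+y. (\<integral>\<^sup>+x. ennreal (\<bar>g' y - g' x\<bar> / \<bar>y - x\<bar> powr (1 + s)) * indicator {a<..<b} x \<partial>lborel) *
      indicator {a<..<b} y \<partial>lborel) < \<infinity>"
  shows "g \<in> W_s1 s a b"
proof -
  have ae: "AE x in lborel. x \<in> {a<..<b} \<longrightarrow> g x = g' x" using g' by (simp add: borel_version_def)
  have inner: "(\<integral>\<^sup>+x. ennreal (\<bar>g' y - g x\<bar> / \<bar>y - x\<bar> powr (1 + s)) * indicator {a<..<b} x \<partial>lborel) =
      (\<integral>\<^sup>+x. ennreal (\<bar>g' y - g' x\<bar> / \<bar>y - x\<bar> powr (1 + s)) * indicator {a<..<b} x \<partial>lborel)" for y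
    by (rule nn_integral_cong_AE) (use ae in \<open>auto elim!: eventually_mono simp: indicator_def\<close>)
  have "(\<integral>\<^sup>+y. (\<integral>\<^sup>+x. ennreal (\<bar>g y - g x\<bar> / \<bar>y - x\<bar> powr (1 + s)) * indicator {a<..<b} x \<partial>lborel) * indicator {a<..<b} y \<partial>lborel) =
      (\<integral>\<^sup>+y. (\<integral>\<^sup>+x. ennreal (\<bar>g' y - g' x\<bar> / \<bar>y - x\<bar> powr (1 + s)) * indicator {a<..<b} x \<partial>lborel) * indicator {a<..<b} y \<partial>lborel)"
    unfolding inner[symmetric]
    by (rule nn_integral_cong_AE, rule eventually_mono[OF ae]) (auto split: split_indicator)
  then show ?thesis using fin assms(1) by (simp add: W_s1_def nn_integral_completion)
qed

lemma dyadic_scale: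
  fixes d L :: real
  assumes "0 < d" "d \<le> L"
  obtains n where "d \<le> L / 2 ^ n" "L / 2 ^ Suc n < d"
proof -
  obtain n where "2 ^ n \<le> L / d" "L / d < 2 ^ Suc n" using dyadic_floor[of "L / d"] assms by auto
  then show ?thesis using assms by (intro that[of n]) (simp_all add: field_simps)
qed

lemma summable_square_geometric:
  fixes q :: real assumes "0 < q" "q < 1"
  shows "summable (\<lambda>n. (real n + 1)\<^sup>2 * q ^ n)"
proof -
  define c where "c = (1 + q) / 2"
  have c: "q < c" "c < 1" using assms by (auto simp: c_def)
  have "(\<lambda>n. ((real n + 2) / (real n + 1))\<^sup>2 * q) \<longlonglongrightarrow> 1\<^sup>2 * q"
  proof (intro tendsto_intros)
    have "(\<lambda>n. 1 + 1 / (real n + 1)) \<longlonglongrightarrow> 1 + 0"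
      using LIMSEQ_inverse_real_of_nat by (intro tendsto_intros) (simp add: inverse_eq_divide add.commute)
    moreover have "(real n + 2) / (real n + 1) = 1 + 1 / (real n + 1)" for n by (simp add: field_simps)
    ultimately show "(\<lambda>n. (real n + 2) / (real n + 1)) \<longlonglongrightarrow> 1" by simp
  qed
  then have "\<forall>\<^sub>F n in sequentially. ((real n + 2) / (real n + 1))\<^sup>2 * q < c"
    using c(1) by (intro order_tendstoD(2)[of _ "1\<^sup>2 * q"]) auto
  then obtain N where N: "\<And>n. n \<ge> N \<Longrightarrow> ((real n + 2) / (real n + 1))\<^sup>2 * q < c"
    by (auto simp: eventually_sequentially)
  show ?thesis
  proof (rule summable_ratio_test[OF c(2), of N])
    fix n assume n: "N \<le> n"
    have "norm ((real (Suc n) + 1)\<^sup>2 * q ^ Suc n) = (((real n + 2) / (real n + 1))\<^sup>2 * q) * ((real n + 1)\<^sup>2 * q ^ n)"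
      using assms by (simp add: power_divide add_ac)
    also have "\<dots> \<le> c * ((real n + 1)\<^sup>2 * q ^ n)"
      using N[OF n] assms by (intro mult_right_mono) auto
    finally show "norm ((real (Suc n) + 1)\<^sup>2 * q ^ Suc n) \<le> c * norm ((real n + 1)\<^sup>2 * q ^ n)"
      using assms by simp
  qed
qed

text \<open>Pairs at distance about L / 2^n are compared through \<open>u n\<close>, and that scale
  contributes (n+1)^2 2^((s-1)n), which is summable for s < 1. The weight (n+1)^2 covers both S_2,
  where a linear factor occurs, and the squared logarithm. The domination is required only inside
  {a..b}, as the latter example is singular to the left of a.\<close>

lemma W_s1_criterion:
  assumes ab: "a < b" and gL1: "g \<in> L1 a b" and g': "borel_version a b g g'"
    and s: "0 < s" "s < 1" and K: "0 \<le> K"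
    and um: "\<And>n. u n \<in> borel_measurable borel" and wm: "\<And>n. w n \<in> borel_measurable borel"
    and uw: "\<And>n x y. a \<le> x \<Longrightarrow> x \<le> y \<Longrightarrow> y \<le> b \<Longrightarrow>
      ennreal \<bar>u n y - u n x\<bar> \<le> (\<integral>\<^sup>+t\<in>{x..y}. ennreal \<bar>w n t\<bar> \<partial>lborel)"
    and ug: "\<And>n. L1_norm {a..b} (\<lambda>x. u n x - g' x) \<le> ennreal (K * (real n + 1)\<^sup>2 / 2 ^ n)"
    and wK: "\<And>n. L1_norm {a..b} (w n) \<le> ennreal (K * (real n + 1)\<^sup>2)"
  shows "g \<in> W_s1 s a b"
proof (rule W_s1_borel_version[OF gL1 g'])
  note [measurable] = um wm borel_version_measurable[OF g']
  define L where "L = b - a"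
  have L: "0 < L" using ab by (simp add: L_def)
  define r where "r n = L / 2 ^ n" for n :: nat
  have r: "0 < r n" for n using L by (simp add: r_def)
  \<comment> \<open>Bounds the kernel on the shell L / 2^(n+1) < |y - x| <= L / 2^n.\<close>
  define \<kappa> where "\<kappa> n = (2 ^ Suc n / L) powr (1 + s)" for n
  define A where "A n x = ennreal \<bar>u n x - g' x\<bar> * indicator {a..b} x" for n x
  define B where "B n x = ennreal \<bar>w n x\<bar> * indicator {a..b} x" for n x
  have Am[measurable]: "A n \<in> borel_measurable borel" and Bm[measurable]: "B n \<in> borel_measurable borel" for n
    unfolding A_def[abs_def] B_def[abs_def] by measurable
  define win where "win f n y = (\<integral>\<^sup>+t\<in>{y - r n..y + r n}. f t \<partial>lborel)" for f :: "real \<Rightarrow> ennreal" and n y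
  have winm[measurable]: "win f n \<in> borel_measurable borel" if "f \<in> borel_measurable borel" for f n
    unfolding win_def[abs_def] by (rule window_measurable[OF that])
  \<comment> \<open>Bound for the integrand on the n-th shell: approximation errors at both points
    and the increment of \<open>u n\<close>, enlarged to the whole window around y so that it
    integrates explicitly.\<close>
  define H where "H n y x = ennreal (\<kappa> n) * ((A n y + A n x + win (B n) n y) * indicator {y - r n..y + r n} x)" for n y x
  have pt: "ennreal (\<bar>g' y - g' x\<bar> / \<bar>y - x\<bar> powr (1 + s)) \<le> (\<Sum>n. H n y x)"
    if x: "x \<in> {a<..<b}" and y: "y \<in> {a<..<b}" for x y
  proof (cases "x = y")
    case False
    then obtain n where n: "\<bar>y - x\<bar> \<le> r n" "L / 2 ^ Suc n < \<bar>y - x\<bar>"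
      using dyadic_scale[of "\<bar>y - x\<bar>" L] x y unfolding r_def L_def by (auto simp: abs_le_iff)
    have \<kappa>: "1 / \<bar>y - x\<bar> powr (1 + s) \<le> \<kappa> n"
    proof -
      have "1 / \<bar>y - x\<bar> \<le> 2 ^ Suc n / L" using n(2) L False by (simp add: field_simps)
      then have "(1 / \<bar>y - x\<bar>) powr (1 + s) \<le> \<kappa> n" unfolding \<kappa>_def using s by (intro powr_mono2) auto
      then show ?thesis by (simp add: powr_divide)
    qed
    have uu: "ennreal \<bar>u n y - u n x\<bar> \<le> win (B n) n y"
    proof -
      have "ennreal \<bar>u n q - u n p\<bar> \<le> win (B n) n y" if "p \<le> q" "p \<in> {x, y}" "q \<in> {x, y}" for p q
      proof -
        have "ennreal \<bar>u n q - u n p\<bar> \<le> (\<integral>\<^sup>+t\<in>{p..q}. ennreal \<bar>w n t\<bar> \<partial>lborel)"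
          by (rule uw) (use that x y in auto)
        also have "\<dots> \<le> win (B n) n y" unfolding win_def B_def
          by (intro nn_integral_mono) (use that x y n(1) in \<open>auto simp: indicator_def abs_le_iff\<close>)
        finally show ?thesis .
      qed
      from this[of x y] this[of y x] show ?thesis by (cases "x \<le> y") (auto simp: abs_minus_commute)
    qed
    have "ennreal (\<bar>g' y - g' x\<bar>) \<le> ennreal (\<bar>u n y - g' y\<bar> + \<bar>u n x - g' x\<bar> + \<bar>u n y - u n x\<bar>)"
      by (intro ennreal_leI) linarith
    also have "\<dots> \<le> A n y + A n x + win (B n) n y"
      using x y uu by (simp add: A_def add_left_mono)
    finally have g: "ennreal \<bar>g' y - g' x\<bar> \<le> A n y + A n x + win (B n) n y" .
    have "ennreal (\<bar>g' y - g' x\<bar> / \<bar>y - x\<bar> powr (1 + s)) \<le> ennreal (\<kappa> n * \<bar>g' y - g' x\<bar>)"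
      using mult_right_mono[OF \<kappa>, of "\<bar>g' y - g' x\<bar>"] by (intro ennreal_leI) simp
    also have "\<dots> = ennreal (\<kappa> n) * ennreal \<bar>g' y - g' x\<bar>" by (rule ennreal_mult) (auto simp: \<kappa>_def)
    also have "\<dots> \<le> H n y x"
      unfolding H_def using n(1) g by (auto simp: abs_le_iff intro!: mult_left_mono)
    also have "\<dots> \<le> (\<Sum>n. H n y x)"
      using sum_le_suminf[of "\<lambda>n. H n y x" "{n}"] by simp
    finally show ?thesis .
  qed simp
  \<comment> \<open>The integral of \<open>H n y x\<close> over x: terms independent of x pick up
    the window length 2 \<open>r n\<close>.\<close>
  define J where "J n y = ennreal (\<kappa> n) * (ennreal (2 * r n) * A n y + win (A n) n y + ennreal (2 * r n) * win (B n) n y)" for n y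
  have inner: "(\<integral>\<^sup>+x. (\<Sum>n. H n y x) \<partial>lborel) = (\<Sum>n. J n y)" for y
  proof -
    have "(\<integral>\<^sup>+x. H n y x \<partial>lborel) = J n y" for n
    proof -
      have e: "emeasure lborel {y - r n..y + r n} = ennreal (2 * r n)" using r[of n] by simp
      have "(\<integral>\<^sup>+x. H n y x \<partial>lborel) = ennreal (\<kappa> n) * (\<integral>\<^sup>+x. (A n y + win (B n) n y) * indicator {y - r n..y + r n} x + A n x * indicator {y - r n..y + r n} x \<partial>lborel)"
        unfolding H_def by (subst nn_integral_cmult[symmetric]) (auto simp: algebra_simps intro!: nn_integral_cong)
      also have "(\<integral>\<^sup>+x. (A n y + win (B n) n y) * indicator {y - r n..y + r n} x + A n x * indicator {y - r n..y + r n} x \<partial>lborel) =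
          (A n y + win (B n) n y) * ennreal (2 * r n) + win (A n) n y"
        by (subst nn_integral_add) (auto simp: nn_integral_cmult_indicator e win_def simp del: emeasure_lborel_Icc_eq emeasure_lborel_Icc)
      finally show ?thesis by (simp add: J_def algebra_simps)
    qed
    moreover have "H n y \<in> borel_measurable lborel" for n unfolding H_def[abs_def] by measurable
    ultimately show ?thesis by (subst nn_integral_suminf) auto
  qed
  \<comment> \<open>\<open>\<kappa> n\<close> is of order 2^(n(1+s)), and both r times the error and
    r^2 times the variation are of order 4^(-n), up to (n+1)^2. The two error terms give 4L, the
    variation term 4L^2.\<close>
  have outer: "(\<integral>\<^sup>+y. J n y \<partial>lborel) \<le> ennreal ((2 / L) powr (1 + s) * (4 * L + 4 * L\<^sup>2) * K * ((real n + 1)\<^sup>2 * (2 powr (s - 1)) ^ n))" for n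
  proof -
    have A: "(\<integral>\<^sup>+x. A n x \<partial>lborel) \<le> ennreal (K * (real n + 1)\<^sup>2 / 2 ^ n)"
      using ug[of n] by (simp add: A_def L1_norm_def)
    have B: "(\<integral>\<^sup>+x. B n x \<partial>lborel) \<le> ennreal (K * (real n + 1)\<^sup>2)"
      using wK[of n] by (simp add: B_def L1_norm_def)
    have W: "(\<integral>\<^sup>+y. win f n y \<partial>lborel) = ennreal (2 * r n) * (\<integral>\<^sup>+x. f x \<partial>lborel)" if "f \<in> borel_measurable borel" for f
      unfolding win_def using r[of n] by (intro nn_integral_window that) auto
    have "(\<integral>\<^sup>+y. J n y \<partial>lborel) = ennreal (\<kappa> n) * (ennreal (2 * r n) * (\<integral>\<^sup>+x. A n x \<partial>lborel) +
        ennreal (2 * r n) * (\<integral>\<^sup>+x. A n x \<partial>lborel) + ennreal (2 * r n) * (ennreal (2 * r n) * (\<integral>\<^sup>+x. B n x \<partial>lborel)))"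
      unfolding J_def by (simp add: nn_integral_cmult nn_integral_add W)
    also have "\<dots> \<le> ennreal (\<kappa> n) * (ennreal (2 * r n) * ennreal (K * (real n + 1)\<^sup>2 / 2 ^ n) +
        ennreal (2 * r n) * ennreal (K * (real n + 1)\<^sup>2 / 2 ^ n) + ennreal (2 * r n) * (ennreal (2 * r n) * ennreal (K * (real n + 1)\<^sup>2)))"
      by (intro mult_left_mono add_mono A B) auto
    also have "\<dots> = ennreal (\<kappa> n * (2 * r n * (K * (real n + 1)\<^sup>2 / 2 ^ n) + 2 * r n * (K * (real n + 1)\<^sup>2 / 2 ^ n) +
        2 * r n * (2 * r n * (K * (real n + 1)\<^sup>2))))"
    proof -
      have nn: "0 \<le> K * (real n + 1)\<^sup>2 / 2 ^ n" "0 \<le> K * (real n + 1)\<^sup>2" "0 \<le> 2 * r n" "0 \<le> \<kappa> n"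
        using K r[of n] by (auto simp: \<kappa>_def)
      show ?thesis using nn by (simp only: ennreal_mult[symmetric] ennreal_plus[symmetric] mult_nonneg_nonneg add_nonneg_nonneg)
    qed
    also have "\<kappa> n * (2 * r n * (K * (real n + 1)\<^sup>2 / 2 ^ n) + 2 * r n * (K * (real n + 1)\<^sup>2 / 2 ^ n) +
        2 * r n * (2 * r n * (K * (real n + 1)\<^sup>2))) = (2 / L) powr (1 + s) * (4 * L + 4 * L\<^sup>2) * K * ((real n + 1)\<^sup>2 * (2 powr (s - 1)) ^ n)"
    proof -
      have "\<kappa> n = (2 / L) powr (1 + s) * (2 ^ n) powr (1 + s)"
        unfolding \<kappa>_def using L by (subst powr_mult[symmetric]) auto
      also have "(2 ^ n) powr (1 + s) = (2 powr (s - 1)) ^ n * (2 ^ n * 2 ^ n)"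
      proof -
        have "(2 ^ n) powr (1 + s) = (2::real) powr (real n * (1 + s))" by (simp add: powr_powr flip: powr_realpow)
        also have "\<dots> = 2 powr (real n * (s - 1)) * (2 powr real n * 2 powr real n)"
          by (simp add: algebra_simps flip: powr_add)
        also have "\<dots> = (2 powr (s - 1)) ^ n * (2 ^ n * 2 ^ n)"
          by (simp add: powr_realpow powr_powr mult.commute flip: powr_realpow[of "2 powr (s - 1)"])
        finally show ?thesis .
      qed
      finally show ?thesis by (simp add: r_def field_simps power2_eq_square)
    qed
    finally show ?thesis .
  qed
  have "(\<integral>\<^sup>+y. (\<integral>\<^sup>+x. ennreal (\<bar>g' y - g' x\<bar> / \<bar>y - x\<bar> powr (1 + s)) * indicator {a<..<b} x \<partial>lborel) *
      indicator {a<..<b} y \<partial>lborel) \<le> (\<integral>\<^sup>+y. (\<integral>\<^sup>+x. (\<Sum>n. H n y x) \<partial>lborel) \<partial>lborel)"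
  proof (rule nn_integral_mono)
    fix y
    show "(\<integral>\<^sup>+x. ennreal (\<bar>g' y - g' x\<bar> / \<bar>y - x\<bar> powr (1 + s)) * indicator {a<..<b} x \<partial>lborel) *
      indicator {a<..<b} y \<le> (\<integral>\<^sup>+x. (\<Sum>n. H n y x) \<partial>lborel)"
    proof (cases "y \<in> {a<..<b}")
      case True
      have "(\<integral>\<^sup>+x. ennreal (\<bar>g' y - g' x\<bar> / \<bar>y - x\<bar> powr (1 + s)) * indicator {a<..<b} x \<partial>lborel) \<le> (\<integral>\<^sup>+x. (\<Sum>n. H n y x) \<partial>lborel)"
        by (rule nn_integral_mono) (use pt[OF _ True] in \<open>auto simp: indicator_def\<close>)
      then show ?thesis using True by simp
    qed simp
  qed
  also have "\<dots> = (\<Sum>n. \<integral>\<^sup>+y. J n y \<partial>lborel)"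
    unfolding inner by (rule nn_integral_suminf) (simp add: J_def[abs_def])
  also have "\<dots> \<le> (\<Sum>n. ennreal ((2 / L) powr (1 + s) * (4 * L + 4 * L\<^sup>2) * K * ((real n + 1)\<^sup>2 * (2 powr (s - 1)) ^ n)))"
    by (intro suminf_le outer) auto
  also have "\<dots> < \<infinity>"
  proof -
    have q: "0 < 2 powr (s - 1)" "2 powr (s - 1) < (1::real)"
      using s powr_less_mono[of "s - 1" 0 2] by auto
    have "summable (\<lambda>n. (2 / L) powr (1 + s) * (4 * L + 4 * L\<^sup>2) * K * ((real n + 1)\<^sup>2 * (2 powr (s - 1)) ^ n))"
      by (intro summable_mult summable_square_geometric q)
    then have "(\<Sum>n. ennreal ((2 / L) powr (1 + s) * (4 * L + 4 * L\<^sup>2) * K * ((real n + 1)\<^sup>2 * (2 powr (s - 1)) ^ n))) \<noteq> top"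
      by (rule ennreal_suminf_neq_top) (use L K in auto)
    then show ?thesis by (simp add: less_top)
  qed
  finally show "(\<integral>\<^sup>+y. (\<integral>\<^sup>+x. ennreal (\<bar>g' y - g' x\<bar> / \<bar>y - x\<bar> powr (1 + s)) * indicator {a<..<b} x \<partial>lborel) *
      indicator {a<..<b} y \<partial>lborel) < \<infinity>" .
qed

lemma S2_subset_W_s1:
  assumes "a < b" "0 < s" "s < 1"
  shows "S_space 2 a b \<subseteq> W_s1 s a b"
proof
  fix g assume g: "g \<in> S_space 2 a b"
  then have L1: "g \<in> L1 a b" by (simp add: S_space_def)
  obtain g' where g': "borel_version a b g g'" using borel_version_exists[OF L1] .
  obtain C U where CU: "dyadic_approx a b 2 g' C U" using S_space_imp_dyadic_approx[OF assms(1) g g'] .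
  then have C: "0 \<le> C" and U: "derivs 2 (U n)"
      "L1_norm {a..b} (\<lambda>x. U n 0 x - g' x) \<le> ennreal (C / 2 ^ n)" for n
    by (auto simp: dyadic_approx_def)
  obtain C' where C': "0 \<le> C'" "\<And>n. L1_norm {a..b} (U n 1) \<le> ennreal (C' * (real n + 1))"
    using dyadic_approx_deriv1[OF assms(1) borel_version_measurable[OF g'] CU] by blast
  have sq: "real n + 1 \<le> (real n + 1)\<^sup>2" "1 \<le> (real n + 1)\<^sup>2" for n
    by (simp_all add: power2_eq_square algebra_simps)
  show "g \<in> W_s1 s a b"
  proof (rule W_s1_criterion[OF assms(1) L1 g' assms(2,3), where u = "\<lambda>n. U n 0" and w = "\<lambda>n. U n 1" and K = "C + C'"])
    fix n
    show "L1_norm {a..b} (\<lambda>x. U n 0 x - g' x) \<le> ennreal ((C + C') * (real n + 1)\<^sup>2 / 2 ^ n)"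
    proof (rule order_trans[OF U(2)], rule ennreal_leI, rule divide_right_mono)
      have "C * 1 \<le> (C + C') * (real n + 1)\<^sup>2" using C C' sq(2) by (intro mult_mono) auto
      then show "C \<le> (C + C') * (real n + 1)\<^sup>2" by simp
    qed simp
    show "L1_norm {a..b} (U n 1) \<le> ennreal ((C + C') * (real n + 1)\<^sup>2)"
      by (rule order_trans[OF C'(2)], rule ennreal_leI, rule mult_mono) (use C C' sq(1) in auto)
  qed (use C C' derivs_measurable[OF U(1)] derivs_increment_le[OF U(1), of 0] in auto)
qed

section \<open>Logarithmic examples\<close>

text \<open>Integrates functions with a logarithmic singularity at an end point: the antiderivative
  is continuous on the closed interval and differentiable only inside.\<close>

lemma L1_norm_FTC:
  assumes "a \<le> b" "continuous_on {a..b} F"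
    "\<And>x. x \<in> {a<..<b} \<Longrightarrow> (F has_real_derivative v x) (at x)"
    "\<And>x. x \<in> {a<..<b} \<Longrightarrow> \<bar>f x\<bar> \<le> v x"
  shows "L1_norm {a..b} f \<le> ennreal (F b - F a)"
proof -
  have "(v has_integral (F b - F a)) {a..b}"
    by (rule fundamental_theorem_of_calculus_interior)
       (use assms in \<open>auto simp: has_real_derivative_iff_has_vector_derivative\<close>)
  then have "(v has_integral (F b - F a)) {a<..<b}" by (simp add: has_integral_Icc_iff_Ioo)
  then have "(\<integral>\<^sup>+x. ennreal (v x) * indicator {a<..<b} x \<partial>lborel) = ennreal (F b - F a)"
    by (rule nn_integral_has_integral_lebesgue'[rotated]) (use assms(4) in force)
  moreover have "L1_norm {a..b} f = L1_norm {a<..<b} f"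
    unfolding L1_norm_def using AE_endpoints[of a b]
    by (intro nn_integral_cong_AE, elim eventually_mono) (auto simp: indicator_def)
  moreover have "L1_norm {a<..<b} f \<le> (\<integral>\<^sup>+x. ennreal (v x) * indicator {a<..<b} x \<partial>lborel)"
    unfolding L1_norm_def using assms(4)
    by (intro nn_integral_mono) (auto simp: indicator_def intro: ennreal_leI)
  ultimately show ?thesis by simp
qed

section \<open>Growth at the left end point\<close>

lemma L1_norm_ge:
  assumes "0 \<le> m" "p \<le> q" "\<And>x. x \<in> {p<..q} \<Longrightarrow> m \<le> \<bar>f x\<bar>"
  shows "ennreal (m * (q - p)) \<le> L1_norm {p..q} f"
proof -
  have "ennreal (m * (q - p)) = (\<integral>\<^sup>+x. ennreal m * indicator {p<..q} x \<partial>lborel)"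
    using assms by (simp add: nn_integral_cmult_indicator ennreal_mult)
  also have "\<dots> \<le> L1_norm {p..q} f"
    unfolding L1_norm_def using assms(3)
    by (intro nn_integral_mono) (auto simp: indicator_def intro: ennreal_leI)
  finally show ?thesis .
qed

text \<open>The one-dimensional Sobolev bound: the oscillation is at most \<open>Q\<close>, so |U 0|
  is at least |U 0 x| - Q everywhere, and integrating this over the interval bounds it by the
  mean.\<close>

lemma derivs_sup_bound:
  assumes "a < b" "derivs 1 U" "0 \<le> Q" "L1_norm {a..b} (U 1) \<le> ennreal Q"
    "0 \<le> P" "L1_norm {a..b} (U 0) \<le> ennreal P" "x \<in> {a..b}"
  shows "\<bar>U 0 x\<bar> \<le> Q + P / (b - a)"
proof (cases "\<bar>U 0 x\<bar> \<le> Q")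
  case True
  then show ?thesis using assms by (intro order_trans[OF True]) simp
next
  case False
  have incr: "\<bar>U 0 q - U 0 p\<bar> \<le> Q" if "p \<le> q" "p \<in> {a..b}" "q \<in> {a..b}" for p q
  proof -
    have "ennreal \<bar>U 0 q - U 0 p\<bar> \<le> L1_norm {p..q} (U 1)"
      using derivs_increment_le[OF assms(2), of 0 p q] that by (simp add: L1_norm_def)
    also have "\<dots> \<le> L1_norm {a..b} (U 1)" using that by (intro L1_norm_subset) auto
    also have "\<dots> \<le> ennreal Q" by (rule assms)
    finally show ?thesis using assms(3) by (simp add: ennreal_le_iff)
  qed
  have "ennreal ((\<bar>U 0 x\<bar> - Q) * (b - a)) \<le> L1_norm {a..b} (U 0)"
  proof (rule L1_norm_ge)
    show "\<bar>U 0 x\<bar> - Q \<le> \<bar>U 0 y\<bar>" if "y \<in> {a<..b}" for y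
      using incr[of x y] incr[of y x] assms(7) that by (cases "x \<le> y") auto
  qed (use False assms in auto)
  also have "\<dots> \<le> ennreal P" by (rule assms)
  finally have "(\<bar>U 0 x\<bar> - Q) * (b - a) \<le> P" using assms(5) by (simp add: ennreal_le_iff)
  then have "\<bar>U 0 x\<bar> - Q \<le> P / (b - a)" using assms(1) by (simp add: pos_le_divide_eq)
  then show ?thesis by simp
qed

text \<open>On a short interval g is a bounded function of height
  \<open>Q + (e + G) / (b - a)\<close> up to an error of norm \<open>e\<close>. The choice of
  approximation then balances height against error.\<close>

lemma L1_norm_left_end_bound:
  assumes "a < b" and g[measurable]: "g \<in> borel_measurable borel" and U: "derivs 1 U"
    and Q: "0 \<le> Q" "L1_norm {a..b} (U 1) \<le> ennreal Q"
    and e: "0 \<le> e" "L1_norm {a..b} (\<lambda>x. U 0 x - g x) \<le> ennreal e"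
    and G: "0 \<le> G" "L1_norm {a..b} g \<le> ennreal G" and \<delta>: "0 < \<delta>" "\<delta> \<le> b - a"
  shows "L1_norm {a..a + \<delta>} g \<le> ennreal ((Q + (e + G) / (b - a)) * \<delta> + e)"
proof -
  define M where "M = Q + (e + G) / (b - a)"
  have M: "0 \<le> M" using assms by (simp add: M_def)
  have [measurable]: "U 0 \<in> borel_measurable borel" using derivs_measurable[OF U, of 0] by simp
  have "L1_norm {a..b} (U 0) \<le> L1_norm {a..b} (\<lambda>x. U 0 x - g x) + L1_norm {a..b} g"
    by (rule L1_norm_triangle) auto
  also have "\<dots> \<le> ennreal e + ennreal G" by (intro add_mono e G)
  also have "\<dots> = ennreal (e + G)" using e G by simp
  finally have sup: "\<bar>U 0 x\<bar> \<le> M" if "x \<in> {a..b}" for x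
    unfolding M_def using derivs_sup_bound[OF assms(1) U Q _ _ that] e G by simp
  have "L1_norm {a..a + \<delta>} g \<le> L1_norm {a..a + \<delta>} (\<lambda>x. M) + L1_norm {a..a + \<delta>} (\<lambda>x. U 0 x - g x)"
  proof (rule L1_norm_triangle)
    show "\<bar>g x\<bar> \<le> \<bar>M\<bar> + \<bar>U 0 x - g x\<bar>" if "x \<in> {a..a + \<delta>}" for x
      using sup[of x] that \<delta> by auto
  qed auto
  also have "L1_norm {a..a + \<delta>} (\<lambda>x. M) = ennreal (M * \<delta>)"
    unfolding L1_norm_def using M \<delta> by (simp add: nn_integral_cmult_indicator ennreal_mult)
  also have "L1_norm {a..a + \<delta>} (\<lambda>x. U 0 x - g x) \<le> L1_norm {a..b} (\<lambda>x. U 0 x - g x)"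
    using \<delta> by (intro L1_norm_subset) auto
  also have "\<dots> \<le> ennreal e" by (rule e)
  finally show ?thesis using M \<delta> e by (simp add: M_def add_left_mono)
qed

lemma borel_version_bound:
  assumes "borel_version a b g g'"
  obtains G where "0 \<le> G" "L1_norm {a..b} g' \<le> ennreal G"
proof -
  have "L1_norm {a..b} g' \<le> L1_norm UNIV g'" by (rule L1_norm_subset) simp
  also have "\<dots> = ennreal (enn2real (L1_norm UNIV g'))"
    using borel_version_finite[OF assms] by simp
  finally show ?thesis by (rule that[rotated]) simp
qed

lemma S1_left_end_growth:
  assumes "a < b" "g \<in> S_space 1 a b" and g': "borel_version a b g g'"
  obtains B where "0 \<le> B" "\<And>\<delta>. 0 < \<delta> \<Longrightarrow> \<delta> \<le> b - a \<Longrightarrow> L1_norm {a..a + \<delta>} g' \<le> ennreal (B * \<delta>)"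
proof -
  obtain C U where "dyadic_approx a b 1 g' C U" using S_space_imp_dyadic_approx[OF assms(1,2) g'] .
  then have C: "0 \<le> C" and U: "derivs 1 (U n)" "L1_norm {a..b} (U n 1) \<le> ennreal C"
      "L1_norm {a..b} (\<lambda>x. U n 0 x - g' x) \<le> ennreal (C / 2 ^ n)" for n
    by (auto simp: dyadic_approx_def)
  obtain G where G: "0 \<le> G" "L1_norm {a..b} g' \<le> ennreal G" using borel_version_bound[OF g'] .
  show ?thesis
  proof (rule that[of "C + (C + G) / (b - a) + 1"])
    show "0 \<le> C + (C + G) / (b - a) + 1" using C G assms by simp
    fix \<delta> assume \<delta>: "0 < \<delta>" "\<delta> \<le> b - a"
    \<comment> \<open>With Q fixed, the approximation can be taken so fine that its error is below
      the interval length.\<close>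
    obtain n where "C / \<delta> < 2 ^ n" using real_arch_pow[of 2 "C / \<delta>"] by auto
    then have n: "C / 2 ^ n \<le> \<delta>" using \<delta> by (simp add: field_simps)
    have "C / 2 ^ n \<le> C / 1" using C by (intro divide_left_mono) auto
    then have "(C / 2 ^ n + G) / (b - a) \<le> (C + G) / (b - a)" using assms(1) by (intro divide_right_mono) auto
    then have "(C + (C / 2 ^ n + G) / (b - a)) * \<delta> \<le> (C + (C + G) / (b - a)) * \<delta>" using \<delta> by (intro mult_right_mono) auto
    then have "(C + (C / 2 ^ n + G) / (b - a)) * \<delta> + C / 2 ^ n \<le> (C + (C + G) / (b - a) + 1) * \<delta>"
      using n by (simp add: distrib_right)
    then show "L1_norm {a..a + \<delta>} g' \<le> ennreal ((C + (C + G) / (b - a) + 1) * \<delta>)"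
      using L1_norm_left_end_bound[OF assms(1) borel_version_measurable[OF g'] U(1) C U(2) _ U(3) G \<delta>, of n] C
      by (auto intro: order_trans ennreal_leI)
  qed
qed

text \<open>Here a finer approximation costs height, so level n is matched with length (b - a) /
  2^n: the error is then of the size of the length, and the height is O(n).\<close>

lemma S2_left_end_growth:
  assumes "a < b" "g \<in> S_space 2 a b" and g': "borel_version a b g g'"
  obtains B where "0 \<le> B" "\<And>n. L1_norm {a..a + (b - a) / 2 ^ n} g' \<le> ennreal (B * (real n + 1) / 2 ^ n)"
proof -
  obtain C U where CU: "dyadic_approx a b 2 g' C U" using S_space_imp_dyadic_approx[OF assms(1,2) g'] .
  then have C: "0 \<le> C" and U: "derivs 2 (U n)" "L1_norm {a..b} (\<lambda>x. U n 0 x - g' x) \<le> ennreal (C / 2 ^ n)" for n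
    by (auto simp: dyadic_approx_def)
  obtain C' where C': "0 \<le> C'" "\<And>n. L1_norm {a..b} (U n 1) \<le> ennreal (C' * (real n + 1))"
    using dyadic_approx_deriv1[OF assms(1) borel_version_measurable[OF g'] CU] by blast
  obtain G where G: "0 \<le> G" "L1_norm {a..b} g' \<le> ennreal G" using borel_version_bound[OF g'] .
  define L where "L = b - a"
  have L: "0 < L" using assms(1) by (simp add: L_def)
  show ?thesis
  proof (rule that[of "C' * L + (C + G) + C"])
    show "0 \<le> C' * L + (C + G) + C" using C C' G L by simp
    fix n
    have "L / 2 ^ n \<le> L / 1" using L by (intro divide_left_mono) auto
    then have \<delta>: "0 < L / 2 ^ n" "L / 2 ^ n \<le> b - a" using L by (auto simp: L_def)
    have "C / 2 ^ n \<le> C / 1" using C by (intro divide_left_mono) auto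
    then have "(C / 2 ^ n + G) / L \<le> (C + G) / L" using L by (intro divide_right_mono) auto
    then have "(C' * (real n + 1) + (C / 2 ^ n + G) / L) * (L / 2 ^ n) \<le> (C' * (real n + 1) + (C + G) / L) * (L / 2 ^ n)"
      using L by (intro mult_right_mono) auto
    also have "\<dots> = (C' * L * (real n + 1) + (C + G)) / 2 ^ n" using L by (simp add: field_simps)
    finally have "(C' * (real n + 1) + (C / 2 ^ n + G) / L) * (L / 2 ^ n) + C / 2 ^ n \<le> (C' * L * (real n + 1) + (C + G) + C) / 2 ^ n"
      by (simp add: add_divide_distrib)
    also have "\<dots> \<le> (C' * L + (C + G) + C) * (real n + 1) / 2 ^ n"
      using C G by (intro divide_right_mono) (simp_all add: distrib_left distrib_right)
    finally have le: "(C' * (real n + 1) + (C / 2 ^ n + G) / L) * (L / 2 ^ n) + C / 2 ^ n \<le> (C' * L + (C + G) + C) * (real n + 1) / 2 ^ n" .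
    have "L1_norm {a..a + L / 2 ^ n} g' \<le> ennreal ((C' * (real n + 1) + (C / 2 ^ n + G) / L) * (L / 2 ^ n) + C / 2 ^ n)"
      using L1_norm_left_end_bound[OF assms(1) borel_version_measurable[OF g'] derivs_le[OF U(1) one_le_numeral] _ C'(2) _ U(2) G \<delta>] C C'
      by (simp add: L_def)
    then show "L1_norm {a..a + (b - a) / 2 ^ n} g' \<le> ennreal ((C' * L + (C + G) + C) * (real n + 1) / 2 ^ n)"
      unfolding L_def[symmetric] by (rule order_trans[OF _ ennreal_leI[OF le]])
  qed
qed

lemma L1_borel_version_self:
  assumes [measurable]: "g \<in> borel_measurable borel" and "L1_norm {a..b} g < \<infinity>" and z: "\<And>x. x \<notin> {a<..<b} \<Longrightarrow> g x = 0"
  shows "g \<in> L1 a b" "borel_version a b g g"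
proof -
  have "L1_norm UNIV g = L1_norm {a..b} g"
    unfolding L1_norm_def by (intro nn_integral_cong) (use z in \<open>auto simp: indicator_def\<close>)
  then have i: "integrable lborel g" using assms(2) by (simp add: integrable_iff_bounded L1_norm_UNIV)
  then show "borel_version a b g g" using z by (simp add: borel_version_def)
  have "(\<lambda>x. indicator {a<..<b} x *\<^sub>R g x) = g" using z by (auto simp: fun_eq_iff indicator_def)
  then show "g \<in> L1 a b" using i by (simp add: L1_def set_integrable_def integrable_completion)
qed

lemma continuous_on_left_end:
  fixes F :: "real \<Rightarrow> real"
  assumes "\<And>t. 0 < t \<Longrightarrow> isCont F t" "(F \<longlongrightarrow> F 0) (at_right 0)"
  shows "continuous_on {0..} F"
  unfolding continuous_on_def
proof
  fix t :: real assume t: "t \<in> {0..}"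
  show "(F \<longlongrightarrow> F t) (at t within {0..})"
  proof (cases "t = 0")
    case True
    have "at (0::real) within {0..} = at_right 0" by (auto simp: at_within_def intro!: arg_cong2[where f=inf] arg_cong[where f=principal])
    then show ?thesis using assms True by simp
  next
    case False
    then show ?thesis using assms(1)[of t] t by (auto simp: isCont_def intro: tendsto_within_subset)
  qed
qed

lemma inverse_one_plus_square_quotient:
  fixes t \<epsilon> :: real assumes "\<epsilon> \<noteq> 0"
  shows "inverse (1 + (t / \<epsilon>)\<^sup>2) = \<epsilon>\<^sup>2 / (t\<^sup>2 + \<epsilon>\<^sup>2)"
proof -
  have "1 + (t / \<epsilon>)\<^sup>2 = (t\<^sup>2 + \<epsilon>\<^sup>2) / \<epsilon>\<^sup>2"
    using assms by (simp add: power_divide add_divide_distrib)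
  then show ?thesis by (simp add: inverse_eq_divide)
qed

text \<open>\<open>U \<epsilon> 0\<close> is the real part of the complex logarithm at x - a +
  i\<epsilon>, with its first two derivatives listed explicitly.\<close>

lemma log_in_S2_not_S1:
  assumes "a < b"
  obtains g where "g \<in> S_space 2 a b" "g \<notin> S_space 1 a b"
proof -
  define L where "L = b - a"
  have L: "0 < L" using assms by (simp add: L_def)
  define g where "g x = indicator {a<..<b} x * ln (x - a)" for x
  have gm[measurable]: "g \<in> borel_measurable borel" unfolding g_def[abs_def] by measurable
  \<comment> \<open>A smooth approximation of the logarithm whose error is \<open>O(\<epsilon>)\<close>; the simpler \<open>ln (x - a + \<epsilon>)\<close> would
    lose a factor \<open>log (1/\<epsilon>)\<close>.\<close>
  define U where "U \<epsilon> i x = (if i = 0 then ln ((x - a)\<^sup>2 + \<epsilon>\<^sup>2) / 2 else if i = 1 then (x - a) / ((x - a)\<^sup>2 + \<epsilon>\<^sup>2)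
    else (\<epsilon>\<^sup>2 - (x - a)\<^sup>2) / ((x - a)\<^sup>2 + \<epsilon>\<^sup>2)\<^sup>2)" for \<epsilon> x :: real and i :: nat
  have pos: "0 < (x - a)\<^sup>2 + \<epsilon>\<^sup>2" if "0 < \<epsilon>" for x \<epsilon> :: real
    using that by (simp add: add_nonneg_pos)
  have der: "derivs 2 (U \<epsilon>)" if \<epsilon>: "0 < \<epsilon>" for \<epsilon>
    unfolding derivs_def
  proof (intro conjI allI impI)
    fix i :: nat and x assume "i < 2"
    have \<epsilon>0: "\<epsilon> \<noteq> 0" using \<epsilon> by simp
    have nz: "(x - a)\<^sup>2 + \<epsilon>\<^sup>2 \<noteq> 0" by (rule less_imp_neq[OF pos[OF \<epsilon>], symmetric])
    have "((\<lambda>x. ln ((x - a)\<^sup>2 + \<epsilon>\<^sup>2) / 2) has_real_derivative (x - a) / ((x - a)\<^sup>2 + \<epsilon>\<^sup>2)) (at x)"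
      using pos[OF \<epsilon>, of x] \<epsilon>0 by (auto intro!: derivative_eq_intros simp: field_simps)
    moreover have "((\<lambda>x. (x - a) / ((x - a)\<^sup>2 + \<epsilon>\<^sup>2)) has_real_derivative (\<epsilon>\<^sup>2 - (x - a)\<^sup>2) / ((x - a)\<^sup>2 + \<epsilon>\<^sup>2)\<^sup>2) (at x)"
      using nz by (auto intro!: derivative_eq_intros simp: field_simps power2_eq_square)
    moreover have "i = 0 \<or> i = 1" using \<open>i < 2\<close> by auto
    ultimately show "(U \<epsilon> i has_real_derivative U \<epsilon> (Suc i) x) (at x)"
      by (auto simp: U_def[abs_def])
  next
    have "(x - a)\<^sup>2 + \<epsilon>\<^sup>2 \<noteq> 0" for x by (rule less_imp_neq[OF pos[OF \<epsilon>], symmetric])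
    then show "continuous_on UNIV (U \<epsilon> 2)" unfolding U_def[abs_def]
      by (auto intro!: continuous_intros)
  qed
  \<comment> \<open>The second derivative is dominated by 1 / (t^2 + \<epsilon>^2) with t = x - a,
    whose integral is an arctan divided by \<epsilon>; 2 is a crude bound for pi/2.\<close>
  have U2: "L1_norm {a..b} (U \<epsilon> 2) \<le> ennreal (2 / \<epsilon>)" if \<epsilon>: "0 < \<epsilon>" for \<epsilon>
  proof -
    have "L1_norm {a..b} (U \<epsilon> 2) \<le> ennreal (arctan ((b - a) / \<epsilon>) / \<epsilon> - arctan ((a - a) / \<epsilon>) / \<epsilon>)"
    proof (rule L1_norm_FTC[where v = "\<lambda>x. 1 / ((x - a)\<^sup>2 + \<epsilon>\<^sup>2)"])
      show "continuous_on {a..b} (\<lambda>x. arctan ((x - a) / \<epsilon>) / \<epsilon>)"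
        using \<epsilon> by (intro continuous_intros) auto
      fix x
      have "inverse (1 + ((x - a) / \<epsilon>)\<^sup>2) / \<epsilon> / \<epsilon> = 1 / ((x - a)\<^sup>2 + \<epsilon>\<^sup>2)"
        using \<epsilon> by (simp add: inverse_one_plus_square_quotient power2_eq_square[of \<epsilon>])
      then show "((\<lambda>x. arctan ((x - a) / \<epsilon>) / \<epsilon>) has_real_derivative 1 / ((x - a)\<^sup>2 + \<epsilon>\<^sup>2)) (at x)"
        using \<epsilon> by (auto intro!: derivative_eq_intros)
      have "\<bar>\<epsilon>\<^sup>2 - (x - a)\<^sup>2\<bar> \<le> (x - a)\<^sup>2 + \<epsilon>\<^sup>2" by (auto simp: abs_le_iff)
      then have "\<bar>\<epsilon>\<^sup>2 - (x - a)\<^sup>2\<bar> / ((x - a)\<^sup>2 + \<epsilon>\<^sup>2)\<^sup>2 \<le> ((x - a)\<^sup>2 + \<epsilon>\<^sup>2) / ((x - a)\<^sup>2 + \<epsilon>\<^sup>2)\<^sup>2"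
        by (rule divide_right_mono) simp
      then show "\<bar>U \<epsilon> 2 x\<bar> \<le> 1 / ((x - a)\<^sup>2 + \<epsilon>\<^sup>2)"
        using \<epsilon> by (simp add: U_def power2_eq_square[of "(x - a)\<^sup>2 + \<epsilon>\<^sup>2"] split: if_splits)
    qed (use assms in auto)
    also have "\<dots> \<le> ennreal (2 / \<epsilon>)"
    proof (intro ennreal_leI)
      have "arctan ((b - a) / \<epsilon>) \<le> 2" using arctan_ubound[of "(b - a) / \<epsilon>"] pi_less_4 by linarith
      then have "arctan ((b - a) / \<epsilon>) / \<epsilon> \<le> 2 / \<epsilon>" using \<epsilon> by (intro divide_right_mono) auto
      then show "arctan ((b - a) / \<epsilon>) / \<epsilon> - arctan ((a - a) / \<epsilon>) / \<epsilon> \<le> 2 / \<epsilon>" by simp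
    qed
    finally show ?thesis .
  qed
  have U0: "L1_norm {a..b} (\<lambda>x. U \<epsilon> 0 x - g x) \<le> ennreal ((1 / (2 * L) + 2) * \<epsilon>)" if \<epsilon>: "0 < \<epsilon>" "\<epsilon> \<le> 1" for \<epsilon>
  proof -
    \<comment> \<open>Antiderivative of the error in t = x - a. The arctan term cancels what remains
      after differentiating the first two, and F 0 = 0 because t multiplies both logarithms.\<close>
    define F where "F t = t / 2 * ln (t\<^sup>2 + \<epsilon>\<^sup>2) - t * ln t + \<epsilon> * arctan (t / \<epsilon>)" for t
    have tp: "0 < t\<^sup>2 + \<epsilon>\<^sup>2" for t using \<epsilon> by (simp add: add_nonneg_pos)
    have dF: "(F has_real_derivative ln (t\<^sup>2 + \<epsilon>\<^sup>2) / 2 - ln t) (at t)" if t: "0 < t" for t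
    proof -
      have "(F has_real_derivative (1/2 * ln (t\<^sup>2 + \<epsilon>\<^sup>2) + t / 2 * (2 * t / (t\<^sup>2 + \<epsilon>\<^sup>2))) - (ln t + 1) + \<epsilon> * (inverse (1 + (t / \<epsilon>)\<^sup>2) / \<epsilon>)) (at t)"
        unfolding F_def[abs_def] using t tp[of t] \<epsilon> by (auto intro!: derivative_eq_intros)
      moreover have "\<epsilon> * (inverse (1 + (t / \<epsilon>)\<^sup>2) / \<epsilon>) = \<epsilon>\<^sup>2 / (t\<^sup>2 + \<epsilon>\<^sup>2)"
        using \<epsilon> by (simp add: inverse_one_plus_square_quotient)
      moreover have "t / 2 * (2 * t / (t\<^sup>2 + \<epsilon>\<^sup>2)) + \<epsilon>\<^sup>2 / (t\<^sup>2 + \<epsilon>\<^sup>2) = 1"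
        using tp[of t] \<epsilon> by (simp add: power2_eq_square flip: add_divide_distrib)
      ultimately show ?thesis by (elim DERIV_cong) linarith
    qed
    have cF: "continuous_on {0..} F"
    proof (rule continuous_on_left_end)
      show "isCont F t" if "0 < t" for t using dF[OF that] by (rule DERIV_isCont)
      show "(F \<longlongrightarrow> F 0) (at_right 0)" unfolding F_def using \<epsilon> by simp real_asymp
    qed
    have "L1_norm {a..b} (\<lambda>x. U \<epsilon> 0 x - g x) \<le> ennreal (F (b - a) - F (a - a))"
    proof (rule L1_norm_FTC[where v = "\<lambda>x. ln ((x - a)\<^sup>2 + \<epsilon>\<^sup>2) / 2 - ln (x - a)"])
      show "continuous_on {a..b} (\<lambda>x. F (x - a))"
        by (rule continuous_on_compose2[OF cF]) (auto intro: continuous_intros)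
      fix x assume x: "x \<in> {a<..<b}"
      show "((\<lambda>x. F (x - a)) has_real_derivative ln ((x - a)\<^sup>2 + \<epsilon>\<^sup>2) / 2 - ln (x - a)) (at x)"
        using DERIV_shift[of F _ x "- a"] dF[of "x - a"] x by simp
      have "2 * ln (x - a) = ln ((x - a)\<^sup>2)" using x by (simp add: ln_realpow)
      also have "\<dots> \<le> ln ((x - a)\<^sup>2 + \<epsilon>\<^sup>2)" using x tp[of "x - a"] by (intro ln_mono) auto
      finally show "\<bar>U \<epsilon> 0 x - g x\<bar> \<le> ln ((x - a)\<^sup>2 + \<epsilon>\<^sup>2) / 2 - ln (x - a)"
        using x by (simp add: U_def g_def)
    qed (use assms in auto)
    also have "F (b - a) - F (a - a) = L / 2 * ln (1 + (\<epsilon> / L)\<^sup>2) + \<epsilon> * arctan (L / \<epsilon>)"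
    proof -
      have "L\<^sup>2 + \<epsilon>\<^sup>2 = L\<^sup>2 * (1 + (\<epsilon> / L)\<^sup>2)" using L by (simp add: field_simps)
      moreover have "0 < 1 + (\<epsilon> / L)\<^sup>2" by (simp add: add_pos_nonneg)
      ultimately have "ln (L\<^sup>2 + \<epsilon>\<^sup>2) = ln (L\<^sup>2) + ln (1 + (\<epsilon> / L)\<^sup>2)"
        using L by (simp only: ln_mult_pos zero_less_power)
      then have "ln (L\<^sup>2 + \<epsilon>\<^sup>2) = 2 * ln L + ln (1 + (\<epsilon> / L)\<^sup>2)" using L by (simp add: ln_realpow)
      then show ?thesis by (simp add: F_def L_def[symmetric] algebra_simps)
    qed
    also have "ennreal \<dots> \<le> ennreal ((1 / (2 * L) + 2) * \<epsilon>)"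
    proof (rule ennreal_leI)
      have "L / 2 * ln (1 + (\<epsilon> / L)\<^sup>2) \<le> L / 2 * (\<epsilon> / L)\<^sup>2"
        using L by (intro mult_left_mono ln_add_one_self_le_self) auto
      also have "\<dots> = \<epsilon> * (\<epsilon> / (2 * L))" using L by (simp add: field_simps power2_eq_square)
      \<comment> \<open>Uses \<epsilon> <= 1, which holds for all dyadic levels.\<close>
      also have "\<dots> \<le> \<epsilon> * (1 / (2 * L))" using \<epsilon> L by (intro mult_left_mono divide_right_mono) auto
      finally have 1: "L / 2 * ln (1 + (\<epsilon> / L)\<^sup>2) \<le> \<epsilon> * (1 / (2 * L))" .
      have "arctan (L / \<epsilon>) \<le> 2" using arctan_ubound[of "L / \<epsilon>"] pi_less_4 by linarith
      then have "\<epsilon> * arctan (L / \<epsilon>) \<le> \<epsilon> * 2" using \<epsilon> by (intro mult_left_mono) auto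
      with 1 show "L / 2 * ln (1 + (\<epsilon> / L)\<^sup>2) + \<epsilon> * arctan (L / \<epsilon>) \<le> (1 / (2 * L) + 2) * \<epsilon>"
        by (simp add: algebra_simps)
    qed
    finally show ?thesis .
  qed
  have "L1_norm {a..b} g < \<infinity>"
  proof -
    have Um[measurable]: "U 1 0 \<in> borel_measurable borel" using derivs_measurable[OF der, of 1 0] by simp
    have "L1_norm {a..b} g \<le> L1_norm {a..b} (\<lambda>x. U 1 0 x - g x) + L1_norm {a..b} (U 1 0)"
      by (rule L1_norm_triangle) auto
    also have "\<dots> < \<infinity>"
      using U0[of 1] L1_norm_continuous_finite[OF continuous_on_subset[OF derivs_continuous[OF der, of 1 0]], of a b]
      by (auto intro: le_less_trans)
    finally show ?thesis .
  qed
  note g = L1_borel_version_self[OF gm this]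
  have gL1: "g \<in> L1 a b" and gv: "borel_version a b g g" by (intro g; simp add: g_def)+
  show ?thesis
  proof (rule that[of g])
    show "g \<in> S_space 2 a b"
    proof (rule S_spaceI[OF assms gL1 gv, of "1 / (2 * L) + 2"])
      show "0 \<le> 1 / (2 * L) + 2" using L by simp
      fix n
      have "2 / (1 / 2 ^ n) \<le> (1 / (2 * L) + 2) * (2 ^ (2 - 1)) ^ n" using L by (simp add: algebra_simps)
      then have "L1_norm {a..b} (U (1 / 2 ^ n) 2) \<le> ennreal ((1 / (2 * L) + 2) * (2 ^ (2 - 1)) ^ n)"
        using U2[of "1 / 2 ^ n"] by (auto intro: order_trans ennreal_leI)
      moreover have "L1_norm {a..b} (\<lambda>x. U (1 / 2 ^ n) 0 x - g x) \<le> ennreal ((1 / (2 * L) + 2) / 2 ^ n)"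
        using U0[of "1 / 2 ^ n"] by simp
      ultimately show "\<exists>U. derivs 2 U \<and> L1_norm {a..b} (U 2) \<le> ennreal ((1 / (2 * L) + 2) * (2 ^ (2 - 1)) ^ n) \<and>
          L1_norm {a..b} (\<lambda>x. U 0 x - g x) \<le> ennreal ((1 / (2 * L) + 2) / 2 ^ n)"
        using der[of "1 / 2 ^ n"] by auto
    qed
    show "g \<notin> S_space 1 a b"
    proof
      assume "g \<in> S_space 1 a b"
      then obtain B where B: "0 \<le> B" "\<And>\<delta>. 0 < \<delta> \<Longrightarrow> \<delta> \<le> b - a \<Longrightarrow> L1_norm {a..a + \<delta>} g \<le> ennreal (B * \<delta>)"
        using S1_left_end_growth[OF assms _ gv] by blast
      \<comment> \<open>The exponential forces |g| >= B + 1 on the short interval, against the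
        growth bound B; L/2 keeps the interval inside (a,b), where g is the logarithm.\<close>
      define \<delta> where "\<delta> = min (exp (- (B + 1))) (L / 2)"
      have "0 < \<delta>" "\<delta> \<le> L / 2" "\<delta> \<le> exp (- (B + 1))"
        using L by (simp_all only: \<delta>_def min.cobounded1 min.cobounded2 min_less_iff_conj exp_gt_zero half_gt_zero)
      then have \<delta>: "0 < \<delta>" "\<delta> < b - a" "\<delta> \<le> exp (- (B + 1))" using L by (auto simp: L_def)
      have "ennreal ((B + 1) * (a + \<delta> - a)) \<le> L1_norm {a..a + \<delta>} g"
      proof (rule L1_norm_ge)
        fix x assume x: "x \<in> {a<..a + \<delta>}"
        have "ln (x - a) \<le> ln (exp (- (B + 1)))" using x \<delta> by (subst ln_le_cancel_iff) auto
        then show "B + 1 \<le> \<bar>g x\<bar>" using x \<delta> by (simp add: g_def)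
      qed (use B \<delta> in auto)
      also have "\<dots> \<le> ennreal (B * \<delta>)" using B(2)[of \<delta>] \<delta> by simp
      finally show False using B \<delta> by (simp add: ennreal_le_iff)
    qed
  qed
qed

text \<open>At level n the shifted functions have variation O(n^2) and error O(n^2 / 2^n), which
  \<open>W_s1_criterion\<close> tolerates for every s < 1. The mean of g near a, however, grows like
  n^2, beyond the O(n) allowed for S_2.\<close>

lemma log_square_in_W_not_S2:
  assumes "a < b"
  obtains g where "\<And>s. 0 < s \<Longrightarrow> s < 1 \<Longrightarrow> g \<in> W_s1 s a b" "g \<notin> S_space 2 a b"
proof -
  define L where "L = b - a"
  have L: "0 < L" using assms by (simp add: L_def)
  \<comment> \<open>Dividing by 2L keeps the logarithm nonpositive on (a,b) even after a shift by at
    most L, so that all the squares decrease in x.\<close>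
  define g where "g x = indicator {a<..<b} x * (ln ((x - a) / (2 * L)))\<^sup>2" for x
  have gm[measurable]: "g \<in> borel_measurable borel" unfolding g_def[abs_def] by measurable
  define \<epsilon> where "\<epsilon> n = L / 2 ^ n" for n :: nat
  have \<epsilon>: "0 < \<epsilon> n" "\<epsilon> n \<le> L" for n
  proof -
    have "L / 2 ^ n \<le> L / 1" using L by (intro divide_left_mono) auto
    then show "0 < \<epsilon> n" "\<epsilon> n \<le> L" using L by (auto simp: \<epsilon>_def)
  qed
  have ln\<epsilon>: "ln (\<epsilon> n / (2 * L)) = - ((real n + 1) * ln 2)" for n
  proof -
    have "\<epsilon> n / (2 * L) = inverse (2 ^ Suc n)" using L by (simp add: \<epsilon>_def field_simps)
    then show ?thesis by (simp add: ln_inverse ln_realpow del: power_Suc)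
  qed
  have ln2: "0 < ln (2::real)" "ln (2::real) \<le> 1" using ln_le_minus_one[of "2::real"] by auto
  \<comment> \<open>Unlike for the logarithm, a plain shift suffices here: the logarithmic loss in
    its error is covered by the weight (n+1)^2.\<close>
  define u where "u n x = (ln ((x - a + \<epsilon> n) / (2 * L)))\<^sup>2" for n x
  define w where "w n x = 2 * ln ((x - a + \<epsilon> n) / (2 * L)) / (x - a + \<epsilon> n)" for n x
  have um[measurable]: "u n \<in> borel_measurable borel" and wm: "w n \<in> borel_measurable borel" for n
    unfolding u_def[abs_def] w_def[abs_def] by measurable
  have du: "(u n has_real_derivative w n x) (at x)" if "a \<le> x" for n x
  proof -
    have "0 < x - a + \<epsilon> n" using that \<epsilon>(1)[of n] by simp
    then show ?thesis unfolding u_def[abs_def] w_def using L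
      by (auto intro!: derivative_eq_intros simp: field_simps)
  qed
  have w0: "w n x \<le> 0" if "x \<in> {a..b}" for n x
  proof -
    have "0 < x - a + \<epsilon> n" "x - a + \<epsilon> n \<le> 2 * L" using that \<epsilon>[of n] by (auto simp: L_def)
    then have "ln ((x - a + \<epsilon> n) / (2 * L)) \<le> 0" using L by (subst ln_le_zero_iff) (auto simp: divide_le_eq)
    then show ?thesis using \<open>0 < x - a + \<epsilon> n\<close> by (simp add: w_def divide_nonpos_pos)
  qed
  \<comment> \<open>As \<open>u n\<close> is decreasing, its variation is the difference of its end
    values, so no separate estimate of the derivative is called for.\<close>
  have uw: "0 \<le> u n x - u n y" "L1_norm {x..y} (w n) = ennreal (u n x - u n y)"
    if xy: "a \<le> x" "x \<le> y" "y \<le> b" for n x y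
  proof -
    have "(w n has_integral (u n y - u n x)) {x..y}"
      by (rule fundamental_theorem_of_calculus[OF xy(2)])
         (use du xy in \<open>auto simp: has_real_derivative_iff_has_vector_derivative intro: has_vector_derivative_at_within\<close>)
    from has_integral_neg[OF this] have i: "((\<lambda>t. - w n t) has_integral (u n x - u n y)) {x..y}"
      by simp
    then show "0 \<le> u n x - u n y" by (rule has_integral_nonneg) (use w0 xy in force)
    have "(\<integral>\<^sup>+t. ennreal (- w n t) * indicator {x..y} t \<partial>lborel) = ennreal (u n x - u n y)"
      by (rule nn_integral_has_integral_lebesgue'[OF _ i]) (use w0 xy in force)
    moreover have "ennreal \<bar>w n t\<bar> * indicator {x..y} t = ennreal (- w n t) * indicator {x..y} t" for t
      using w0[of t n] xy by (auto simp: indicator_def)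
    ultimately show "L1_norm {x..y} (w n) = ennreal (u n x - u n y)" by (simp add: L1_norm_def)
  qed
  \<comment> \<open>Antiderivative of the squared logarithm, with G 0 = 0.\<close>
  define G where "G t = t * ((ln (t / (2 * L)))\<^sup>2 - 2 * ln (t / (2 * L)) + 2)" for t
  have dG: "(G has_real_derivative (ln (t / (2 * L)))\<^sup>2) (at t)" if "0 < t" for t
    unfolding G_def[abs_def] using that L
    by (auto intro!: derivative_eq_intros simp: field_simps power2_eq_square)
  have cG: "continuous_on {0..} G"
  proof (rule continuous_on_left_end)
    show "isCont G t" if "0 < t" for t using dG[OF that] by (rule DERIV_isCont)
    show "(G \<longlongrightarrow> G 0) (at_right 0)" unfolding G_def using L by simp real_asymp
  qed
  have G\<epsilon>: "G (\<epsilon> n) \<le> 5 * L * (real n + 1)\<^sup>2 / 2 ^ n" for n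
  proof -
    define m where "m = (real n + 1) * ln 2"
    have m: "0 \<le> m" "m \<le> real n + 1" using ln2 by (auto simp: m_def mult_left_le)
    have "m\<^sup>2 \<le> (real n + 1)\<^sup>2" using m by (intro power_mono) auto
    moreover have "real n + 1 \<le> (real n + 1)\<^sup>2" "1 \<le> (real n + 1)\<^sup>2"
      by (simp_all add: power2_eq_square algebra_simps)
    \<comment> \<open>The constant is 5 = 1 + 2 + 2, each summand being compared with
      (n+1)^2.\<close>
    ultimately have "m\<^sup>2 + 2 * m + 2 \<le> 5 * (real n + 1)\<^sup>2" using m by linarith
    then have "\<epsilon> n * (m\<^sup>2 + 2 * m + 2) \<le> \<epsilon> n * (5 * (real n + 1)\<^sup>2)"
      using \<epsilon>(1)[of n] by (intro mult_left_mono) auto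
    also have "\<dots> = 5 * L * (real n + 1)\<^sup>2 / 2 ^ n" by (simp add: \<epsilon>_def)
    also have "\<epsilon> n * (m\<^sup>2 + 2 * m + 2) = G (\<epsilon> n)" by (simp add: G_def ln\<epsilon> m_def)
    finally show ?thesis .
  qed
  have ug: "L1_norm {a..b} (\<lambda>x. u n x - g x) \<le> ennreal (5 * L * (real n + 1)\<^sup>2 / 2 ^ n)" for n
  proof -
    have "L1_norm {a..b} (\<lambda>x. u n x - g x) \<le> ennreal ((G (b - a) - G (b - a + \<epsilon> n)) - (G (a - a) - G (a - a + \<epsilon> n)))"
    proof (rule L1_norm_FTC[where F = "\<lambda>x. G (x - a) - G (x - a + \<epsilon> n)"
          and v = "\<lambda>x. (ln ((x - a) / (2 * L)))\<^sup>2 - (ln ((x - a + \<epsilon> n) / (2 * L)))\<^sup>2"])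
      show "continuous_on {a..b} (\<lambda>x. G (x - a) - G (x - a + \<epsilon> n))"
        by (intro continuous_intros continuous_on_compose2[OF cG]) (use \<epsilon>(1)[of n] in auto)
      fix x assume x: "x \<in> {a<..<b}"
      have xe: "0 < x - a + \<epsilon> n" using x \<epsilon>(1)[of n] by simp
      have "((\<lambda>x. G (x - a)) has_real_derivative (ln ((x - a) / (2 * L)))\<^sup>2) (at x)"
        using DERIV_shift[of G _ x "- a"] dG[of "x - a"] x by simp
      moreover have "((\<lambda>x. G (x - a + \<epsilon> n)) has_real_derivative (ln ((x - a + \<epsilon> n) / (2 * L)))\<^sup>2) (at x)"
        using DERIV_shift[of G _ x "- a + \<epsilon> n"] dG[OF xe] by (simp add: algebra_simps)
      ultimately show "((\<lambda>x. G (x - a) - G (x - a + \<epsilon> n)) has_real_derivative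
          (ln ((x - a) / (2 * L)))\<^sup>2 - (ln ((x - a + \<epsilon> n) / (2 * L)))\<^sup>2) (at x)" by (rule DERIV_diff)
      have "ln ((x - a) / (2 * L)) \<le> ln ((x - a + \<epsilon> n) / (2 * L))"
        using x L \<epsilon>(1)[of n] by (subst ln_le_cancel_iff) (auto simp: divide_le_cancel)
      moreover have "ln ((x - a + \<epsilon> n) / (2 * L)) \<le> 0"
        using x L xe \<epsilon>(2)[of n] by (subst ln_le_zero_iff) (auto simp: divide_le_eq L_def)
      ultimately have "(ln ((x - a + \<epsilon> n) / (2 * L)))\<^sup>2 \<le> (ln ((x - a) / (2 * L)))\<^sup>2"
        by (simp add: abs_le_square_iff[symmetric])
      then show "\<bar>u n x - g x\<bar> \<le> (ln ((x - a) / (2 * L)))\<^sup>2 - (ln ((x - a + \<epsilon> n) / (2 * L)))\<^sup>2"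
        using x by (simp add: u_def g_def)
    qed (use assms in auto)
    also have "\<dots> \<le> ennreal (G (\<epsilon> n))"
    proof (rule ennreal_leI)
      \<comment> \<open>The error integral is G(L) - G(L + \<epsilon>) + G(\<epsilon>); monotonicity
        of \<open>G\<close> leaves only G(\<epsilon>).\<close>
      have "G L \<le> G (L + \<epsilon> n)"
      proof (rule DERIV_nonneg_imp_nondecreasing[where f = G])
        show "\<exists>y. (G has_real_derivative y) (at t) \<and> 0 \<le> y" if "L \<le> t" for t
          using dG[of t] L that by (intro exI[of _ "(ln (t / (2 * L)))\<^sup>2"]) simp
      qed (use \<epsilon>(1)[of n] in simp)
      then show "(G (b - a) - G (b - a + \<epsilon> n)) - (G (a - a) - G (a - a + \<epsilon> n)) \<le> G (\<epsilon> n)"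
        by (simp add: L_def[symmetric]) (simp add: G_def)
    qed
    also have "\<dots> \<le> ennreal (5 * L * (real n + 1)\<^sup>2 / 2 ^ n)" by (rule ennreal_leI[OF G\<epsilon>])
    finally show ?thesis .
  qed
  have "L1_norm {a..b} g < \<infinity>"
  proof -
    have c: "continuous_on {a..b} (u 0)"
      by (rule continuous_at_imp_continuous_on) (use DERIV_isCont[OF du[of _ 0]] in auto)
    have "L1_norm {a..b} g \<le> L1_norm {a..b} (\<lambda>x. u 0 x - g x) + L1_norm {a..b} (u 0)"
      by (rule L1_norm_triangle) auto
    also have "\<dots> < \<infinity>" using ug[of 0] L1_norm_continuous_finite[OF c] by (auto intro: le_less_trans)
    finally show ?thesis .
  qed
  note g = L1_borel_version_self[OF gm this]
  have gL1: "g \<in> L1 a b" and gv: "borel_version a b g g" by (intro g; simp add: g_def)+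
  show ?thesis
  proof (rule that[of g])
    show "g \<in> W_s1 s a b" if s: "0 < s" "s < 1" for s
    proof (rule W_s1_criterion[OF assms gL1 gv s _ um wm, of "5 * L + 1"])
      show "0 \<le> 5 * L + 1" using L by simp
      fix n
      show "ennreal \<bar>u n y - u n x\<bar> \<le> (\<integral>\<^sup>+t\<in>{x..y}. ennreal \<bar>w n t\<bar> \<partial>lborel)"
        if "a \<le> x" "x \<le> y" "y \<le> b" for x y
        using uw[OF that, of n] by (simp add: L1_norm_def)
      show "L1_norm {a..b} (\<lambda>x. u n x - g x) \<le> ennreal ((5 * L + 1) * (real n + 1)\<^sup>2 / 2 ^ n)"
        by (rule order_trans[OF ug], rule ennreal_leI, rule divide_right_mono) (auto intro: mult_right_mono)
      have "u n a = ((real n + 1) * ln 2)\<^sup>2" by (simp add: u_def ln\<epsilon>)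
      also have "\<dots> \<le> (real n + 1)\<^sup>2" using ln2 by (intro power_mono) (auto simp: mult_left_le)
      also have "\<dots> \<le> (5 * L + 1) * (real n + 1)\<^sup>2" using L by (simp add: distrib_right)
      finally have "u n a - u n b \<le> (5 * L + 1) * (real n + 1)\<^sup>2" by (simp add: u_def) (smt (verit) zero_le_power2)
      then show "L1_norm {a..b} (w n) \<le> ennreal ((5 * L + 1) * (real n + 1)\<^sup>2)"
        using uw(2)[of a b n] assms by (simp add: ennreal_leI)
    qed
    show "g \<notin> S_space 2 a b"
    proof
      assume "g \<in> S_space 2 a b"
      then obtain B where B: "0 \<le> B" "\<And>n. L1_norm {a..a + (b - a) / 2 ^ n} g \<le> ennreal (B * (real n + 1) / 2 ^ n)"
        using S2_left_end_growth[OF assms _ gv] by blast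
      \<comment> \<open>On (a, a + \<epsilon>] with \<epsilon> = L / 2^n the function is at least
        ((n+1) ln 2)^2; one factor n + 1 cancels against the growth bound and the other yields the
        contradiction. n >= 1 keeps the interval inside (a,b).\<close>
      have le: "L * (ln 2)\<^sup>2 * (real n + 1) \<le> B" if n: "n \<ge> 1" for n
      proof -
        have "\<epsilon> n \<le> L / 2 ^ 1" unfolding \<epsilon>_def using L n by (intro divide_left_mono power_increasing) auto
        then have "\<epsilon> n < b - a" using L by (simp add: L_def)
        have "ennreal (((real n + 1) * ln 2)\<^sup>2 * (a + \<epsilon> n - a)) \<le> L1_norm {a..a + \<epsilon> n} g"
        proof (rule L1_norm_ge)
          fix x assume x: "x \<in> {a<..a + \<epsilon> n}"
          have "ln ((x - a) / (2 * L)) \<le> ln (\<epsilon> n / (2 * L))"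
            using x L \<epsilon>(1)[of n] by (subst ln_le_cancel_iff) (auto simp: divide_le_cancel)
          then have "\<bar>(real n + 1) * ln 2\<bar> \<le> \<bar>ln ((x - a) / (2 * L))\<bar>" using ln2 by (simp add: ln\<epsilon>)
          then have "((real n + 1) * ln 2)\<^sup>2 \<le> (ln ((x - a) / (2 * L)))\<^sup>2" by (simp only: abs_le_square_iff)
          then show "((real n + 1) * ln 2)\<^sup>2 \<le> \<bar>g x\<bar>" using x \<open>\<epsilon> n < b - a\<close> by (simp add: g_def)
        qed (use \<epsilon>(1)[of n] in auto)
        also have "\<dots> \<le> ennreal (B * (real n + 1) / 2 ^ n)" using B(2)[of n] by (simp add: \<epsilon>_def L_def)
        finally have "((real n + 1) * ln 2)\<^sup>2 * \<epsilon> n \<le> B * (real n + 1) / 2 ^ n" using B(1) by (simp add: ennreal_le_iff)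
        moreover have "((real n + 1) * ln 2)\<^sup>2 * \<epsilon> n = (L * (ln 2)\<^sup>2 * (real n + 1)) * (real n + 1) / 2 ^ n"
          by (simp add: \<epsilon>_def power2_eq_square mult_ac)
        ultimately have "(L * (ln 2)\<^sup>2 * (real n + 1)) * (real n + 1) \<le> B * (real n + 1)"
          by (simp only: divide_le_cancel) simp
        then show ?thesis by (rule mult_right_le_imp_le) simp
      qed
      obtain N where "B / (L * (ln 2)\<^sup>2) < real N" using reals_Archimedean2 by blast
      then have "B < L * (ln 2)\<^sup>2 * real N" using L ln2 by (simp add: divide_less_eq mult.commute)
      moreover have "L * (ln 2)\<^sup>2 * real N \<le> L * (ln 2)\<^sup>2 * (real (Suc N) + 1)"
        using L by (intro mult_left_mono) auto
      ultimately show False using le[of "Suc N"] by simp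
    qed
  qed
qed

theorem theorem5p2:
  fixes a b :: real and k :: nat
  assumes "a < b" and "k \<ge> 2"
  shows "BV a b = S_space 1 a b
       \<and> S_space 1 a b \<subset> S_space 2 a b
       \<and> S_space 2 a b = S_space k a b
       \<and> S_space k a b \<subset> (\<Inter>s\<in>{0<..<1}. W_s1 s a b)"
proof (intro conjI)
  show "BV a b = S_space 1 a b"
    using S1_subset_BV[OF assms(1)] BV_subset_S1[OF assms(1)] by blast
  have "S_space 1 a b \<subseteq> S_space 2 a b"
    using S1_subset_S_space_Suc[OF assms(1), of 1] by (simp add: numeral_2_eq_2)
  moreover obtain g where "g \<in> S_space 2 a b" "g \<notin> S_space 1 a b" using log_in_S2_not_S1[OF assms(1)] .
  ultimately show "S_space 1 a b \<subset> S_space 2 a b" by blast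
  show eq: "S_space 2 a b = S_space k a b"
    using S2_subset_S_space[OF assms] S_space_subset_S2[OF assms] by blast
  have "S_space k a b \<subseteq> (\<Inter>s\<in>{0<..<1}. W_s1 s a b)"
    unfolding eq[symmetric] using S2_subset_W_s1[OF assms(1)] by fastforce
  moreover obtain g where g: "\<And>s. 0 < s \<Longrightarrow> s < 1 \<Longrightarrow> g \<in> W_s1 s a b" "g \<notin> S_space 2 a b"
    by (rule log_square_in_W_not_S2[OF assms(1)]) blast
  ultimately show "S_space k a b \<subset> (\<Inter>s\<in>{0<..<1}. W_s1 s a b)"
    unfolding eq[symmetric] by auto
qed

end
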